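(* (Provable in $\mathsf{C}$.) Suppose $\mathfrak S$ is a weakly satisfactory $\rho$-structure, $\Theta$ is a $\rho$-theory, $\sigma$ is a $\rho$-sentence, $\mathfrak S\models^*\Theta$, and $\Theta\vdash\sigma$. Then $\mathfrak S\models^*\sigma$.
   Context: $\mathsf{C}$ is Gödel–Bernays class theory $\mathsf{GB}$ with the Axiom of Infinity omitted. Structures and theories (classes of sentences) may be proper classes. For a class $\Phi$ of $\rho$-formulas, a $\Phi$-satisfaction relation for $\mathfrak S$ is the class of pairs $\langle\phi,A\rangle$ ($\phi$ a subformula of a member of $\Phi$, $A$ an $\mathfrak S$-assignment for $\phi$, i.e. a finite function into $|\mathfrak S|$ whose domain contains the free variables of $\phi$) at which $\phi$ is true according to a valuation obeying the usual Tarskian clauses; write $\models^S\phi[A]$ for $\langle\phi,A\rangle\in S$. $\mathfrak S$ is weakly satisfactory if for every $\rho$-formula $\phi$ a $\{\phi\}$-satisfaction relation for $\mathfrak S$ exists. Universal satisfaction: $\mathfrak S\models^*\phi[A]$ iff for every $\{\phi\}$-satisfaction relation $S$ for $\mathfrak S$, $\models^S\phi[A]$; for a theory $\Theta$, $\mathfrak S\models^*\Theta$ iff $\mathfrak S\models^*\theta$ for every $\theta\in\Theta$. *)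

theory Defs
  imports Main
begin

text \<open>
  The theory \<open>C\<close> (Goedel-Bernays class theory without the axiom of infinity) is given by a
  locale over one binary relation, so that a theorem assuming only the locale predicate for an
  arbitrary relation on an arbitrary type speaks about every model of \<open>C\<close>.  Everything
  syntactic and semantic below (natural numbers, finite sets, terms, formulas, substitution,
  proofs, assignments, satisfaction relations) is internal: it is a notion of the language of class
  theory, interpreted in the model.  In particular the natural numbers of the model need not be
  standard and need not form a set, and no internal notion is defined by HOL induction
  or by HOL quantification over predicates.
\<close>

section \<open>Predicative formulas of class theory\<close>

datatype pform =
    PMem nat nat
  | PEq nat nat
  | PNeg pform
  | PAnd pform pform
  | PAllSet nat pform

text \<open>Variables may denote arbitrary classes, but quantifiers range over sets only.\<close>

primrec psat :: "('c \<Rightarrow> 'c \<Rightarrow> bool) \<Rightarrow> (nat \<Rightarrow> 'c) \<Rightarrow> pform \<Rightarrow> bool" where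
  "psat E e (PMem i j) \<longleftrightarrow> E (e i) (e j)"
| "psat E e (PEq i j) \<longleftrightarrow> e i = e j"
| "psat E e (PNeg f) \<longleftrightarrow> \<not> psat E e f"
| "psat E e (PAnd f g) \<longleftrightarrow> psat E e f \<and> psat E e g"
| "psat E e (PAllSet i f) \<longleftrightarrow> (\<forall>x. (\<exists>y. E x y) \<longrightarrow> psat E (e(i := x)) f)"

section \<open>Signatures and structures\<close>

text \<open>
  The components are classes of the model.  A signature is the class function taking each
  relation symbol to its arity together with the same for function symbols (constants being the
  function symbols of arity 0); equality is a logical symbol.
\<close>

record 'c signature =
  rel_arity :: 'c
  fun_arity :: 'c

record 'c struct =
  universe :: 'c
  rel_int :: 'c
  fun_int :: 'c

section \<open>The language of class theory\<close>

locale class_language =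
  fixes mem :: "'c \<Rightarrow> 'c \<Rightarrow> bool"  (infix "\<epsilon>" 50)
begin

definition setp :: "'c \<Rightarrow> bool" where
  "setp x \<longleftrightarrow> (\<exists>y. x \<epsilon> y)"

abbreviation AllSet :: "('c \<Rightarrow> bool) \<Rightarrow> bool"  (binder "\<forall>\<^sub>s" 10) where
  "\<forall>\<^sub>s x. P x \<equiv> \<forall>x. setp x \<longrightarrow> P x"

abbreviation ExSet :: "('c \<Rightarrow> bool) \<Rightarrow> bool"  (binder "\<exists>\<^sub>s" 10) where
  "\<exists>\<^sub>s x. P x \<equiv> \<exists>x. setp x \<and> P x"

text \<open>The class of all sets with a property; meaningful when the property is predicative.\<close>

definition coll :: "('c \<Rightarrow> bool) \<Rightarrow> 'c" where
  "coll P = (THE C. \<forall>x. x \<epsilon> C \<longleftrightarrow> setp x \<and> P x)"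

definition cempty :: 'c where
  "cempty = coll (\<lambda>_. False)"

definition upair :: "'c \<Rightarrow> 'c \<Rightarrow> 'c" where
  "upair x y = coll (\<lambda>z. z = x \<or> z = y)"

definition sing :: "'c \<Rightarrow> 'c" where
  "sing x = upair x x"

definition opair :: "'c \<Rightarrow> 'c \<Rightarrow> 'c"  ("\<langle>_,/ _\<rangle>") where
  "\<langle>x, y\<rangle> = upair (sing x) (upair x y)"

definition csucc :: "'c \<Rightarrow> 'c" where
  "csucc n = coll (\<lambda>x. x \<epsilon> n \<or> x = n)"

text \<open>The numerals, used as truth values and as tags in the coding of syntax.\<close>

primrec num :: "nat \<Rightarrow> 'c" where
  "num 0 = cempty"
| "num (Suc k) = csucc (num k)"

text \<open>
  Von Neumann natural numbers: ordinals \<open>n\<close> such that \<open>n\<close> and all its elements are zero or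
  successors.
\<close>

definition is_nat :: "'c \<Rightarrow> bool" where
  "is_nat n \<longleftrightarrow> setp n
     \<and> (\<forall>x. x \<epsilon> n \<longrightarrow> (\<forall>y. y \<epsilon> x \<longrightarrow> y \<epsilon> n))
     \<and> (\<forall>x y. x \<epsilon> n \<and> y \<epsilon> n \<longrightarrow> x \<epsilon> y \<or> x = y \<or> y \<epsilon> x)
     \<and> (\<forall>x. x \<epsilon> n \<or> x = n \<longrightarrow> x = cempty \<or> (\<exists>\<^sub>s y. x = csucc y))"

text \<open>\<open>f\<close> is a class function with domain \<open>a\<close>, all of whose values satisfy \<open>P\<close>.\<close>

definition fun_on :: "'c \<Rightarrow> 'c \<Rightarrow> ('c \<Rightarrow> bool) \<Rightarrow> bool" where
  "fun_on f a P \<longleftrightarrow>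
     (\<forall>p. p \<epsilon> f \<longrightarrow> (\<exists>x. x \<epsilon> a \<and> (\<exists>\<^sub>s y. P y \<and> p = \<langle>x, y\<rangle>)))
   \<and> (\<forall>x. x \<epsilon> a \<longrightarrow> (\<exists>!y. setp y \<and> \<langle>x, y\<rangle> \<epsilon> f))"

definition finite_set :: "'c \<Rightarrow> bool" where
  "finite_set x \<longleftrightarrow> setp x
     \<and> (\<exists>\<^sub>s n. is_nat n \<and>
          (\<exists>\<^sub>s f. fun_on f n (\<lambda>y. y \<epsilon> x)
                \<and> (\<forall>y. y \<epsilon> x \<longrightarrow> (\<exists>!i. i \<epsilon> n \<and> \<langle>i, y\<rangle> \<epsilon> f))))"

text \<open>\<open>a\<close> and \<open>b\<close> are finite sequences of the same length whose entries are related by \<open>P\<close>.\<close>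

definition pointwise :: "('c \<Rightarrow> 'c \<Rightarrow> bool) \<Rightarrow> 'c \<Rightarrow> 'c \<Rightarrow> bool" where
  "pointwise P a b \<longleftrightarrow>
     (\<exists>\<^sub>s n. is_nat n \<and> fun_on a n (\<lambda>_. True) \<and> fun_on b n (\<lambda>_. True)
          \<and> (\<forall>\<^sub>s i. \<forall>\<^sub>s x. \<forall>\<^sub>s y. \<langle>i, x\<rangle> \<epsilon> a \<and> \<langle>i, y\<rangle> \<epsilon> b \<longrightarrow> P x y))"

text \<open>
  Internal inductive definitions.  \<open>step X q\<close> says that one application of a generating rule
  yields \<open>q\<close> from premises in \<open>X\<close>; then \<open>generated step p\<close> says that \<open>p\<close> has a finite derivation,
  presented as the set of its lines.  No ordering of the lines is needed: in every use below the
  premises of a rule are (codes of) proper constituents of its conclusion, hence have smaller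
  rank, so that by foundation a derivation cannot be circular.
\<close>

definition generated :: "('c \<Rightarrow> 'c \<Rightarrow> bool) \<Rightarrow> 'c \<Rightarrow> bool" where
  "generated step p \<longleftrightarrow>
     (\<exists>X. finite_set X \<and> p \<epsilon> X \<and> (\<forall>q. q \<epsilon> X \<longrightarrow> step X q))"


section \<open>Syntax\<close>

definition Var :: "'c \<Rightarrow> 'c" where "Var i = \<langle>num 0, i\<rangle>"
definition Fn :: "'c \<Rightarrow> 'c \<Rightarrow> 'c" where "Fn f a = \<langle>num 1, \<langle>f, a\<rangle>\<rangle>"
definition Rl :: "'c \<Rightarrow> 'c \<Rightarrow> 'c" where "Rl r a = \<langle>num 2, \<langle>r, a\<rangle>\<rangle>"
definition Eqn :: "'c \<Rightarrow> 'c \<Rightarrow> 'c" where "Eqn t u = \<langle>num 3, \<langle>t, u\<rangle>\<rangle>"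
definition Neg :: "'c \<Rightarrow> 'c" where "Neg p = \<langle>num 4, p\<rangle>"
definition Imp :: "'c \<Rightarrow> 'c \<Rightarrow> 'c" where "Imp p q = \<langle>num 5, \<langle>p, q\<rangle>\<rangle>"
definition All :: "'c \<Rightarrow> 'c \<Rightarrow> 'c" where "All x p = \<langle>num 6, \<langle>x, p\<rangle>\<rangle>"

definition is_signature :: "'c signature \<Rightarrow> bool" where
  "is_signature \<rho> \<longleftrightarrow>
     (\<exists>D. fun_on (rel_arity \<rho>) D is_nat) \<and> (\<exists>D. fun_on (fun_arity \<rho>) D is_nat)"

definition is_var :: "'c \<Rightarrow> bool" where
  "is_var x \<longleftrightarrow> (\<exists>\<^sub>s i. is_nat i \<and> x = Var i)"

definition is_term :: "'c signature \<Rightarrow> 'c \<Rightarrow> bool" where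
  "is_term \<rho> = generated (\<lambda>X q.
       is_var q
     \<or> (\<exists>\<^sub>s f. \<exists>\<^sub>s n. \<exists>\<^sub>s a. \<langle>f, n\<rangle> \<epsilon> fun_arity \<rho> \<and> fun_on a n (\<lambda>t. t \<epsilon> X) \<and> q = Fn f a))"

definition is_atomic :: "'c signature \<Rightarrow> 'c \<Rightarrow> bool" where
  "is_atomic \<rho> q \<longleftrightarrow>
       (\<exists>\<^sub>s t. \<exists>\<^sub>s u. is_term \<rho> t \<and> is_term \<rho> u \<and> q = Eqn t u)
     \<or> (\<exists>\<^sub>s r. \<exists>\<^sub>s n. \<exists>\<^sub>s a. \<langle>r, n\<rangle> \<epsilon> rel_arity \<rho> \<and> fun_on a n (is_term \<rho>) \<and> q = Rl r a)"

definition is_fm :: "'c signature \<Rightarrow> 'c \<Rightarrow> bool" where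
  "is_fm \<rho> = generated (\<lambda>X q.
       is_atomic \<rho> q
     \<or> (\<exists>p. p \<epsilon> X \<and> q = Neg p)
     \<or> (\<exists>p r. p \<epsilon> X \<and> r \<epsilon> X \<and> q = Imp p r)
     \<or> (\<exists>\<^sub>s x. \<exists>p. is_var x \<and> p \<epsilon> X \<and> q = All x p))"

text \<open>\<open>subfm p\<close> holds of the formulas that have \<open>p\<close> as a (not necessarily proper) subformula.\<close>

definition subfm :: "'c \<Rightarrow> 'c \<Rightarrow> bool" where
  "subfm p = generated (\<lambda>X q.
       q = p
     \<or> (\<exists>r. r \<epsilon> X \<and> q = Neg r)
     \<or> (\<exists>\<^sub>s r. \<exists>\<^sub>s s. (r \<epsilon> X \<or> s \<epsilon> X) \<and> q = Imp r s)
     \<or> (\<exists>\<^sub>s x. \<exists>r. r \<epsilon> X \<and> q = All x r))"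

text \<open>\<open>occurs x t\<close>: the variable \<open>x\<close> occurs in the term \<open>t\<close>.\<close>

definition occurs :: "'c \<Rightarrow> 'c \<Rightarrow> bool" where
  "occurs x = generated (\<lambda>X q.
       q = x
     \<or> (\<exists>\<^sub>s f. \<exists>\<^sub>s a. (\<exists>\<^sub>s i. \<exists>t. t \<epsilon> X \<and> \<langle>i, t\<rangle> \<epsilon> a) \<and> q = Fn f a))"

text \<open>\<open>free x q\<close>: the variable \<open>x\<close> has a free occurrence in the formula \<open>q\<close>.\<close>

definition free :: "'c \<Rightarrow> 'c \<Rightarrow> bool" where
  "free x = generated (\<lambda>X q.
       (\<exists>\<^sub>s t. \<exists>\<^sub>s u. (occurs x t \<or> occurs x u) \<and> q = Eqn t u)
     \<or> (\<exists>\<^sub>s r. \<exists>\<^sub>s a. (\<exists>\<^sub>s i. \<exists>\<^sub>s t. \<langle>i, t\<rangle> \<epsilon> a \<and> occurs x t) \<and> q = Rl r a)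
     \<or> (\<exists>p. p \<epsilon> X \<and> q = Neg p)
     \<or> (\<exists>\<^sub>s p. \<exists>\<^sub>s r. (p \<epsilon> X \<or> r \<epsilon> X) \<and> q = Imp p r)
     \<or> (\<exists>\<^sub>s y. \<exists>p. y \<noteq> x \<and> p \<epsilon> X \<and> q = All y p))"

definition is_sentence :: "'c signature \<Rightarrow> 'c \<Rightarrow> bool" where
  "is_sentence \<rho> q \<longleftrightarrow> is_fm \<rho> q \<and> \<not> (\<exists>\<^sub>s x. is_var x \<and> free x q)"

definition is_theory :: "'c signature \<Rightarrow> 'c \<Rightarrow> bool" where
  "is_theory \<rho> \<Theta> \<longleftrightarrow> (\<forall>q. q \<epsilon> \<Theta> \<longrightarrow> is_sentence \<rho> q)"

text \<open>\<open>subst_tm x t u v\<close>: the term \<open>v\<close> is the result of replacing \<open>x\<close> by \<open>t\<close> in \<open>u\<close>.\<close>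

definition subst_tm :: "'c \<Rightarrow> 'c \<Rightarrow> 'c \<Rightarrow> 'c \<Rightarrow> bool" where
  "subst_tm x t u v \<longleftrightarrow> generated (\<lambda>X q.
       q = \<langle>x, t\<rangle>
     \<or> (\<exists>\<^sub>s y. is_var y \<and> y \<noteq> x \<and> q = \<langle>y, y\<rangle>)
     \<or> (\<exists>\<^sub>s f. \<exists>\<^sub>s a. \<exists>\<^sub>s b. pointwise (\<lambda>w z. \<langle>w, z\<rangle> \<epsilon> X) a b \<and> q = \<langle>Fn f a, Fn f b\<rangle>)) \<langle>u, v\<rangle>"

text \<open>
  \<open>subst_fm x t p q\<close>: the term \<open>t\<close> is free for \<open>x\<close> in the formula \<open>p\<close>, and \<open>q\<close> is the result of
  replacing the free occurrences of \<open>x\<close> by \<open>t\<close>.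
\<close>

definition subst_fm :: "'c \<Rightarrow> 'c \<Rightarrow> 'c \<Rightarrow> 'c \<Rightarrow> bool" where
  "subst_fm x t p q \<longleftrightarrow> generated (\<lambda>X w.
       (\<exists>\<^sub>s u. \<exists>\<^sub>s v. \<exists>\<^sub>s u'. \<exists>\<^sub>s v'. subst_tm x t u u' \<and> subst_tm x t v v'
            \<and> w = \<langle>Eqn u v, Eqn u' v'\<rangle>)
     \<or> (\<exists>\<^sub>s r. \<exists>\<^sub>s a. \<exists>\<^sub>s b. pointwise (subst_tm x t) a b \<and> w = \<langle>Rl r a, Rl r b\<rangle>)
     \<or> (\<exists>\<^sub>s r. \<exists>\<^sub>s r'. \<langle>r, r'\<rangle> \<epsilon> X \<and> w = \<langle>Neg r, Neg r'\<rangle>)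
     \<or> (\<exists>\<^sub>s r. \<exists>\<^sub>s s. \<exists>\<^sub>s r'. \<exists>\<^sub>s s'. \<langle>r, r'\<rangle> \<epsilon> X \<and> \<langle>s, s'\<rangle> \<epsilon> X
            \<and> w = \<langle>Imp r s, Imp r' s'\<rangle>)
     \<or> (\<exists>\<^sub>s y. \<exists>\<^sub>s r. \<not> free x (All y r) \<and> w = \<langle>All y r, All y r\<rangle>)
     \<or> (\<exists>\<^sub>s y. \<exists>\<^sub>s r. \<exists>\<^sub>s r'. y \<noteq> x \<and> \<not> occurs y t \<and> \<langle>r, r'\<rangle> \<epsilon> X
            \<and> w = \<langle>All y r, All y r'\<rangle>)) \<langle>p, q\<rangle>"


section \<open>Derivability\<close>

text \<open>
  The usual Hilbert calculus for first-order logic with equality; the rules, modus ponens and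
  generalization, are built into \<open>is_proof\<close>.
\<close>

definition logical_axiom :: "'c signature \<Rightarrow> 'c \<Rightarrow> bool" where
  "logical_axiom \<rho> q \<longleftrightarrow> is_fm \<rho> q \<and>
     ((\<exists>\<^sub>s a. \<exists>\<^sub>s b. q = Imp a (Imp b a))
    \<or> (\<exists>\<^sub>s a. \<exists>\<^sub>s b. \<exists>\<^sub>s c. q = Imp (Imp a (Imp b c)) (Imp (Imp a b) (Imp a c)))
    \<or> (\<exists>\<^sub>s a. \<exists>\<^sub>s b. q = Imp (Imp (Neg a) (Neg b)) (Imp b a))
    \<or> (\<exists>\<^sub>s x. \<exists>\<^sub>s t. \<exists>\<^sub>s a. \<exists>\<^sub>s b. is_var x \<and> is_term \<rho> t \<and> subst_fm x t a b
          \<and> q = Imp (All x a) b)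
    \<or> (\<exists>\<^sub>s x. \<exists>\<^sub>s a. \<exists>\<^sub>s b. is_var x \<and> \<not> free x a
          \<and> q = Imp (All x (Imp a b)) (Imp a (All x b)))
    \<or> (\<exists>\<^sub>s t. is_term \<rho> t \<and> q = Eqn t t)
    \<or> (\<exists>\<^sub>s x. \<exists>\<^sub>s t. \<exists>\<^sub>s u. \<exists>\<^sub>s a. \<exists>\<^sub>s b. \<exists>\<^sub>s c.
          is_var x \<and> is_term \<rho> t \<and> is_term \<rho> u \<and> is_fm \<rho> a
          \<and> subst_fm x t a b \<and> subst_fm x u a c
          \<and> q = Imp (Eqn t u) (Imp b c)))"

definition is_proof :: "'c signature \<Rightarrow> 'c \<Rightarrow> 'c \<Rightarrow> 'c \<Rightarrow> bool" where
  "is_proof \<rho> \<Theta> n s \<longleftrightarrow> is_nat n \<and> setp s \<and> fun_on s n (is_fm \<rho>)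
     \<and> (\<forall>i. i \<epsilon> n \<longrightarrow> (\<forall>\<^sub>s q. \<langle>i, q\<rangle> \<epsilon> s \<longrightarrow>
            q \<epsilon> \<Theta>
          \<or> logical_axiom \<rho> q
          \<or> (\<exists>j k. \<exists>\<^sub>s p. j \<epsilon> i \<and> k \<epsilon> i \<and> \<langle>j, p\<rangle> \<epsilon> s \<and> \<langle>k, Imp p q\<rangle> \<epsilon> s)
          \<or> (\<exists>j. \<exists>\<^sub>s x. \<exists>\<^sub>s p. j \<epsilon> i \<and> is_var x \<and> \<langle>j, p\<rangle> \<epsilon> s \<and> q = All x p)))"

definition proves :: "'c signature \<Rightarrow> 'c \<Rightarrow> 'c \<Rightarrow> bool" where
  "proves \<rho> \<Theta> q \<longleftrightarrow> (\<exists>\<^sub>s i. \<exists>\<^sub>s s. is_proof \<rho> \<Theta> (csucc i) s \<and> \<langle>i, q\<rangle> \<epsilon> s)"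


section \<open>Structures and satisfaction\<close>

text \<open>
  \<open>rel_int\<close> consists of the pairs of a relation symbol and a tuple in its interpretation;
  \<open>fun_int\<close> is the function taking a function symbol and an argument tuple to the value.
\<close>

definition is_struct :: "'c signature \<Rightarrow> 'c struct \<Rightarrow> bool" where
  "is_struct \<rho> M \<longleftrightarrow>
     (\<exists>x. x \<epsilon> universe M)
   \<and> (\<forall>q. q \<epsilon> rel_int M \<longrightarrow>
        (\<exists>\<^sub>s r. \<exists>\<^sub>s n. \<exists>\<^sub>s d. \<langle>r, n\<rangle> \<epsilon> rel_arity \<rho> \<and> fun_on d n (\<lambda>b. b \<epsilon> universe M)
           \<and> q = \<langle>r, d\<rangle>))
   \<and> (\<exists>D. (\<forall>q. q \<epsilon> D \<longleftrightarrow>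
              (\<exists>\<^sub>s f. \<exists>\<^sub>s n. \<exists>\<^sub>s d. \<langle>f, n\<rangle> \<epsilon> fun_arity \<rho> \<and> fun_on d n (\<lambda>b. b \<epsilon> universe M)
                 \<and> q = \<langle>f, d\<rangle>))
         \<and> fun_on (fun_int M) D (\<lambda>b. b \<epsilon> universe M))"

definition in_dom :: "'c \<Rightarrow> 'c \<Rightarrow> bool" where
  "in_dom A x \<longleftrightarrow> (\<exists>\<^sub>s b. \<langle>x, b\<rangle> \<epsilon> A)"

definition assignment_for :: "'c struct \<Rightarrow> 'c \<Rightarrow> 'c \<Rightarrow> bool" where
  "assignment_for M q A \<longleftrightarrow> finite_set A
     \<and> (\<exists>\<^sub>s D. fun_on A D (\<lambda>b. b \<epsilon> universe M))
     \<and> (\<forall>\<^sub>s x. is_var x \<and> free x q \<longrightarrow> in_dom A x)"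

definition update :: "'c \<Rightarrow> 'c \<Rightarrow> 'c \<Rightarrow> 'c" where
  "update A x b = coll (\<lambda>p. p = \<langle>x, b\<rangle> \<or> (p \<epsilon> A \<and> \<not> (\<exists>\<^sub>s c. p = \<langle>x, c\<rangle>)))"

text \<open>\<open>tm_val M A t b\<close>: the term \<open>t\<close> has the value \<open>b\<close> under \<open>A\<close>.\<close>

definition tm_val :: "'c struct \<Rightarrow> 'c \<Rightarrow> 'c \<Rightarrow> 'c \<Rightarrow> bool" where
  "tm_val M A t b \<longleftrightarrow> generated (\<lambda>X q.
       (\<exists>\<^sub>s x. \<exists>\<^sub>s c. is_var x \<and> \<langle>x, c\<rangle> \<epsilon> A \<and> q = \<langle>x, c\<rangle>)
     \<or> (\<exists>\<^sub>s f. \<exists>\<^sub>s a. \<exists>\<^sub>s d. \<exists>\<^sub>s c. pointwise (\<lambda>u e. \<langle>u, e\<rangle> \<epsilon> X) a d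
          \<and> \<langle>\<langle>f, d\<rangle>, c\<rangle> \<epsilon> fun_int M \<and> q = \<langle>Fn f a, c\<rangle>)) \<langle>t, b\<rangle>"

text \<open>\<open>\<Phi>\<close> is a class of formulas.\<close>

definition sat_dom :: "'c struct \<Rightarrow> 'c \<Rightarrow> 'c \<Rightarrow> 'c \<Rightarrow> bool" where
  "sat_dom M \<Phi> q A \<longleftrightarrow> (\<exists>p. p \<epsilon> \<Phi> \<and> subfm q p) \<and> assignment_for M q A"

text \<open>
  A valuation is a class function from the pairs in \<open>sat_dom\<close> to the truth values 0 and 1 which
  obeys the Tarskian clauses.
\<close>

definition is_valuation :: "'c struct \<Rightarrow> 'c \<Rightarrow> 'c \<Rightarrow> bool" where
  "is_valuation M \<Phi> V \<longleftrightarrow>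
   (let T = (\<lambda>q A. \<langle>\<langle>q, A\<rangle>, num 1\<rangle> \<epsilon> V) in
     (\<exists>D. (\<forall>w. w \<epsilon> D \<longleftrightarrow> (\<exists>\<^sub>s q. \<exists>\<^sub>s A. sat_dom M \<Phi> q A \<and> w = \<langle>q, A\<rangle>))
         \<and> fun_on V D (\<lambda>v. v = num 0 \<or> v = num 1))
   \<and> (\<forall>\<^sub>s t. \<forall>\<^sub>s u. \<forall>\<^sub>s A. sat_dom M \<Phi> (Eqn t u) A \<longrightarrow>
        (T (Eqn t u) A \<longleftrightarrow> (\<exists>\<^sub>s b. tm_val M A t b \<and> tm_val M A u b)))
   \<and> (\<forall>\<^sub>s r. \<forall>\<^sub>s a. \<forall>\<^sub>s A. sat_dom M \<Phi> (Rl r a) A \<longrightarrow>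
        (T (Rl r a) A \<longleftrightarrow> (\<exists>\<^sub>s d. pointwise (tm_val M A) a d \<and> \<langle>r, d\<rangle> \<epsilon> rel_int M)))
   \<and> (\<forall>\<^sub>s p. \<forall>\<^sub>s A. sat_dom M \<Phi> (Neg p) A \<longrightarrow>
        (T (Neg p) A \<longleftrightarrow> \<not> T p A))
   \<and> (\<forall>\<^sub>s p. \<forall>\<^sub>s q. \<forall>\<^sub>s A. sat_dom M \<Phi> (Imp p q) A \<longrightarrow>
        (T (Imp p q) A \<longleftrightarrow> (T p A \<longrightarrow> T q A)))
   \<and> (\<forall>\<^sub>s x. \<forall>\<^sub>s p. \<forall>\<^sub>s A. sat_dom M \<Phi> (All x p) A \<longrightarrow>
        (T (All x p) A \<longleftrightarrow> (\<forall>b. b \<epsilon> universe M \<longrightarrow> T p (update A x b)))))"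

definition is_sat_relation :: "'c struct \<Rightarrow> 'c \<Rightarrow> 'c \<Rightarrow> bool" where
  "is_sat_relation M \<Phi> S \<longleftrightarrow>
     (\<exists>V. is_valuation M \<Phi> V \<and>
        (\<forall>w. w \<epsilon> S \<longleftrightarrow> (\<exists>\<^sub>s q. \<exists>\<^sub>s A. w = \<langle>q, A\<rangle> \<and> \<langle>\<langle>q, A\<rangle>, num 1\<rangle> \<epsilon> V)))"

definition weakly_satisfactory :: "'c signature \<Rightarrow> 'c struct \<Rightarrow> bool" where
  "weakly_satisfactory \<rho> M \<longleftrightarrow>
     (\<forall>q. is_fm \<rho> q \<longrightarrow> (\<exists>S. is_sat_relation M (sing q) S))"

definition usat_at :: "'c struct \<Rightarrow> 'c \<Rightarrow> 'c \<Rightarrow> bool" where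
  "usat_at M q A \<longleftrightarrow> (\<forall>S. is_sat_relation M (sing q) S \<longrightarrow> \<langle>q, A\<rangle> \<epsilon> S)"

definition usat :: "'c struct \<Rightarrow> 'c \<Rightarrow> bool" where
  "usat M q \<longleftrightarrow> (\<forall>A. assignment_for M q A \<longrightarrow> usat_at M q A)"

definition usat_theory :: "'c struct \<Rightarrow> 'c \<Rightarrow> bool" where
  "usat_theory M \<Theta> \<longleftrightarrow> (\<forall>q. q \<epsilon> \<Theta> \<longrightarrow> usat M q)"

end


section \<open>Goedel-Bernays class theory without infinity\<close>

text \<open>
  Foundation is the axiom for classes; the existence of a set, usually a consequence of infinity,
  has to be an axiom of its own.
\<close>

locale class_theory_C = class_language +
  assumes extensionality:
      "(\<And>x. x \<epsilon> a \<longleftrightarrow> x \<epsilon> b) \<Longrightarrow> a = b"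
    and comprehension:
      "\<exists>C. \<forall>x. x \<epsilon> C \<longleftrightarrow> setp x \<and> psat (\<epsilon>) (e(0 := x)) f"
    and empty_set:
      "\<exists>a. setp a \<and> (\<forall>x. \<not> x \<epsilon> a)"
    and pairing:
      "setp a \<Longrightarrow> setp b \<Longrightarrow> \<exists>c. setp c \<and> (\<forall>x. x \<epsilon> c \<longleftrightarrow> x = a \<or> x = b)"
    and union:
      "setp a \<Longrightarrow> \<exists>u. setp u \<and> (\<forall>x. x \<epsilon> u \<longleftrightarrow> (\<exists>y. y \<epsilon> a \<and> x \<epsilon> y))"
    and power_set:
      "setp a \<Longrightarrow> \<exists>p. setp p \<and> (\<forall>x. x \<epsilon> p \<longleftrightarrow> setp x \<and> (\<forall>y. y \<epsilon> x \<longrightarrow> y \<epsilon> a))"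
    and replacement:
      "setp a \<Longrightarrow>
       (\<forall>\<^sub>s x. \<forall>\<^sub>s y. \<forall>\<^sub>s z. \<langle>x, y\<rangle> \<epsilon> F \<and> \<langle>x, z\<rangle> \<epsilon> F \<longrightarrow> y = z) \<Longrightarrow>
       \<exists>b. setp b \<and> (\<forall>y. y \<epsilon> b \<longleftrightarrow> setp y \<and> (\<exists>x. x \<epsilon> a \<and> \<langle>x, y\<rangle> \<epsilon> F))"
    and foundation:
      "x \<epsilon> a \<Longrightarrow> \<exists>y. y \<epsilon> a \<and> \<not> (\<exists>z. z \<epsilon> y \<and> z \<epsilon> a)"

end

theory Submission
  imports Defs
begin

text \<open>
  Universal satisfaction quantifies over classes, so truth of the lines of a proof cannot be shown
  by induction on the proof directly: only predicative properties admit induction.  Instead the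
  (internally finitely many) lines of the proof are joined by implications to a single formula.
  Weak satisfactoriness provides one valuation for that formula, and relative to this fixed class
  truth of a line under all assignments is predicative, so the usual soundness induction goes
  through.  Two valuations agree on the subformulas they share, again by a predicative induction.
  Hence the members of the theory are true in the chosen valuation, and truth of the last line
  there carries over to every valuation for it.
\<close>

section \<open>Predicative comprehension with parameters\<close>

text \<open>Three obstacles shape the details. Before any induction its hypothesis must be matched
  with one formula of class theory, uniformly in the parameters. That the coded syntax passes this
  test rests on derivations being finite sets: quantifying over derivations is then quantifying over
  sets. Next, "finite" is internal, so sequences of terms and proofs may have nonstandard length.
  Finitely many witnesses are therefore never picked one by one outside the model; they are replaced
  by a single finite set that bounds them all, found by internal induction. Finally, one valuation
  speaks only about subformulas of one formula and about finite assignments. An equality axiom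
  mentions two substitution instances but not the formula substituted into, so the joined formula
  must contain more than the lines of the proof. Modus ponens may remove a formula with free
  variables that the current assignment leaves out, and the axiom of instantiation may involve a
  term with such variables; the assignment is then enlarged, using that the universe is
  nonempty.\<close>

primrec rename :: "(nat \<Rightarrow> nat) \<Rightarrow> pform \<Rightarrow> pform" where
  "rename r (PMem i j) = PMem (r i) (r j)"
| "rename r (PEq i j) = PEq (r i) (r j)"
| "rename r (PNeg f) = PNeg (rename r f)"
| "rename r (PAnd f g) = PAnd (rename r f) (rename r g)"
| "rename r (PAllSet i f) = PAllSet (r i) (rename r f)"

text \<open>Bound variables are renamed along with free ones. Injectivity excludes capture: an
  update at \<open>r i\<close> disturbs no other index in the range of \<open>r\<close>.\<close>

lemma psat_rename: "inj r \<Longrightarrow> psat E e (rename r f) \<longleftrightarrow> psat E (\<lambda>i. e (r i)) f"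
proof (induction f arbitrary: e)
  case (PAllSet i f)
  have "(\<lambda>j. (e(r i := x)) (r j)) = (\<lambda>j. e (r j))(i := x)" for x
    using PAllSet.prems by (auto simp: inj_eq)
  with PAllSet show ?case by simp
qed auto

definition interleave :: "(nat \<Rightarrow> 'a) \<Rightarrow> (nat \<Rightarrow> 'a) \<Rightarrow> nat \<Rightarrow> 'a" where
  "interleave e c i = (if even i then e (i div 2) else c (i div 2))"

context class_language
begin

text \<open>Even variables of the formula are read from the environment, odd ones are parameters.\<close>

definition predicative :: "((nat \<Rightarrow> 'c) \<Rightarrow> bool) \<Rightarrow> bool" where
  "predicative P \<longleftrightarrow> (\<exists>f c. \<forall>e. P e \<longleftrightarrow> psat (\<epsilon>) (interleave e c) f)"

text \<open>Class terms have no counterpart in \<open>pform\<close>, so a term is handled through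
  the formula for membership in its value. Variable 0 holds the member, which shifts the variables
  of the term by one.\<close>

definition definable :: "((nat \<Rightarrow> 'c) \<Rightarrow> 'c) \<Rightarrow> bool" where
  "definable t \<longleftrightarrow> predicative (\<lambda>e. e 0 \<epsilon> t (\<lambda>i. e (Suc i)))"

named_theorems pred_intros

lemma predicative_reindex:
  assumes "predicative P" "inj r"
  shows "predicative (\<lambda>e. P (\<lambda>i. e (r i)))"
proof -
  obtain f c where f: "\<And>e. P e \<longleftrightarrow> psat (\<epsilon>) (interleave e c) f"
    using assms(1) unfolding predicative_def by blast
  \<comment> \<open>Only the even positions, which hold the environment, move; the odd ones hold
    parameters and stay in place.\<close>
  define s where "s i = (if even i then 2 * r (i div 2) else i)" for i
  have "inj s"
  proof (rule injI)
    fix i j assume eq: "s i = s j"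
    show "i = j"
    proof (cases "even i")
      case True
      with eq have "even j" by (auto simp: s_def split: if_splits)
      with True eq show ?thesis
        using assms(2) by (auto simp: s_def inj_eq elim!: evenE)
    next
      case False
      with eq show ?thesis by (auto simp: s_def split: if_splits)
    qed
  qed
  moreover have "(\<lambda>i. interleave e c (s i)) = interleave (\<lambda>i. e (r i)) c" for e
    by (auto simp: interleave_def s_def)
  ultimately have "P (\<lambda>i. e (r i)) \<longleftrightarrow> psat (\<epsilon>) (interleave e c) (rename s f)" for e
    by (simp add: psat_rename f)
  then show ?thesis unfolding predicative_def by blast
qed

lemma predicative_not [pred_intros]: "predicative P \<Longrightarrow> predicative (\<lambda>e. \<not> P e)"
  unfolding predicative_def by (metis psat.simps(3))

lemma predicative_conj [pred_intros]:
  assumes "predicative P" "predicative Q"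
  shows "predicative (\<lambda>e. P e \<and> Q e)"
proof -
  obtain f c where f: "\<And>e. P e \<longleftrightarrow> psat (\<epsilon>) (interleave e c) f"
    using assms(1) unfolding predicative_def by blast
  obtain g d where g: "\<And>e. Q e \<longleftrightarrow> psat (\<epsilon>) (interleave e d) g"
    using assms(2) unfolding predicative_def by blast
  \<comment> \<open>The two formulas come with separate parameter sequences. Parameter
    \<open>k\<close>, at index \<open>2 * k + 1\<close>, takes place \<open>2 * k\<close> or
    \<open>2 * k + 1\<close> of the merged sequence, that is, index \<open>4 * k + 1\<close> or
    \<open>4 * k + 3\<close>.\<close>
  define r where "r i = (if even i then i else 2 * i - 1)" for i :: nat
  define s where "s i = (if even i then i else 2 * i + 1)" for i :: nat
  have "inj r" "inj s"
    unfolding inj_def r_def s_def by (auto split: if_splits; presburger)+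
  have "(\<lambda>i. interleave e (interleave c d) (r i)) = interleave e c" for e :: "nat \<Rightarrow> 'c"
  proof
    fix i show "interleave e (interleave c d) (r i) = interleave e c i"
    proof (cases "even i")
      case False
      then obtain k where "i = 2 * k + 1" by (elim oddE)
      then have "r i = 2 * (2 * k) + 1" by (simp add: r_def)
      then show ?thesis using \<open>i = 2 * k + 1\<close> by (simp add: interleave_def)
    qed (simp add: interleave_def r_def)
  qed
  moreover have "(\<lambda>i. interleave e (interleave c d) (s i)) = interleave e d" for e :: "nat \<Rightarrow> 'c"
  proof
    fix i show "interleave e (interleave c d) (s i) = interleave e d i"
    proof (cases "even i")
      case False
      then obtain k where "i = 2 * k + 1" by (elim oddE)
      then have "s i = 2 * (2 * k + 1) + 1" by (simp add: s_def)
      then show ?thesis using \<open>i = 2 * k + 1\<close> by (simp add: interleave_def)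
    qed (simp add: interleave_def s_def)
  qed
  ultimately have "P e \<and> Q e \<longleftrightarrow>
      psat (\<epsilon>) (interleave e (interleave c d)) (PAnd (rename r f) (rename s g))" for e
    using \<open>inj r\<close> \<open>inj s\<close> by (simp add: psat_rename f g)
  then show ?thesis unfolding predicative_def by blast
qed

lemma predicative_AllSet:
  assumes "predicative (\<lambda>e. P (\<lambda>i. e (Suc i)) (e 0))"
  shows "predicative (\<lambda>e. \<forall>\<^sub>s x. P e x)"
proof -
  obtain f c where f: "\<And>e. P (\<lambda>i. e (Suc i)) (e 0) \<longleftrightarrow> psat (\<epsilon>) (interleave e c) f"
    using assms unfolding predicative_def by blast
  \<comment> \<open>Variable 0, the one to be bound, moves to index 1, the first parameter slot. The
    other environment variables move down by one place and the parameters up by one. The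
    \<open>undefined\<close> in \<open>d\<close> fills the slot that the quantifier
    overwrites.\<close>
  define r where "r i = (if i = 0 then 1 else if even i then i - 2 else i + 2)" for i :: nat
  have "inj r"
    unfolding inj_def r_def by (auto split: if_splits; presburger)
  define d where "d = case_nat undefined c"
  have eq: "(\<lambda>i. ((interleave e d)(1 := x)) (r i)) = interleave (case_nat x e) c"
    for e :: "nat \<Rightarrow> 'c" and x
  proof
    fix i show "((interleave e d)(1 := x)) (r i) = interleave (case_nat x e) c i"
    proof (cases "even i")
      case True
      then obtain k where "i = 2 * k" by (elim evenE)
      then show ?thesis by (cases k) (auto simp: interleave_def r_def)
    next
      case False
      then obtain k where "i = 2 * k + 1" by (elim oddE)
      then have "r i = 2 * Suc k + 1" by (simp add: r_def)
      then show ?thesis using \<open>i = 2 * k + 1\<close> by (simp add: interleave_def d_def)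
    qed
  qed
  have "(\<forall>\<^sub>s x. P e x) \<longleftrightarrow> psat (\<epsilon>) (interleave e d) (PAllSet 1 (rename r f))" for e
  proof -
    have "P e x \<longleftrightarrow> psat (\<epsilon>) ((interleave e d)(1 := x)) (rename r f)" for x
      using f[of "case_nat x e"] unfolding psat_rename[OF \<open>inj r\<close>] eq by simp
    then show ?thesis by (simp add: setp_def)
  qed
  then show ?thesis unfolding predicative_def by blast
qed

lemma predicative_True [pred_intros]: "predicative (\<lambda>e. True)"
  unfolding predicative_def by (rule exI[of _ "PEq 0 0"]) simp

lemma predicative_disj [pred_intros]:
  assumes "predicative P" "predicative Q"
  shows "predicative (\<lambda>e. P e \<or> Q e)"
proof -
  have "predicative (\<lambda>e. \<not> (\<not> P e \<and> \<not> Q e))"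
    by (intro predicative_not predicative_conj assms)
  then show ?thesis by simp
qed

lemma predicative_False [pred_intros]: "predicative (\<lambda>e. False)"
  using predicative_not[of "\<lambda>_. True"] predicative_True by simp

lemma predicative_imp [pred_intros]:
  assumes "predicative P" "predicative Q"
  shows "predicative (\<lambda>e. P e \<longrightarrow> Q e)"
  unfolding imp_conv_disj by (intro predicative_disj predicative_not assms)

lemma predicative_iff [pred_intros]:
  "predicative P \<Longrightarrow> predicative Q \<Longrightarrow> predicative (\<lambda>e. P e = Q e)"
  unfolding iff_conv_conj_imp by (intro pred_intros)

text \<open>Many quantifiers in the definitions carry no explicit guard. By the first premise only
  sets can be counterexamples, so restricting the quantifier to sets changes nothing.\<close>

lemma predicative_all [pred_intros]:
  assumes "\<And>e x. \<not> P e x \<Longrightarrow> setp x" "predicative (\<lambda>e. P (\<lambda>i. e (Suc i)) (e 0))"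
  shows "predicative (\<lambda>e. \<forall>x. P e x)"
proof -
  have "(\<lambda>e. \<forall>x. P e x) = (\<lambda>e. \<forall>\<^sub>s x. P e x)" using assms(1) by blast
  then show ?thesis using predicative_AllSet[OF assms(2)] by simp
qed

lemma predicative_ex [pred_intros]:
  assumes "\<And>e x. P e x \<Longrightarrow> setp x" "predicative (\<lambda>e. P (\<lambda>i. e (Suc i)) (e 0))"
  shows "predicative (\<lambda>e. \<exists>x. P e x)"
proof -
  have "predicative (\<lambda>e. \<not> (\<forall>x. \<not> P e x))"
    using assms(1) by (intro predicative_not predicative_all assms(2)) blast
  then show ?thesis by simp
qed

lemma predicative_ex1 [pred_intros]:
  assumes "\<And>e x. P e x \<Longrightarrow> setp x" "predicative (\<lambda>e. \<exists>x. P e x \<and> (\<forall>y. P e y \<longrightarrow> y = x))"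
  shows "predicative (\<lambda>e. \<exists>!x. P e x)"
  using assms(2) unfolding Ex1_def .

lemma definable_var [pred_intros]: "definable (\<lambda>e. e j)"
  unfolding definable_def predicative_def
  by (rule exI[of _ "PMem 0 (2 * Suc j)"]) (auto simp: interleave_def)

lemma definable_const [pred_intros]: "definable (\<lambda>e. c)"
  unfolding definable_def predicative_def
  by (rule exI[of _ "PMem 0 1"]) (auto simp: interleave_def)

lemma definable_shift:
  assumes "definable t" shows "definable (\<lambda>e. t (\<lambda>i. e (Suc i)))"
proof -
  define r where "r i = (case i of 0 \<Rightarrow> 0 | Suc k \<Rightarrow> Suc (Suc k))" for i
  have "inj r" by (auto simp: r_def inj_def split: nat.splits)
  from predicative_reindex[OF assms[unfolded definable_def] this]
  show ?thesis by (simp add: definable_def r_def)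
qed

lemma setpI: "x \<epsilon> y \<Longrightarrow> setp x"
  by (auto simp: setp_def)

end

section \<open>Equality, membership and comprehension for definable classes\<close>

context class_theory_C
begin

lemma predicative_eq [pred_intros]:
  assumes "definable a" "definable b" shows "predicative (\<lambda>e. a e = b e)"
proof -
  have "(\<lambda>e. a e = b e) = (\<lambda>e. \<forall>z. z \<epsilon> a e \<longleftrightarrow> z \<epsilon> b e)"
    using extensionality by (intro ext) metis
  moreover have "predicative (\<lambda>e. \<forall>z. z \<epsilon> a e \<longleftrightarrow> z \<epsilon> b e)"
    using assms unfolding definable_def by (intro pred_intros) (auto intro: setpI)
  ultimately show ?thesis by simp
qed

text \<open>Definability of \<open>b\<close> concerns membership of a variable only, so the term
  \<open>a e\<close> is first named by a quantified member.\<close>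

lemma predicative_mem [pred_intros]:
  assumes "definable a" "definable b" shows "predicative (\<lambda>e. a e \<epsilon> b e)"
proof -
  have "(\<lambda>e. a e \<epsilon> b e) = (\<lambda>e. \<exists>z. z = a e \<and> z \<epsilon> b e)" by auto
  moreover have "predicative (\<lambda>e. \<exists>z. z = a e \<and> z \<epsilon> b e)"
    using assms(2) unfolding definable_def
    by (intro pred_intros definable_shift assms(1)) (auto intro: setpI)
  ultimately show ?thesis by simp
qed

lemma predicative_setp [pred_intros]:
  assumes "definable a" shows "predicative (\<lambda>e. setp (a e))"
proof -
  \<comment> \<open>The definition of \<open>setp\<close> quantifies over classes. Being equal to
    some set is the same condition with a set quantifier.\<close>
  have "predicative (\<lambda>e. \<not> (\<forall>\<^sub>s x. x \<noteq> a e))"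
    by (intro predicative_not predicative_AllSet predicative_eq definable_shift pred_intros assms)
  then show ?thesis by simp
qed

lemma comprehension_env:
  assumes "predicative (\<lambda>e. P (\<lambda>i. e (Suc i)) (e 0))"
  shows "\<exists>C. \<forall>x. x \<epsilon> C \<longleftrightarrow> setp x \<and> P e x"
proof -
  obtain f c where f: "\<And>e. P (\<lambda>i. e (Suc i)) (e 0) \<longleftrightarrow> psat (\<epsilon>) (interleave e c) f"
    using assms unfolding predicative_def by blast
  have "P e x \<longleftrightarrow> psat (\<epsilon>) ((interleave (case_nat undefined e) c)(0 := x)) f" for x
  proof -
    have "(interleave (case_nat undefined e) c)(0 := x) = interleave (case_nat x e) c"
      by (rule ext) (auto simp: interleave_def elim!: evenE split: nat.split)
    then show ?thesis using f[of "case_nat x e"] by simp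
  qed
  then show ?thesis using comprehension by simp
qed

lemma mem_coll_env:
  assumes "predicative (\<lambda>e. P (\<lambda>i. e (Suc i)) (e 0))"
  shows "x \<epsilon> coll (P e) \<longleftrightarrow> setp x \<and> P e x"
proof -
  have "\<exists>!C. \<forall>x. x \<epsilon> C \<longleftrightarrow> setp x \<and> P e x"
    using comprehension_env[OF assms] extensionality by (auto intro!: ex_ex1I)
  from theI'[OF this] show ?thesis unfolding coll_def by blast
qed

lemma mem_coll:
  assumes "predicative (\<lambda>e. P (e 0))"
  shows "x \<epsilon> coll P \<longleftrightarrow> setp x \<and> P x"
  using mem_coll_env[of "\<lambda>_. P"] assms by simp

lemma definable_coll [pred_intros]:
  assumes "predicative (\<lambda>e. P (\<lambda>i. e (Suc i)) (e 0))"
  shows "definable (\<lambda>e. coll (P e))"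
  unfolding definable_def mem_coll_env[OF assms]
  by (intro pred_intros assms)

end

section \<open>Sets, pairs and induction on membership\<close>

context class_theory_C
begin

lemma definable_reindex:
  assumes "definable t" "inj r" shows "definable (\<lambda>e. t (\<lambda>i. e (r i)))"
proof -
  have "inj (case_nat 0 (\<lambda>i. Suc (r i)))"
    by (auto intro!: injI split: nat.splits dest: injD[OF assms(2)])
  from predicative_reindex[OF assms(1)[unfolded definable_def] this]
  show ?thesis by (simp add: definable_def)
qed

text \<open>For notions that take a predicate as argument, such as \<open>fun_on\<close>: inside
  their definition the argument is applied to a bound variable \<open>k\<close> under further
  binders, and \<open>r\<close> records how these shift the environment.\<close>

lemma predicative_inst:
  assumes "predicative (\<lambda>e. P (\<lambda>i. e (Suc i)) (e 0))" "inj r" "k \<notin> range r"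
  shows "predicative (\<lambda>e. P (\<lambda>i. e (r i)) (e k))"
proof -
  have "inj (case_nat k r)"
    using assms(3) by (auto intro!: injI split: nat.splits dest: injD[OF assms(2)])
  from predicative_reindex[OF assms(1) this] show ?thesis by simp
qed

lemma predicative_inst2:
  assumes "predicative (\<lambda>e. P (\<lambda>i. e (Suc (Suc i))) (e (Suc 0)) (e 0))" "inj r"
    "j \<notin> range r" "k \<notin> range r" "j \<noteq> k"
  shows "predicative (\<lambda>e. P (\<lambda>i. e (r i)) (e j) (e k))"
proof -
  have "inj (case_nat k (case_nat j r))"
    using assms(3-) by (auto intro!: injI split: nat.splits dest: injD[OF assms(2)])
  from predicative_reindex[OF assms(1) this] show ?thesis by simp
qed

lemma mem_cempty [simp]: "\<not> x \<epsilon> cempty"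
  unfolding cempty_def by (subst mem_coll) (auto intro: pred_intros)

lemma setp_cempty [simp]: "setp cempty"
proof -
  obtain a where "setp a" "\<forall>x. \<not> x \<epsilon> a" using empty_set by blast
  moreover from this have "a = cempty" by (intro extensionality) auto
  ultimately show ?thesis by simp
qed

lemma mem_upair: "z \<epsilon> upair x y \<longleftrightarrow> setp z \<and> (z = x \<or> z = y)"
  unfolding upair_def by (rule mem_coll) (intro pred_intros)

text \<open>Proper classes are filtered out by \<open>coll\<close>, so the pair of arbitrary classes
  is still a set with at most two members. Codes are therefore sets unconditionally; sethood of the
  components matters only for injectivity.\<close>

lemma setp_upair [simp]: "setp (upair x y)"
proof -
  have *: "setp (upair u v)" if "setp u" "setp v" for u v
  proof -
    obtain c where "setp c" "\<forall>x. x \<epsilon> c \<longleftrightarrow> x = u \<or> x = v" using pairing \<open>setp u\<close> \<open>setp v\<close> by blast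
    moreover from this that have "c = upair u v" by (intro extensionality) (auto simp: mem_upair)
    ultimately show ?thesis by simp
  qed
  consider "setp x" "setp y" | "setp x" "\<not> setp y" | "\<not> setp x" "setp y" | "\<not> setp x" "\<not> setp y"
    by blast
  then show ?thesis
  proof cases
    case 2
    then have "upair x y = upair x x" by (intro extensionality) (auto simp: mem_upair)
    then show ?thesis using * 2 by simp
  next
    case 3
    then have "upair x y = upair y y" by (intro extensionality) (auto simp: mem_upair)
    then show ?thesis using * 3 by simp
  next
    case 4
    then have "upair x y = cempty" by (intro extensionality) (auto simp: mem_upair)
    then show ?thesis by simp
  qed (use * in blast)
qed

lemma mem_sing: "z \<epsilon> sing x \<longleftrightarrow> setp z \<and> z = x"
  unfolding sing_def by (auto simp: mem_upair)

lemma setp_sing [simp]: "setp (sing x)"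
  by (simp add: sing_def)

lemma setp_opair [simp]: "setp \<langle>x, y\<rangle>"
  by (simp add: opair_def)

lemma upair_eq_iff:
  assumes "setp x" "setp y" "setp u" "setp v"
  shows "upair x y = upair u v \<longleftrightarrow> x = u \<and> y = v \<or> x = v \<and> y = u"
proof
  assume "upair x y = upair u v"
  then have "z = x \<or> z = y \<longleftrightarrow> z = u \<or> z = v" if "setp z" for z
    using that mem_upair by metis
  then show "x = u \<and> y = v \<or> x = v \<and> y = u" using assms by metis
next
  assume "x = u \<and> y = v \<or> x = v \<and> y = u"
  then show "upair x y = upair u v" by (intro extensionality) (auto simp: mem_upair)
qed

lemma opair_eq_iff [simp]:
  assumes "setp x" "setp y" "setp u" "setp v"
  shows "\<langle>x, y\<rangle> = \<langle>u, v\<rangle> \<longleftrightarrow> x = u \<and> y = v"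
  using assms by (auto simp: opair_def sing_def upair_eq_iff)

lemma definable_upair [pred_intros]:
  "definable a \<Longrightarrow> definable b \<Longrightarrow> definable (\<lambda>e. upair (a e) (b e))"
  unfolding upair_def by (intro pred_intros definable_shift)

lemma definable_sing [pred_intros]: "definable a \<Longrightarrow> definable (\<lambda>e. sing (a e))"
  unfolding sing_def by (intro pred_intros)

lemma definable_opair [pred_intros]:
  "definable a \<Longrightarrow> definable b \<Longrightarrow> definable (\<lambda>e. \<langle>a e, b e\<rangle>)"
  unfolding opair_def by (intro pred_intros)

lemma definable_csucc [pred_intros]: "definable a \<Longrightarrow> definable (\<lambda>e. csucc (a e))"
  unfolding csucc_def by (intro pred_intros definable_shift)

section \<open>Consequences of replacement and union\<close>

lemma setp_subset:
  assumes "setp b" "\<And>x. x \<epsilon> a \<Longrightarrow> x \<epsilon> b" shows "setp a"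
proof -
  \<comment> \<open>Replacement along the identity of \<open>a\<close>: the image of
    \<open>b\<close> under it is \<open>a\<close>.\<close>
  define F where "F = coll (\<lambda>p. \<exists>x. x \<epsilon> a \<and> p = \<langle>x, x\<rangle>)"
  have F: "p \<epsilon> F \<longleftrightarrow> setp p \<and> (\<exists>x. x \<epsilon> a \<and> p = \<langle>x, x\<rangle>)" for p
    unfolding F_def by (rule mem_coll) (intro pred_intros; auto intro: setpI)
  have "\<exists>c. setp c \<and> (\<forall>y. y \<epsilon> c \<longleftrightarrow> setp y \<and> (\<exists>x. x \<epsilon> b \<and> \<langle>x, y\<rangle> \<epsilon> F))"
    using assms(1) by (rule replacement) (auto simp: F dest!: setpI)
  then obtain c where c: "setp c" "\<And>y. y \<epsilon> c \<longleftrightarrow> setp y \<and> (\<exists>x. x \<epsilon> b \<and> \<langle>x, y\<rangle> \<epsilon> F)"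
    by blast
  have "c = a"
    unfolding c(2)
  proof (rule extensionality)
    fix y show "y \<epsilon> c \<longleftrightarrow> y \<epsilon> a"
      unfolding c(2) using assms(2) by (auto simp: F dest: setpI) (metis opair_eq_iff setpI)
  qed
  with c(1) show ?thesis by simp
qed

text \<open>Replacement for a predicative relation in place of a class of pairs. Functionality is
  required on \<open>a\<close> only, because \<open>F\<close> is cut down to first components in
  \<open>a\<close>.\<close>

lemma set_image:
  assumes "setp a" "predicative (\<lambda>e. R (e (Suc 0)) (e 0))"
    "\<And>x y z. x \<epsilon> a \<Longrightarrow> setp y \<Longrightarrow> setp z \<Longrightarrow> R x y \<Longrightarrow> R x z \<Longrightarrow> y = z"
  obtains b where "setp b" "\<And>y. y \<epsilon> b \<longleftrightarrow> setp y \<and> (\<exists>x. x \<epsilon> a \<and> R x y)"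
proof -
  define F where "F = coll (\<lambda>p. \<exists>x y. x \<epsilon> a \<and> setp y \<and> R x y \<and> p = \<langle>x, y\<rangle>)"
  have F: "p \<epsilon> F \<longleftrightarrow> setp p \<and> (\<exists>x y. x \<epsilon> a \<and> setp y \<and> R x y \<and> p = \<langle>x, y\<rangle>)" for p
    unfolding F_def by (rule mem_coll)
      (intro pred_intros assms(2); auto intro: setpI)
  have "\<exists>c. setp c \<and> (\<forall>y. y \<epsilon> c \<longleftrightarrow> setp y \<and> (\<exists>x. x \<epsilon> a \<and> \<langle>x, y\<rangle> \<epsilon> F))"
    using assms(1)
  proof (rule replacement, intro allI impI)
    fix x y z
    assume "setp x" "setp y" "setp z" and "\<langle>x, y\<rangle> \<epsilon> F \<and> \<langle>x, z\<rangle> \<epsilon> F"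
    then show "y = z" using assms(3) by (auto simp: F) (metis opair_eq_iff setpI)
  qed
  then obtain c where c: "setp c" "\<And>y. y \<epsilon> c \<longleftrightarrow> setp y \<and> (\<exists>x. x \<epsilon> a \<and> \<langle>x, y\<rangle> \<epsilon> F)"
    by blast
  have "y \<epsilon> c \<longleftrightarrow> setp y \<and> (\<exists>x. x \<epsilon> a \<and> R x y)" for y
    unfolding c(2) F by (metis opair_eq_iff setpI setp_opair)
  with c(1) that show thesis by blast
qed

definition cun :: "'a \<Rightarrow> 'a \<Rightarrow> 'a" where
  "cun a b = coll (\<lambda>x. x \<epsilon> a \<or> x \<epsilon> b)"

lemma mem_cun [simp]: "x \<epsilon> cun a b \<longleftrightarrow> x \<epsilon> a \<or> x \<epsilon> b"
  unfolding cun_def by (subst mem_coll) (auto intro!: pred_intros intro: setpI)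

lemma definable_cun [pred_intros]:
  "definable a \<Longrightarrow> definable b \<Longrightarrow> definable (\<lambda>e. cun (a e) (b e))"
  unfolding cun_def by (intro pred_intros definable_shift)

lemma setp_cun:
  assumes "setp a" "setp b" shows "setp (cun a b)"
proof -
  obtain u where u: "setp u" "\<And>x. x \<epsilon> u \<longleftrightarrow> (\<exists>y. y \<epsilon> upair a b \<and> x \<epsilon> y)"
    using union[of "upair a b"] by auto
  show ?thesis
    by (rule setp_subset[OF u(1)]) (use assms in \<open>auto simp: u(2) mem_upair\<close>)
qed

definition cins :: "'a \<Rightarrow> 'a \<Rightarrow> 'a" where
  "cins y a = cun a (sing y)"

lemma mem_cins: "x \<epsilon> cins y a \<longleftrightarrow> x \<epsilon> a \<or> setp x \<and> x = y"
  by (simp add: cins_def mem_sing)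

lemma setp_cins: "setp a \<Longrightarrow> setp (cins y a)"
  by (simp add: cins_def setp_cun)

lemma csucc_eq_cins: "csucc n = cins n n"
  by (rule extensionality) (unfold csucc_def, subst mem_coll, intro pred_intros,
      auto simp: mem_cins intro: setpI)

lemma mem_csucc: "x \<epsilon> csucc n \<longleftrightarrow> x \<epsilon> n \<or> setp x \<and> x = n"
  by (simp add: csucc_eq_cins mem_cins)

lemma setp_csucc: "setp n \<Longrightarrow> setp (csucc n)"
  by (simp add: csucc_eq_cins setp_cins)

section \<open>Foundation and induction on membership\<close>

lemma eps_induct [consumes 2]:
  assumes "predicative (\<lambda>e. P (e 0))" "setp x"
    and step: "\<And>x. setp x \<Longrightarrow> (\<And>y. y \<epsilon> x \<Longrightarrow> P y) \<Longrightarrow> P x"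
  shows "P x"
proof (rule ccontr)
  \<comment> \<open>Predicativity makes the counterexamples a class; a minimal element of it
    contradicts \<open>step\<close>.\<close>
  define F where "F = coll (\<lambda>x. \<not> P x)"
  have F: "x \<epsilon> F \<longleftrightarrow> setp x \<and> \<not> P x" for x
    unfolding F_def by (rule mem_coll) (intro pred_intros assms(1))
  assume "\<not> P x"
  with \<open>setp x\<close> have "x \<epsilon> F" by (simp add: F)
  from foundation[OF this] obtain y where "y \<epsilon> F" "\<And>z. z \<epsilon> y \<Longrightarrow> \<not> z \<epsilon> F" by blast
  then show False using step[of y] by (auto simp: F dest: setpI)
qed

lemma mem_irrefl: "\<not> x \<epsilon> x"
proof
  assume "x \<epsilon> x"
  from foundation[of x "sing x"] this show False by (auto simp: mem_sing dest: setpI)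
qed

lemma mem_asym: "x \<epsilon> y \<Longrightarrow> \<not> y \<epsilon> x"
  using foundation[of x "upair x y"] by (auto simp: mem_upair dest: setpI)

lemma mem_no_cycle3: "x \<epsilon> y \<Longrightarrow> y \<epsilon> z \<Longrightarrow> \<not> z \<epsilon> x"
  using foundation[of x "cins z (upair x y)"] by (auto simp: mem_upair mem_cins dest: setpI)

lemma csucc_inject: "setp m \<Longrightarrow> setp n \<Longrightarrow> csucc m = csucc n \<Longrightarrow> m = n"
  by (metis mem_csucc mem_asym)

lemma csucc_neq_cempty: "setp m \<Longrightarrow> csucc m \<noteq> cempty"
  by (metis mem_csucc mem_cempty)

lemma setp_num [simp]: "setp (num k)"
  by (induction k) (simp_all add: setp_csucc)

lemma num_eq_iff [simp]: "num i = num j \<longleftrightarrow> i = j"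
proof (induction i arbitrary: j)
  case 0
  then show ?case using csucc_neq_cempty[of "num k" for k] by (cases j) (auto, metis setp_num)
next
  case (Suc i)
  show ?case
  proof (cases j)
    case (Suc k)
    then show ?thesis using csucc_inject[of "num i" "num k"] Suc.IH[of k] by auto
  qed (use csucc_neq_cempty[of "num i"] in auto)
qed

section \<open>Induction on constituents of bounded depth\<close>

primrec mem_depth :: "nat \<Rightarrow> 'a \<Rightarrow> 'a \<Rightarrow> bool" where
  "mem_depth 0 y x \<longleftrightarrow> y = x"
| "mem_depth (Suc k) y x \<longleftrightarrow> (\<exists>z. z \<epsilon> x \<and> mem_depth k y z)"

lemma mem_depth_add: "mem_depth j x y \<Longrightarrow> mem_depth k y z \<Longrightarrow> mem_depth (j + k) x z"
  by (induction k arbitrary: z) auto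

text \<open>Seven is the depth at which the arguments of \<open>Fn f a\<close> sit below it.\<close>

definition below :: "'a \<Rightarrow> 'a \<Rightarrow> bool" where
  "below y x \<longleftrightarrow> (\<exists>k\<in>{1..7}. mem_depth k y x)"

text \<open>The recursion runs over an external number, which is harmless: each fixed
  \<open>k\<close> unfolds to a single predicative condition.\<close>

primrec all_depth :: "nat \<Rightarrow> ('a \<Rightarrow> bool) \<Rightarrow> 'a \<Rightarrow> bool" where
  "all_depth 0 P x \<longleftrightarrow> P x"
| "all_depth (Suc k) P x \<longleftrightarrow> P x \<and> (\<forall>y. y \<epsilon> x \<longrightarrow> all_depth k P y)"

lemma all_depthD: "all_depth k P x \<Longrightarrow> mem_depth j y x \<Longrightarrow> j \<le> k \<Longrightarrow> P y"
proof (induction k arbitrary: x j)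
  case (Suc k)
  then show ?case by (cases j) auto
qed simp

lemma all_depth_SucD: "all_depth (Suc k) P x \<Longrightarrow> all_depth k P x"
  by (induction k arbitrary: x) auto

lemma predicative_all_depth:
  "predicative (\<lambda>e. P (e 0)) \<Longrightarrow> predicative (\<lambda>e. all_depth k P (e 0))"
  by (induction k) (auto intro!: pred_intros intro: setpI)

text \<open>Constituents of a code lie several membership steps below it, out of reach of plain
  \<epsilon>-induction. The property is therefore strengthened to hold down to depth 6: whatever
  lies at depth at most 7 below \<open>x\<close> lies at depth at most 6 below an element of
  \<open>x\<close>. A bounded depth avoids transitive closures.\<close>

lemma below_induct [consumes 2, case_names below]:
  assumes "predicative (\<lambda>e. P (e 0))" "setp x"
    and step: "\<And>x. setp x \<Longrightarrow> (\<And>y. below y x \<Longrightarrow> P y) \<Longrightarrow> P x"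
  shows "P x"
proof -
  have "all_depth 6 P x"
    using predicative_all_depth[OF assms(1)] assms(2)
  proof (rule eps_induct)
    fix x assume x: "setp x" and IH: "\<And>y. y \<epsilon> x \<Longrightarrow> all_depth 6 P y"
    have "P x"
    proof (rule step[OF x])
      fix y assume "below y x"
      then obtain k where "k < 7" "mem_depth (Suc k) y x"
        unfolding below_def by (metis Suc_le_D Suc_le_lessD atLeastAtMost_iff One_nat_def)
      then show "P y" using all_depthD[OF IH, of _ k y] by auto
    qed
    moreover have "all_depth 5 P y" if "y \<epsilon> x" for y
      using all_depth_SucD[of 5] IH[OF that] by simp
    ultimately show "all_depth 6 P x" by (simp add: numeral_eq_Suc)
  qed
  then show ?thesis by (rule all_depthD[where j = 0]) auto
qed

text \<open>Both components belong to \<open>upair x y\<close>, an element of the Kuratowski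
  pair.\<close>

lemma mem_depth_opair:
  assumes "setp x" "setp y"
  shows "mem_depth 2 x \<langle>x, y\<rangle>" "mem_depth 2 y \<langle>x, y\<rangle>"
proof -
  have "upair x y \<epsilon> \<langle>x, y\<rangle>" "x \<epsilon> upair x y" "y \<epsilon> upair x y"
    using assms by (auto simp: opair_def mem_upair)
  then show "mem_depth 2 x \<langle>x, y\<rangle>" "mem_depth 2 y \<langle>x, y\<rangle>"
    by (auto simp: numeral_eq_Suc)
qed

end

section \<open>Natural numbers and finite sets\<close>

context class_theory_C
begin

section \<open>Predicativity of the notions built on finiteness\<close>

lemma predicative_is_nat [pred_intros]:
  assumes "definable a" shows "predicative (\<lambda>e. is_nat (a e))"
proof -
  \<comment> \<open>The quantifier over \<open>x \<epsilon> n \<or> x = n\<close> is not visibly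
    limited to sets, so the case \<open>x = n\<close> is split off.\<close>
  have "is_nat n \<longleftrightarrow> setp n
     \<and> (\<forall>x. x \<epsilon> n \<longrightarrow> (\<forall>y. y \<epsilon> x \<longrightarrow> y \<epsilon> n))
     \<and> (\<forall>x. x \<epsilon> n \<longrightarrow> (\<forall>y. y \<epsilon> n \<longrightarrow> x \<epsilon> y \<or> x = y \<or> y \<epsilon> x))
     \<and> (\<forall>x. x \<epsilon> n \<longrightarrow> x = cempty \<or> (\<exists>\<^sub>s y. x = csucc y))
     \<and> (n = cempty \<or> (\<exists>\<^sub>s y. n = csucc y))" for n
    unfolding is_nat_def by blast
  then show ?thesis
    by (simp only:) (intro pred_intros assms definable_reindex[OF assms]; auto simp: inj_def intro: setpI)
qed

lemma predicative_fun_on [pred_intros]: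
  assumes "definable f" "definable a" "predicative (\<lambda>e. P (\<lambda>i. e (Suc i)) (e 0))"
  shows "predicative (\<lambda>e. fun_on (f e) (a e) (P e))"
  unfolding fun_on_def
  by (intro pred_intros definable_reindex[OF assms(1)] definable_reindex[OF assms(2)]
      predicative_inst[OF assms(3)]) (auto simp: inj_def intro: setpI)

lemma predicative_finite_set [pred_intros]:
  assumes "definable a" shows "predicative (\<lambda>e. finite_set (a e))"
  unfolding finite_set_def
  by (intro pred_intros assms definable_reindex[OF assms]) (auto simp: inj_def intro: setpI)

lemma predicative_pointwise [pred_intros]:
  assumes "definable a" "definable b"
    "predicative (\<lambda>e. P (\<lambda>i. e (Suc (Suc i))) (e (Suc 0)) (e 0))"
  shows "predicative (\<lambda>e. pointwise (P e) (a e) (b e))"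
  unfolding pointwise_def
  by (intro pred_intros definable_reindex[OF assms(1)] definable_reindex[OF assms(2)]
      predicative_inst2[OF assms(3)]) (auto simp: inj_def intro: setpI)

lemma finite_setp: "finite_set x \<Longrightarrow> setp x"
  by (simp add: finite_set_def)

text \<open>Derivations are finite sets, so the quantifier over \<open>X\<close> is a set
  quantifier. Through this rule every inductively defined part of the syntax becomes available for
  comprehension and induction.\<close>

lemma predicative_generated [pred_intros]:
  assumes "definable p" "predicative (\<lambda>e. step (\<lambda>i. e (Suc (Suc i))) (e (Suc 0)) (e 0))"
  shows "predicative (\<lambda>e. generated (step e) (p e))"
  unfolding generated_def
  by (intro pred_intros definable_reindex[OF assms(1)] predicative_inst2[OF assms(2)])
    (auto simp: inj_def intro: setpI finite_setp)

section \<open>Natural numbers\<close>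

lemma setp_nat: "is_nat n \<Longrightarrow> setp n"
  by (simp add: is_nat_def)

lemma nat_cempty: "is_nat cempty"
  by (simp add: is_nat_def)

lemma nat_csucc: assumes "is_nat n" shows "is_nat (csucc n)"
proof -
  have n: "setp n" using assms by (simp add: is_nat_def)
  have 1: "y \<epsilon> csucc n" if "x \<epsilon> csucc n" "y \<epsilon> x" for x y
    using assms that unfolding is_nat_def mem_csucc by blast
  have 2: "x \<epsilon> y \<or> x = y \<or> y \<epsilon> x" if "x \<epsilon> csucc n" "y \<epsilon> csucc n" for x y
    using assms that unfolding is_nat_def mem_csucc by blast
  have 3: "x = cempty \<or> (\<exists>\<^sub>s y. x = csucc y)" if "x \<epsilon> csucc n \<or> x = csucc n" for x
    using assms that n unfolding is_nat_def mem_csucc by blast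
  show ?thesis using n 1 2 3 unfolding is_nat_def by (auto intro: setp_csucc)
qed

lemma nat_trans: "is_nat n \<Longrightarrow> x \<epsilon> n \<Longrightarrow> y \<epsilon> x \<Longrightarrow> y \<epsilon> n"
  unfolding is_nat_def by blast

lemma nat_mem:
  assumes "is_nat n" "m \<epsilon> n" shows "is_nat m"
proof -
  have lin: "x \<epsilon> y \<or> x = y \<or> y \<epsilon> x" if "x \<epsilon> n" "y \<epsilon> n" for x y
    using assms(1) that unfolding is_nat_def by blast
  have "y \<epsilon> m" if "x \<epsilon> m" "y \<epsilon> x" for x y
  proof -
    have "y \<epsilon> n" using nat_trans[OF assms(1)] that assms(2) by blast
    \<comment> \<open>The last two alternatives would close a membership cycle of length two or
      three through \<open>x\<close>.\<close>
    with lin assms(2) have "y \<epsilon> m \<or> y = m \<or> m \<epsilon> y" by blast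
    then show ?thesis using that mem_asym mem_no_cycle3 by blast
  qed
  moreover have "x \<epsilon> n" if "x \<epsilon> m" for x using nat_trans[OF assms that] .
  moreover have "x = cempty \<or> (\<exists>\<^sub>s y. x = csucc y)" if "x \<epsilon> n" for x
    using assms(1) that unfolding is_nat_def by blast
  ultimately show ?thesis
    using lin assms(2) setpI unfolding is_nat_def by blast
qed

text \<open>An instance of \<epsilon>-induction: by definition a natural number is zero or a
  successor, and its predecessor is one of its elements, hence again a natural number.\<close>

lemma nat_induct [consumes 2, case_names zero succ]:
  assumes "predicative (\<lambda>e. P (e 0))" "is_nat n"
    and zero: "P cempty"
    and succ: "\<And>m. is_nat m \<Longrightarrow> P m \<Longrightarrow> P (csucc m)"
  shows "P n"
proof -
  have "predicative (\<lambda>e. is_nat (e 0) \<longrightarrow> P (e 0))"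
    by (intro pred_intros assms(1))
  moreover have "setp n" using assms(2) by (rule setp_nat)
  ultimately have "is_nat n \<longrightarrow> P n"
  proof (rule eps_induct)
    fix x assume IH: "\<And>y. y \<epsilon> x \<Longrightarrow> is_nat y \<longrightarrow> P y"
    show "is_nat x \<longrightarrow> P x"
    proof
      assume x: "is_nat x"
      then consider "x = cempty" | y where "setp y" "x = csucc y"
        unfolding is_nat_def by blast
      then show "P x"
      proof cases
        case 2
        then have "y \<epsilon> x" by (simp add: mem_csucc)
        then show ?thesis using IH nat_mem[OF x] succ 2 by simp
      qed (use zero in simp)
    qed
  qed
  with assms(2) show ?thesis by simp
qed

section \<open>Functions and finite sets\<close>

lemma finite_set_cempty: "finite_set cempty"
  unfolding finite_set_def fun_on_def using nat_cempty setp_cempty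
  by (intro conjI exI[of _ cempty]) auto

lemma cins_absorb: "y \<epsilon> X \<Longrightarrow> cins y X = X"
  by (rule extensionality) (auto simp: mem_cins)

lemma fun_on_mono: "fun_on f a P \<Longrightarrow> (\<And>y. P y \<Longrightarrow> Q y) \<Longrightarrow> fun_on f a Q"
  unfolding fun_on_def by blast

lemma fun_onD:
  assumes "fun_on f a P" "\<langle>x, y\<rangle> \<epsilon> f" "setp x" "setp y"
  shows "x \<epsilon> a" "P y"
  using assms unfolding fun_on_def by (metis opair_eq_iff setpI)+

lemma fun_on_value:
  assumes "fun_on f a P" "x \<epsilon> a"
  obtains y where "setp y" "P y" "\<langle>x, y\<rangle> \<epsilon> f"
  using assms fun_onD[OF assms(1)] setpI unfolding fun_on_def by metis

lemma fun_on_unique: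
  assumes "fun_on f a P" "\<langle>x, y\<rangle> \<epsilon> f" "\<langle>x, z\<rangle> \<epsilon> f" "setp x" "setp y" "setp z"
  shows "y = z"
  using assms fun_onD(1)[OF assms(1)] unfolding fun_on_def by metis

lemma fun_on_pair:
  assumes "fun_on f a P" "p \<epsilon> f"
  obtains x y where "x \<epsilon> a" "setp x" "setp y" "P y" "p = \<langle>x, y\<rangle>"
  using assms setpI unfolding fun_on_def by metis

lemma fun_onI:
  assumes "\<And>p. p \<epsilon> f \<Longrightarrow> \<exists>x y. x \<epsilon> a \<and> setp y \<and> P y \<and> p = \<langle>x, y\<rangle>"
    "\<And>x. x \<epsilon> a \<Longrightarrow> \<exists>y. setp y \<and> \<langle>x, y\<rangle> \<epsilon> f"
    "\<And>x y z. x \<epsilon> a \<Longrightarrow> setp y \<Longrightarrow> setp z \<Longrightarrow> \<langle>x, y\<rangle> \<epsilon> f \<Longrightarrow> \<langle>x, z\<rangle> \<epsilon> f \<Longrightarrow> y = z"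
  shows "fun_on f a P"
  unfolding fun_on_def using assms by (intro conjI allI impI ex_ex1I) blast+

lemma finite_set_cins:
  assumes "finite_set X" "setp y" shows "finite_set (cins y X)"
proof (cases "y \<epsilon> X")
  case False
  from assms(1) obtain n f where nf: "setp X" "setp n" "is_nat n" "setp f" "fun_on f n (\<lambda>y. y \<epsilon> X)"
    "\<And>y. y \<epsilon> X \<Longrightarrow> \<exists>!i. i \<epsilon> n \<and> \<langle>i, y\<rangle> \<epsilon> f"
    unfolding finite_set_def by blast
  define g where "g = cins \<langle>n, y\<rangle> f"
  have g: "\<langle>i, z\<rangle> \<epsilon> g \<longleftrightarrow> \<langle>i, z\<rangle> \<epsilon> f \<or> i = n \<and> z = y" if "setp i" "setp z" for i z
    using that \<open>setp n\<close> \<open>setp y\<close> by (auto simp: g_def mem_cins)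
  have nn: "\<not> \<langle>n, z\<rangle> \<epsilon> f" if "setp z" for z
    using fun_onD(1)[OF nf(5)] that \<open>setp n\<close> mem_irrefl by blast
  have ny: "\<not> \<langle>i, y\<rangle> \<epsilon> f" if "setp i" for i
    using fun_onD(2)[OF nf(5)] that \<open>setp y\<close> False by blast
  have "fun_on g (csucc n) (\<lambda>z. z \<epsilon> cins y X)"
  proof (rule fun_onI)
    fix p assume "p \<epsilon> g"
    then show "\<exists>x z. x \<epsilon> csucc n \<and> setp z \<and> z \<epsilon> cins y X \<and> p = \<langle>x, z\<rangle>"
      unfolding g_def mem_cins using fun_on_pair[OF nf(5)] mem_csucc mem_cins \<open>setp n\<close> \<open>setp y\<close>
      by metis
  next
    fix x assume "x \<epsilon> csucc n"
    then show "\<exists>z. setp z \<and> \<langle>x, z\<rangle> \<epsilon> g"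
      using fun_on_value[OF nf(5)] g setpI \<open>setp n\<close> \<open>setp y\<close> unfolding mem_csucc by metis
  next
    fix x z z' assume "x \<epsilon> csucc n" "setp z" "setp z'" "\<langle>x, z\<rangle> \<epsilon> g" "\<langle>x, z'\<rangle> \<epsilon> g"
    then show "z = z'" using fun_on_unique[OF nf(5)] g nn setpI by metis
  qed
  moreover have "\<exists>!i. i \<epsilon> csucc n \<and> \<langle>i, z\<rangle> \<epsilon> g" if "z \<epsilon> cins y X" for z
  proof (cases "z = y")
    case True
    then show ?thesis using g ny nn \<open>setp n\<close> \<open>setp y\<close> setpI unfolding mem_csucc by metis
  next
    case F: False
    with that have "z \<epsilon> X" by (simp add: mem_cins)
    then show ?thesis using nf(6)[OF \<open>z \<epsilon> X\<close>] g F nn setpI unfolding mem_csucc by metis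
  qed
  moreover have "setp g" using \<open>setp f\<close> by (simp add: g_def setp_cins)
  ultimately show ?thesis
    unfolding finite_set_def using nat_csucc[OF \<open>is_nat n\<close>] setp_cins[OF \<open>setp X\<close>] \<open>setp n\<close>
    by (intro conjI exI[of _ "csucc n"] exI[of _ g] allI impI) (simp_all add: setp_csucc)
qed (simp add: cins_absorb assms)

text \<open>Induction along an enumeration \<open>f\<close> of \<open>X\<close>: the images of the
  initial segments of its index set grow by one element at a time and end with
  \<open>X\<close>.\<close>

lemma finite_set_induct [consumes 2, case_names empty insert]:
  assumes "predicative (\<lambda>e. P (e 0))" "finite_set X"
    and empty: "P cempty"
    and insert: "\<And>Y y. finite_set Y \<Longrightarrow> setp y \<Longrightarrow> P Y \<Longrightarrow> P (cins y Y)"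
  shows "P X"
proof -
  from assms(2) obtain n f where nf: "setp X" "is_nat n" "setp f" "fun_on f n (\<lambda>y. y \<epsilon> X)"
    "\<And>y. y \<epsilon> X \<Longrightarrow> \<exists>!i. i \<epsilon> n \<and> \<langle>i, y\<rangle> \<epsilon> f"
    unfolding finite_set_def by blast
  define img where "img m = coll (\<lambda>y. \<exists>i. i \<epsilon> m \<and> \<langle>i, y\<rangle> \<epsilon> f)" for m
  have img: "y \<epsilon> img m \<longleftrightarrow> setp y \<and> (\<exists>i. i \<epsilon> m \<and> \<langle>i, y\<rangle> \<epsilon> f)" for y m
    unfolding img_def by (rule mem_coll) (intro pred_intros; auto intro: setpI)
  \<comment> \<open>Predicativity of \<open>P\<close> is known at variables only. Turning
    \<open>P\<close> into a class makes its application to the term \<open>img m\<close> an ordinary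
    membership statement.\<close>
  define C where "C = coll P"
  have C: "X \<epsilon> C \<longleftrightarrow> setp X \<and> P X" for X
    unfolding C_def by (rule mem_coll) (rule assms(1))
  have "predicative (\<lambda>e. e 0 \<epsilon> n \<or> e 0 = n \<longrightarrow> finite_set (img (e 0)) \<and> img (e 0) \<epsilon> C)"
    unfolding img_def by (intro pred_intros; auto intro: setpI)
  then have "n \<epsilon> n \<or> n = n \<longrightarrow> finite_set (img n) \<and> img n \<epsilon> C"
    using \<open>is_nat n\<close>
  proof (rule nat_induct)
    have "img cempty = cempty" by (rule extensionality) (simp add: img)
    then show "cempty \<epsilon> n \<or> cempty = n \<longrightarrow> finite_set (img cempty) \<and> img cempty \<epsilon> C"
      using empty finite_set_cempty by (simp add: C)
  next
    fix m assume m: "is_nat m" and IH: "m \<epsilon> n \<or> m = n \<longrightarrow> finite_set (img m) \<and> img m \<epsilon> C"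
    show "csucc m \<epsilon> n \<or> csucc m = n \<longrightarrow> finite_set (img (csucc m)) \<and> img (csucc m) \<epsilon> C"
    proof
      assume "csucc m \<epsilon> n \<or> csucc m = n"
      moreover have "m \<epsilon> csucc m" using setp_nat[OF m] by (simp add: mem_csucc)
      ultimately have mn: "m \<epsilon> n" using nat_trans[OF \<open>is_nat n\<close>] by blast
      then obtain y where y: "setp y" "\<langle>m, y\<rangle> \<epsilon> f" using fun_on_value[OF nf(4)] by blast
      have "img (csucc m) = cins y (img m)"
        by (rule extensionality)
          (use y fun_on_unique[OF nf(4)] setp_nat[OF m] in \<open>auto simp: img mem_csucc mem_cins\<close>)
      with IH mn show "finite_set (img (csucc m)) \<and> img (csucc m) \<epsilon> C"
        using finite_set_cins insert y(1) finite_setp by (simp add: C)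
    qed
  qed
  moreover have "img n = X"
  proof (rule extensionality)
    fix y show "y \<epsilon> img n \<longleftrightarrow> y \<epsilon> X"
      using nf(5) fun_onD(2)[OF nf(4)] setpI unfolding img by blast
  qed
  ultimately show ?thesis by (simp add: C)
qed

lemma finite_set_subset:
  assumes "finite_set X" "\<And>y. y \<epsilon> Y \<Longrightarrow> y \<epsilon> X" shows "finite_set Y"
proof -
  have "predicative (\<lambda>e. \<forall>\<^sub>s Y. (\<forall>y. y \<epsilon> Y \<longrightarrow> y \<epsilon> e 0) \<longrightarrow> finite_set Y)"
    by (intro pred_intros; auto intro: setpI)
  then have "\<forall>\<^sub>s Y. (\<forall>y. y \<epsilon> Y \<longrightarrow> y \<epsilon> X) \<longrightarrow> finite_set Y"
    using assms(1)
  proof (rule finite_set_induct)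
    show "\<forall>\<^sub>s Y. (\<forall>y. y \<epsilon> Y \<longrightarrow> y \<epsilon> cempty) \<longrightarrow> finite_set Y"
      using extensionality[of _ cempty] finite_set_cempty by (metis mem_cempty)
  next
    fix X z assume z: "setp z" and IH: "\<forall>\<^sub>s Y. (\<forall>y. y \<epsilon> Y \<longrightarrow> y \<epsilon> X) \<longrightarrow> finite_set Y"
    show "\<forall>\<^sub>s Y. (\<forall>y. y \<epsilon> Y \<longrightarrow> y \<epsilon> cins z X) \<longrightarrow> finite_set Y"
    proof (intro allI impI)
      fix Y assume Y: "setp Y" and sub: "\<forall>y. y \<epsilon> Y \<longrightarrow> y \<epsilon> cins z X"
      define Y' where "Y' = coll (\<lambda>y. y \<epsilon> Y \<and> y \<noteq> z)"
      have Y': "y \<epsilon> Y' \<longleftrightarrow> y \<epsilon> Y \<and> y \<noteq> z" for y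
        unfolding Y'_def by (subst mem_coll) (auto intro!: pred_intros intro: setpI)
      have "setp Y'" using setp_subset[OF Y, of Y'] by (simp add: Y')
      moreover have "\<forall>y. y \<epsilon> Y' \<longrightarrow> y \<epsilon> X" using sub by (auto simp: Y' mem_cins)
      ultimately have fin: "finite_set Y'" using IH by blast
      show "finite_set Y"
      proof (cases "z \<epsilon> Y")
        case True
        then have "Y = cins z Y'" using z by (intro extensionality) (auto simp: Y' mem_cins)
        then show ?thesis using finite_set_cins[OF fin z] by simp
      next
        case False
        then have "Y = Y'" by (intro extensionality) (auto simp: Y')
        then show ?thesis using fin by simp
      qed
    qed
  qed
  moreover have "setp Y" using setp_subset finite_setp assms by blast
  ultimately show ?thesis using assms(2) by blast
qed

lemma cun_cempty: "cun X cempty = X"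
  by (rule extensionality) simp

lemma cun_cins: "cun X (cins y Y) = cins y (cun X Y)"
  by (rule extensionality) (auto simp: mem_cins)

lemma finite_set_cun:
  assumes "finite_set X" "finite_set Y" shows "finite_set (cun X Y)"
proof -
  have "predicative (\<lambda>e. finite_set (cun X (e 0)))" by (intro pred_intros)
  then show ?thesis using assms(2)
    by (rule finite_set_induct) (simp_all add: cun_cempty cun_cins assms(1) finite_set_cins)
qed

lemma finite_set_nat:
  assumes "is_nat n" shows "finite_set n"
proof -
  have "predicative (\<lambda>e. finite_set (e 0))" by (intro pred_intros)
  then show ?thesis using assms
    by (rule nat_induct) (simp_all add: csucc_eq_cins finite_set_cempty finite_set_cins setp_nat)
qed

text \<open>Finite choice, in the form of a common bound in a directed family of finite sets.\<close>

lemma finite_directed: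
  assumes "predicative (\<lambda>e. R (e 0) (e (Suc 0)))" "predicative (\<lambda>e. G (e 0))"
    and "finite_set Y" "\<And>y. y \<epsilon> Y \<Longrightarrow> \<exists>\<^sub>s W. G W \<and> R y W"
    and empty: "G cempty"
    and un: "\<And>V W. setp V \<Longrightarrow> setp W \<Longrightarrow> G V \<Longrightarrow> G W \<Longrightarrow> G (cun V W)"
    and mono: "\<And>y V W. y \<epsilon> Y \<Longrightarrow> setp V \<Longrightarrow> setp W \<Longrightarrow> R y V \<Longrightarrow> (\<And>z. z \<epsilon> V \<Longrightarrow> z \<epsilon> W) \<Longrightarrow> R y W"
  shows "\<exists>\<^sub>s W. G W \<and> (\<forall>y. y \<epsilon> Y \<longrightarrow> R y W)"
proof -
  \<comment> \<open>The induction variable ranges over a part of \<open>Y\<close> while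
    \<open>Y\<close> itself stays fixed, because witnesses and monotonicity are available for
    elements of \<open>Y\<close> only.\<close>
  have "predicative (\<lambda>e. \<exists>\<^sub>s W. G W \<and> (\<forall>y. y \<epsilon> Y \<and> y \<epsilon> e 0 \<longrightarrow> R y W))"
    by (intro pred_intros assms(1,2); auto intro: setpI)
  then have "\<exists>\<^sub>s W. G W \<and> (\<forall>y. y \<epsilon> Y \<and> y \<epsilon> Y \<longrightarrow> R y W)"
    using assms(3)
  proof (rule finite_set_induct)
    show "\<exists>\<^sub>s W. G W \<and> (\<forall>y. y \<epsilon> Y \<and> y \<epsilon> cempty \<longrightarrow> R y W)"
      using empty setp_cempty mem_cempty by blast
  next
    fix Z z assume z: "setp z" and "\<exists>\<^sub>s W. G W \<and> (\<forall>y. y \<epsilon> Y \<and> y \<epsilon> Z \<longrightarrow> R y W)"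
    then obtain W where W: "setp W" "G W" "\<And>y. y \<epsilon> Y \<Longrightarrow> y \<epsilon> Z \<Longrightarrow> R y W" by blast
    show "\<exists>\<^sub>s W. G W \<and> (\<forall>y. y \<epsilon> Y \<and> y \<epsilon> cins z Z \<longrightarrow> R y W)"
    proof (cases "z \<epsilon> Y")
      case True
      then obtain V where V: "setp V" "G V" "R z V" using assms(4) by blast
      have "R y (cun V W)" if "y \<epsilon> Y" "y \<epsilon> cins z Z" for y
      proof (cases "y = z")
        case True
        then show ?thesis using mono[of z V "cun V W"] V W(1) setp_cun that by simp
      next
        case False
        then have "R y W" using that W(3) by (simp add: mem_cins)
        then show ?thesis using mono[of y W "cun V W"] V(1) W(1) setp_cun that by simp
      qed
      then show ?thesis using un[OF V(1) W(1) V(2) W(2)] setp_cun[OF V(1) W(1)] by blast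
    next
      case False
      then have "R y W" if "y \<epsilon> Y" "y \<epsilon> cins z Z" for y
        using W(3) that by (metis mem_cins)
      then show ?thesis using W(1,2) by blast
    qed
  qed
  then show ?thesis by blast
qed

end

section \<open>Generated predicates and codes\<close>

context class_theory_C
begin

declare num.simps [simp del]

section \<open>Finite derivations\<close>

definition mono_step :: "('a \<Rightarrow> 'a \<Rightarrow> bool) \<Rightarrow> bool" where
  "mono_step step \<longleftrightarrow> (\<forall>X Y q. (\<forall>z. z \<epsilon> X \<longrightarrow> z \<epsilon> Y) \<longrightarrow> step X q \<longrightarrow> step Y q)"

definition closed_under :: "('a \<Rightarrow> 'a \<Rightarrow> bool) \<Rightarrow> 'a \<Rightarrow> bool" where
  "closed_under step X \<longleftrightarrow> finite_set X \<and> (\<forall>q. q \<epsilon> X \<longrightarrow> step X q)"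

lemma mono_stepD: "mono_step step \<Longrightarrow> step X q \<Longrightarrow> (\<And>z. z \<epsilon> X \<Longrightarrow> z \<epsilon> Y) \<Longrightarrow> step Y q"
  unfolding mono_step_def by blast

lemma generated_iff_closed: "generated step p \<longleftrightarrow> (\<exists>X. closed_under step X \<and> p \<epsilon> X)"
  unfolding generated_def closed_under_def by blast

lemma generated_setp: "generated step p \<Longrightarrow> setp p"
  unfolding generated_def by (blast intro: setpI)

text \<open>A derivation of \<open>p\<close> derives each of its lines as well, so the premises used
  for \<open>p\<close> are generated themselves. All inversion rules for the syntax come from
  this.\<close>

lemma generated_cases:
  assumes "generated step p"
  obtains X where "\<forall>q. q \<epsilon> X \<longrightarrow> setp q \<and> generated step q" "step X p"
proof -
  obtain X where X: "finite_set X" "p \<epsilon> X" "\<forall>q. q \<epsilon> X \<longrightarrow> step X q"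
    using assms unfolding generated_def by blast
  have "\<forall>q. q \<epsilon> X \<longrightarrow> setp q \<and> generated step q"
    using X(1,3) setpI[of _ X] unfolding generated_def by blast
  moreover have "step X p" using X(2,3) by blast
  ultimately show thesis by (rule that)
qed

text \<open>The conclusion is added to the derivation as a further line; monotonicity keeps the old
  lines justified.\<close>

lemma generated_closedI:
  assumes "mono_step step" "closed_under step X" "step X q" "setp q"
  shows "generated step q"
proof -
  have "step (cins q X) z" if "z \<epsilon> cins q X" for z
  proof (rule mono_stepD[OF assms(1)])
    show "step X z" using that assms(2,3) unfolding closed_under_def mem_cins by blast
  qed (simp add: mem_cins)
  then show ?thesis
    using assms(2,4) finite_set_cins unfolding generated_def closed_under_def
    by (intro exI[of _ "cins q X"]) (simp add: mem_cins)
qed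

lemma generated_step1:
  assumes "mono_step step" "generated step p" "\<And>X. p \<epsilon> X \<Longrightarrow> step X q" "setp q"
  shows "generated step q"
  using assms(2) generated_closedI[OF assms(1) _ _ assms(4)] assms(3)
  unfolding generated_iff_closed by blast

lemma generated_step0:
  assumes "mono_step step" "step cempty q" "setp q"
  shows "generated step q"
  using assms by (rule_tac generated_closedI[of _ cempty]) (simp_all add: closed_under_def finite_set_cempty)

lemma closed_under_cun:
  assumes "mono_step step" "closed_under step V" "closed_under step W"
  shows "closed_under step (cun V W)"
proof -
  have "step (cun V W) q" if "step V q" for q
    using assms(1) that by (rule mono_stepD) simp
  moreover have "step (cun V W) q" if "step W q" for q
    using assms(1) that by (rule mono_stepD) simp
  ultimately show ?thesis
    using assms(2,3) finite_set_cun unfolding closed_under_def mem_cun by blast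
qed

text \<open>Internally finitely many derivations are merged into one without choosing among them:
  derivations are closed under union, and each requirement \<open>R y\<close> survives
  enlargement.\<close>

lemma closed_under_directed:
  assumes "mono_step step" "predicative (\<lambda>e. step (e (Suc 0)) (e 0))"
    and "predicative (\<lambda>e. R (e 0) (e (Suc 0)))" "finite_set Y"
    and ex: "\<And>y. y \<epsilon> Y \<Longrightarrow> \<exists>X. closed_under step X \<and> R y X"
    and mono: "\<And>y V W. y \<epsilon> Y \<Longrightarrow> R y V \<Longrightarrow> (\<And>z. z \<epsilon> V \<Longrightarrow> z \<epsilon> W) \<Longrightarrow> R y W"
  shows "\<exists>X. closed_under step X \<and> (\<forall>y. y \<epsilon> Y \<longrightarrow> R y X)"
proof -
  have "\<exists>\<^sub>s X. closed_under step X \<and> (\<forall>y. y \<epsilon> Y \<longrightarrow> R y X)"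
    using assms(3) _ assms(4)
  proof (rule finite_directed)
    show "predicative (\<lambda>e. closed_under step (e 0))"
      unfolding closed_under_def by (intro pred_intros assms(2); auto intro: setpI)
    show "closed_under step cempty"
      by (simp add: closed_under_def finite_set_cempty)
    show "\<exists>\<^sub>s W. closed_under step W \<and> R y W" if "y \<epsilon> Y" for y
      using ex[OF that] finite_setp unfolding closed_under_def by blast
    show "closed_under step (cun V W)" if "closed_under step V" "closed_under step W" for V W
      using that by (rule closed_under_cun[OF assms(1)])
    show "R y W" if "y \<epsilon> Y" "R y V" "\<And>z. z \<epsilon> V \<Longrightarrow> z \<epsilon> W" for y V W
      using that by (rule mono)
  qed
  then show ?thesis by blast
qed

section \<open>Codes of terms and formulas\<close>

lemmas code_defs = Var_def Fn_def Rl_def Eqn_def Neg_def Imp_def All_def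

lemma setp_code [simp]:
  "setp (Var i)" "setp (Fn f a)" "setp (Rl f a)" "setp (Eqn t u)" "setp (Neg p)" "setp (Imp p q)"
  "setp (All x p)"
  by (simp_all add: code_defs)

lemma definable_code [pred_intros]:
  "definable a \<Longrightarrow> definable (\<lambda>e. Var (a e))"
  "definable a \<Longrightarrow> definable b \<Longrightarrow> definable (\<lambda>e. Fn (a e) (b e))"
  "definable a \<Longrightarrow> definable b \<Longrightarrow> definable (\<lambda>e. Rl (a e) (b e))"
  "definable a \<Longrightarrow> definable b \<Longrightarrow> definable (\<lambda>e. Eqn (a e) (b e))"
  "definable a \<Longrightarrow> definable (\<lambda>e. Neg (a e))"
  "definable a \<Longrightarrow> definable b \<Longrightarrow> definable (\<lambda>e. Imp (a e) (b e))"
  "definable a \<Longrightarrow> definable b \<Longrightarrow> definable (\<lambda>e. All (a e) (b e))"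
  unfolding code_defs by (intro pred_intros; assumption)+

lemma code_eq_iff:
  "setp t \<Longrightarrow> setp u \<Longrightarrow> setp t' \<Longrightarrow> setp u' \<Longrightarrow> Eqn t u = Eqn t' u' \<longleftrightarrow> t = t' \<and> u = u'"
  "setp r \<Longrightarrow> setp a \<Longrightarrow> setp r' \<Longrightarrow> setp a' \<Longrightarrow> Rl r a = Rl r' a' \<longleftrightarrow> r = r' \<and> a = a'"
  "setp r \<Longrightarrow> setp a \<Longrightarrow> setp r' \<Longrightarrow> setp a' \<Longrightarrow> Fn r a = Fn r' a' \<longleftrightarrow> r = r' \<and> a = a'"
  "setp p \<Longrightarrow> setp p' \<Longrightarrow> Neg p = Neg p' \<longleftrightarrow> p = p'"
  "setp p \<Longrightarrow> setp q \<Longrightarrow> setp p' \<Longrightarrow> setp q' \<Longrightarrow> Imp p q = Imp p' q' \<longleftrightarrow> p = p' \<and> q = q'"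
  "setp x \<Longrightarrow> setp p \<Longrightarrow> setp x' \<Longrightarrow> setp p' \<Longrightarrow> All x p = All x' p' \<longleftrightarrow> x = x' \<and> p = p'"
  by (simp_all add: code_defs)

lemma code_neq:
  "setp i \<Longrightarrow> Var i \<noteq> Fn f a" "setp i \<Longrightarrow> Fn f a \<noteq> Var i"
  "setp p \<Longrightarrow> Neg p \<noteq> Eqn t u" "setp p \<Longrightarrow> Eqn t u \<noteq> Neg p"
  "setp p \<Longrightarrow> Neg p \<noteq> Rl r a" "setp p \<Longrightarrow> Rl r a \<noteq> Neg p"
  "setp p \<Longrightarrow> Neg p \<noteq> Imp q q'" "setp p \<Longrightarrow> Imp q q' \<noteq> Neg p"
  "setp p \<Longrightarrow> Neg p \<noteq> All x q" "setp p \<Longrightarrow> All x q \<noteq> Neg p"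
  "Eqn t u \<noteq> Rl r a" "Rl r a \<noteq> Eqn t u" "Eqn t u \<noteq> Imp q q'" "Imp q q' \<noteq> Eqn t u"
  "Eqn t u \<noteq> All x q" "All x q \<noteq> Eqn t u" "Rl r a \<noteq> Imp q q'" "Imp q q' \<noteq> Rl r a"
  "Rl r a \<noteq> All x q" "All x q \<noteq> Rl r a" "Imp p q \<noteq> All x q'" "All x q' \<noteq> Imp p q"
  by (simp_all add: code_defs)

lemmas code_simps = code_eq_iff code_neq

lemma below_code:
  assumes "setp p" "setp q"
  shows "below p (Neg p)" "below p (Imp p q)" "below q (Imp p q)" "below q (All p q)"
proof -
  \<comment> \<open>Two levels for the pair with the tag and two for the inner pair.\<close>
  have 4: "mem_depth 4 p \<langle>num k, \<langle>p, q\<rangle>\<rangle>" "mem_depth 4 q \<langle>num k, \<langle>p, q\<rangle>\<rangle>" for k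
    using mem_depth_add[OF mem_depth_opair(1)[OF assms] mem_depth_opair(2)[of "num k"]]
      mem_depth_add[OF mem_depth_opair(2)[OF assms] mem_depth_opair(2)[of "num k"]] by simp_all
  show "below p (Neg p)"
    unfolding below_def Neg_def using mem_depth_opair(2)[OF setp_num assms(1)]
    by (intro bexI[of _ 2]) auto
  show "below p (Imp p q)" "below q (Imp p q)" "below q (All p q)"
    unfolding below_def Imp_def All_def using 4 by (auto intro!: bexI[of _ 4])
qed

lemma below_Fn:
  assumes "setp f" "setp a" "\<langle>i, t\<rangle> \<epsilon> a" "setp i" "setp t"
  shows "below t (Fn f a)"
proof -
  have "mem_depth 1 \<langle>i, t\<rangle> a" using assms(3) by simp
  with mem_depth_opair(2)[OF assms(4,5)] have "mem_depth (2 + 1) t a" by (rule mem_depth_add)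
  moreover have "mem_depth (2 + 2) a (Fn f a)"
    unfolding Fn_def using mem_depth_opair(2)[OF assms(1,2)] mem_depth_opair(2)[of "num 1"]
    by (rule mem_depth_add) auto
  ultimately have "mem_depth ((2 + 1) + (2 + 2)) t (Fn f a)" by (rule mem_depth_add)
  then show ?thesis unfolding below_def by (intro bexI[of _ 7]) auto
qed

section \<open>Finite sequences related entry by entry\<close>

lemma pointwise_mono:
  assumes "pointwise P a b"
    "\<And>i x y. setp i \<Longrightarrow> setp x \<Longrightarrow> setp y \<Longrightarrow> \<langle>i, x\<rangle> \<epsilon> a \<Longrightarrow> \<langle>i, y\<rangle> \<epsilon> b \<Longrightarrow> P x y \<Longrightarrow> Q x y"
  shows "pointwise Q a b"
  using assms unfolding pointwise_def by meson

lemma fun_on_dom_unique: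
  assumes "fun_on a n P" "fun_on a m Q" shows "n = m"
  using assms by (intro extensionality) (metis fun_onD(1) fun_on_value setpI)

lemma pointwiseE:
  assumes "pointwise P a b"
  obtains n where "is_nat n" "fun_on a n (\<lambda>_. True)" "fun_on b n (\<lambda>_. True)"
    "\<forall>\<^sub>s i. \<forall>\<^sub>s x. \<forall>\<^sub>s y. \<langle>i, x\<rangle> \<epsilon> a \<and> \<langle>i, y\<rangle> \<epsilon> b \<longrightarrow> P x y"
  using assms unfolding pointwise_def by blast

lemma pointwiseI:
  assumes "is_nat n" "fun_on a n (\<lambda>_. True)" "fun_on b n (\<lambda>_. True)"
    "\<And>i x y. i \<epsilon> n \<Longrightarrow> setp i \<Longrightarrow> setp x \<Longrightarrow> setp y \<Longrightarrow> \<langle>i, x\<rangle> \<epsilon> a \<Longrightarrow> \<langle>i, y\<rangle> \<epsilon> b \<Longrightarrow> P x y"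
  shows "pointwise P a b"
  unfolding pointwise_def using assms setp_nat[OF assms(1)] fun_onD(1)[OF assms(2)]
  by (intro exI[of _ n] conjI allI impI) auto

text \<open>Both lengths are the domain of \<open>b\<close>, hence equal, and the entry of
  \<open>b\<close> at each index links the outer two.\<close>

lemma pointwise_compose:
  assumes "pointwise P a b" "pointwise Q b c"
    "\<And>i u v w. setp i \<Longrightarrow> setp u \<Longrightarrow> setp v \<Longrightarrow> setp w \<Longrightarrow> \<langle>i, u\<rangle> \<epsilon> a \<Longrightarrow> P u v \<Longrightarrow> Q v w \<Longrightarrow> R u w"
  shows "pointwise R a c"
proof -
  obtain n where n: "is_nat n" "fun_on a n (\<lambda>_. True)" "fun_on b n (\<lambda>_. True)"
    "\<forall>\<^sub>s i. \<forall>\<^sub>s x. \<forall>\<^sub>s y. \<langle>i, x\<rangle> \<epsilon> a \<and> \<langle>i, y\<rangle> \<epsilon> b \<longrightarrow> P x y"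
    by (rule pointwiseE[OF assms(1)])
  obtain m where m: "fun_on b m (\<lambda>_. True)" "fun_on c m (\<lambda>_. True)"
    "\<forall>\<^sub>s i. \<forall>\<^sub>s x. \<forall>\<^sub>s y. \<langle>i, x\<rangle> \<epsilon> b \<and> \<langle>i, y\<rangle> \<epsilon> c \<longrightarrow> Q x y"
    by (rule pointwiseE[OF assms(2)])
  have "n = m" using fun_on_dom_unique n(3) m(1) by blast
  show ?thesis
  proof (rule pointwiseI[OF n(1,2) m(2)[folded \<open>n = m\<close>]])
    fix i x y assume *: "i \<epsilon> n" "setp i" "setp x" "setp y" "\<langle>i, x\<rangle> \<epsilon> a" "\<langle>i, y\<rangle> \<epsilon> c"
    obtain z where z: "setp z" "\<langle>i, z\<rangle> \<epsilon> b" using fun_on_value[OF n(3) *(1)] by blast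
    show "R x y"
      using assms(3)[of i x z y] n(4) m(3) * z by blast
  qed
qed

lemma pointwise_swap: "pointwise P a b \<Longrightarrow> pointwise (\<lambda>y x. P x y) b a"
  unfolding pointwise_def by blast

text \<open>Stores in the relation that its arguments are entries at a common index, for
  compositions in which the index of the middle sequence would otherwise be lost.\<close>

lemma pointwise_mem:
  assumes "pointwise P a b"
  shows "pointwise (\<lambda>x y. (\<exists>\<^sub>s i. \<langle>i, x\<rangle> \<epsilon> a \<and> \<langle>i, y\<rangle> \<epsilon> b) \<and> P x y) a b"
  using assms by (rule pointwise_mono) blast

text \<open>Makes the tuple of argument values unique as soon as the value of each argument
  is.\<close>

lemma pointwise_unique:
  assumes "pointwise P a b" "pointwise Q a c"
    "\<And>i u v w. setp i \<Longrightarrow> setp u \<Longrightarrow> setp v \<Longrightarrow> setp w \<Longrightarrow> \<langle>i, u\<rangle> \<epsilon> a \<Longrightarrow> P u v \<Longrightarrow> Q u w \<Longrightarrow> v = w"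
  shows "b = c"
proof -
  obtain n where n: "is_nat n" "fun_on a n (\<lambda>_. True)" "fun_on b n (\<lambda>_. True)"
    "\<forall>\<^sub>s i. \<forall>\<^sub>s x. \<forall>\<^sub>s y. \<langle>i, x\<rangle> \<epsilon> a \<and> \<langle>i, y\<rangle> \<epsilon> b \<longrightarrow> P x y"
    by (rule pointwiseE[OF assms(1)])
  obtain m where m: "fun_on a m (\<lambda>_. True)" "fun_on c m (\<lambda>_. True)"
    "\<forall>\<^sub>s i. \<forall>\<^sub>s x. \<forall>\<^sub>s y. \<langle>i, x\<rangle> \<epsilon> a \<and> \<langle>i, y\<rangle> \<epsilon> c \<longrightarrow> Q x y"
    by (rule pointwiseE[OF assms(2)])
  have nm: "n = m" using fun_on_dom_unique n(2) m(1) by blast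
  have eq: "v = w" if iv: "i \<epsilon> n" "setp v" "setp w" "\<langle>i, v\<rangle> \<epsilon> b" "\<langle>i, w\<rangle> \<epsilon> c" for i v w
  proof -
    obtain u where u: "setp u" "\<langle>i, u\<rangle> \<epsilon> a" using fun_on_value[OF n(2) iv(1)] by blast
    show ?thesis
      using assms(3)[of i u v w] n(4) m(3) iv u setpI[OF iv(1)] by blast
  qed
  show ?thesis
  proof (rule extensionality)
    fix p show "p \<epsilon> b \<longleftrightarrow> p \<epsilon> c"
    proof
      assume "p \<epsilon> b"
      then obtain i v where v: "i \<epsilon> n" "setp v" "p = \<langle>i, v\<rangle>" using fun_on_pair[OF n(3)] by metis
      moreover obtain w where "setp w" "\<langle>i, w\<rangle> \<epsilon> c" using fun_on_value[OF m(2)] v(1) nm by metis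
      ultimately show "p \<epsilon> c" using eq \<open>p \<epsilon> b\<close> by metis
    next
      assume "p \<epsilon> c"
      then obtain i v where v: "i \<epsilon> n" "setp v" "p = \<langle>i, v\<rangle>" using fun_on_pair[OF m(2)] nm by metis
      moreover obtain w where "setp w" "\<langle>i, w\<rangle> \<epsilon> b" using fun_on_value[OF n(3)] v(1) by metis
      ultimately show "p \<epsilon> b" using eq \<open>p \<epsilon> c\<close> by metis
    qed
  qed
qed

end

section \<open>Syntax\<close>

context class_theory_C
begin

section \<open>Predicativity of syntax and term values\<close>

lemma predicative_is_var [pred_intros]:
  "definable a \<Longrightarrow> predicative (\<lambda>e. is_var (a e))"
  unfolding is_var_def by (intro pred_intros definable_shift; auto intro: setpI)

lemma is_var_setp: "is_var x \<Longrightarrow> setp x"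
  by (auto simp: is_var_def)

lemma predicative_is_term [pred_intros]:
  assumes "definable a" shows "predicative (\<lambda>e. is_term \<rho> (a e))"
  unfolding is_term_def
  by (intro pred_intros assms definable_reindex[OF assms]; auto simp: inj_def intro: setpI)

lemma predicative_is_atomic [pred_intros]:
  assumes "definable a" shows "predicative (\<lambda>e. is_atomic \<rho> (a e))"
  unfolding is_atomic_def
  by (intro pred_intros assms definable_reindex[OF assms]; auto simp: inj_def intro: setpI)

lemma predicative_is_fm [pred_intros]:
  assumes "definable a" shows "predicative (\<lambda>e. is_fm \<rho> (a e))"
  unfolding is_fm_def
  by (intro pred_intros assms; auto simp: inj_def intro: setpI)

lemma predicative_subfm [pred_intros]:
  assumes "definable a" "definable b" shows "predicative (\<lambda>e. subfm (a e) (b e))"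
  unfolding subfm_def
  by (intro pred_intros assms definable_reindex[OF assms(1)]; auto simp: inj_def intro: setpI)

lemma predicative_occurs [pred_intros]:
  assumes "definable a" "definable b" shows "predicative (\<lambda>e. occurs (a e) (b e))"
  unfolding occurs_def
  by (intro pred_intros assms definable_reindex[OF assms(1)]; auto simp: inj_def intro: setpI)

lemma predicative_free [pred_intros]:
  assumes "definable a" "definable b" shows "predicative (\<lambda>e. free (a e) (b e))"
  unfolding free_def
  by (intro pred_intros assms definable_reindex[OF assms(1)]; auto simp: inj_def intro: setpI)

lemma predicative_subst_tm [pred_intros]:
  assumes "definable x" "definable t" "definable u" "definable v"
  shows "predicative (\<lambda>e. subst_tm (x e) (t e) (u e) (v e))"
  unfolding subst_tm_def
  by (intro pred_intros assms definable_reindex[OF assms(1)] definable_reindex[OF assms(2)];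
      auto simp: inj_def intro: setpI)

lemma predicative_subst_fm [pred_intros]:
  assumes "definable x" "definable t" "definable u" "definable v"
  shows "predicative (\<lambda>e. subst_fm (x e) (t e) (u e) (v e))"
  unfolding subst_fm_def
  by (intro pred_intros assms definable_reindex[OF assms(1)] definable_reindex[OF assms(2)];
      auto simp: inj_def intro: setpI)

lemma predicative_in_dom [pred_intros]:
  "definable a \<Longrightarrow> definable b \<Longrightarrow> predicative (\<lambda>e. in_dom (a e) (b e))"
  unfolding in_dom_def by (intro pred_intros definable_shift; auto intro: setpI)

lemma predicative_assignment_for [pred_intros]:
  assumes "definable a" "definable b"
  shows "predicative (\<lambda>e. assignment_for M (a e) (b e))"
  unfolding assignment_for_def
  by (intro pred_intros assms definable_reindex[OF assms(1)] definable_reindex[OF assms(2)];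
      auto simp: inj_def intro: setpI)

lemma predicative_tm_val [pred_intros]:
  assumes "definable a" "definable t" "definable b"
  shows "predicative (\<lambda>e. tm_val M (a e) (t e) (b e))"
  unfolding tm_val_def
  by (intro pred_intros assms definable_reindex[OF assms(1)];
      auto simp: inj_def intro: setpI)

lemma definable_update [pred_intros]:
  assumes "definable a" "definable x" "definable b"
  shows "definable (\<lambda>e. update (a e) (x e) (b e))"
  unfolding update_def
  by (intro pred_intros assms definable_reindex[OF assms(1)] definable_reindex[OF assms(2)]
    definable_reindex[OF assms(3)]; auto simp: inj_def intro: setpI)

section \<open>Inversion and formation of terms and formulas\<close>

lemma is_term_cases:
  assumes "is_term \<rho> t"
  shows "is_var t \<or> (\<exists>\<^sub>s f. \<exists>\<^sub>s n. \<exists>\<^sub>s a. \<langle>f, n\<rangle> \<epsilon> fun_arity \<rho> \<and> fun_on a n (is_term \<rho>) \<and> t = Fn f a)"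
  by (rule generated_cases[OF assms[unfolded is_term_def], folded is_term_def])
    (use fun_on_mono[of _ _ "\<lambda>t. t \<epsilon> _" "is_term \<rho>"] in blast)

lemma is_fm_cases:
  assumes "is_fm \<rho> q"
  shows "is_atomic \<rho> q \<or> (\<exists>\<^sub>s p. is_fm \<rho> p \<and> q = Neg p)
    \<or> (\<exists>\<^sub>s p. \<exists>\<^sub>s r. is_fm \<rho> p \<and> is_fm \<rho> r \<and> q = Imp p r)
    \<or> (\<exists>\<^sub>s x. \<exists>\<^sub>s p. is_var x \<and> is_fm \<rho> p \<and> q = All x p)"
  by (rule generated_cases[OF assms[unfolded is_fm_def], folded is_fm_def]) (elim disjE exE conjE; metis)

lemma is_fm_setp: "is_fm \<rho> q \<Longrightarrow> setp q"
  unfolding is_fm_def by (rule generated_setp)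

lemma is_term_setp: "is_term \<rho> q \<Longrightarrow> setp q"
  unfolding is_term_def by (rule generated_setp)

text \<open>Implication is the connective with which several formulas are gathered as subformulas of
  one. The two derivations are united before the conclusion is added.\<close>

lemma is_fm_Imp:
  assumes "is_fm \<rho> p" "is_fm \<rho> q" shows "is_fm \<rho> (Imp p q)"
proof -
  define step where "step = (\<lambda>X q. is_atomic \<rho> q
     \<or> (\<exists>p. p \<epsilon> X \<and> q = Neg p)
     \<or> (\<exists>p r. p \<epsilon> X \<and> r \<epsilon> X \<and> q = Imp p r)
     \<or> (\<exists>\<^sub>s x. \<exists>p. is_var x \<and> p \<epsilon> X \<and> q = All x p))"
  have fm: "is_fm \<rho> = generated step" by (simp add: is_fm_def step_def)
  have mono: "mono_step step" unfolding mono_step_def step_def by blast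
  obtain X Y where X: "closed_under step X" "p \<epsilon> X" and Y: "closed_under step Y" "q \<epsilon> Y"
    using assms unfolding fm generated_iff_closed by blast
  show ?thesis
    unfolding fm
  proof (rule generated_closedI[OF mono closed_under_cun[OF mono X(1) Y(1)]])
    show "step (cun X Y) (Imp p q)"
      unfolding step_def mem_cun using X(2) Y(2) by blast
  qed simp
qed

lemma is_fm_NegD: "is_fm \<rho> (Neg p) \<Longrightarrow> setp p \<Longrightarrow> is_fm \<rho> p"
  using is_fm_cases[of \<rho> "Neg p"] is_fm_setp
  by (auto simp: is_atomic_def code_simps dest: is_fm_setp is_var_setp)

lemma is_fm_ImpD: "is_fm \<rho> (Imp p q) \<Longrightarrow> setp p \<Longrightarrow> setp q \<Longrightarrow> is_fm \<rho> p \<and> is_fm \<rho> q"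
  using is_fm_cases[of \<rho> "Imp p q"]
  by (auto simp: is_atomic_def code_simps dest: is_fm_setp is_var_setp)

lemma is_fm_AllD: "is_fm \<rho> (All x p) \<Longrightarrow> setp x \<Longrightarrow> setp p \<Longrightarrow> is_var x \<and> is_fm \<rho> p"
  using is_fm_cases[of \<rho> "All x p"]
  by (auto simp: is_atomic_def code_simps dest: is_fm_setp is_var_setp)

section \<open>Subformulas\<close>

lemma subfm_setp: "subfm p q \<Longrightarrow> setp q"
  unfolding subfm_def by (rule generated_setp)

lemma subfm_cases:
  assumes "subfm p q"
  shows "q = p \<or> (\<exists>\<^sub>s r. subfm p r \<and> q = Neg r)
     \<or> (\<exists>\<^sub>s r. \<exists>\<^sub>s s. (subfm p r \<or> subfm p s) \<and> q = Imp r s)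
     \<or> (\<exists>\<^sub>s x. \<exists>\<^sub>s r. subfm p r \<and> q = All x r)"
  by (rule generated_cases[OF assms[unfolded subfm_def], folded subfm_def]) (elim disjE exE conjE; metis)

definition subfm_step :: "'a \<Rightarrow> 'a \<Rightarrow> 'a \<Rightarrow> bool" where
  "subfm_step p X q \<longleftrightarrow> q = p
     \<or> (\<exists>r. r \<epsilon> X \<and> q = Neg r)
     \<or> (\<exists>\<^sub>s r. \<exists>\<^sub>s s. (r \<epsilon> X \<or> s \<epsilon> X) \<and> q = Imp r s)
     \<or> (\<exists>\<^sub>s x. \<exists>r. r \<epsilon> X \<and> q = All x r)"

lemma subfm_generated: "subfm p = generated (subfm_step p)"
  unfolding subfm_def subfm_step_def ..

lemma mono_subfm_step: "mono_step (subfm_step p)"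
  unfolding mono_step_def subfm_step_def by (intro allI impI; elim disjE exE conjE; metis)

lemma subfm_refl: "setp p \<Longrightarrow> subfm p p"
  unfolding subfm_generated
  by (rule generated_step0[OF mono_subfm_step]) (simp_all add: subfm_step_def)

lemma subfm_NegI: "subfm p r \<Longrightarrow> subfm p (Neg r)"
  unfolding subfm_generated
  by (erule generated_step1[OF mono_subfm_step]) (unfold subfm_step_def, blast, simp)

lemma subfm_ImpI1:
  assumes "setp r" "setp s" "subfm p r" shows "subfm p (Imp r s)"
proof -
  have "subfm_step p X (Imp r s)" if "r \<epsilon> X" for X
    using that assms(1,2) unfolding subfm_step_def by metis
  with assms(3) show ?thesis
    unfolding subfm_generated by (rule generated_step1[OF mono_subfm_step]) simp_all
qed

lemma subfm_ImpI2:
  assumes "setp r" "setp s" "subfm p s" shows "subfm p (Imp r s)"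
proof -
  have "subfm_step p X (Imp r s)" if "s \<epsilon> X" for X
    using that assms(1,2) unfolding subfm_step_def by metis
  with assms(3) show ?thesis
    unfolding subfm_generated by (rule generated_step1[OF mono_subfm_step]) simp_all
qed

lemma subfm_AllI:
  assumes "setp x" "subfm p r" shows "subfm p (All x r)"
proof -
  have "subfm_step p X (All x r)" if "r \<epsilon> X" for X
    using that assms(1) unfolding subfm_step_def by metis
  with assms(2) show ?thesis
    unfolding subfm_generated by (rule generated_step1[OF mono_subfm_step]) simp_all
qed

text \<open>Induction on the outermost formula, since \<open>subfm q\<close> builds formulas up
  around \<open>q\<close>.\<close>

lemma subfm_trans:
  assumes "subfm p q" "subfm q r" shows "subfm p r"
proof -
  have "predicative (\<lambda>e. subfm q (e 0) \<longrightarrow> subfm p (e 0))" by (intro pred_intros)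
  then have "subfm q r \<longrightarrow> subfm p r" using subfm_setp[OF assms(2)]
  proof (rule below_induct)
    fix r assume IH: "\<And>s. below s r \<Longrightarrow> subfm q s \<longrightarrow> subfm p s"
    show "subfm q r \<longrightarrow> subfm p r"
    proof
      assume "subfm q r"
      from subfm_cases[OF this] consider "r = q" | s where "setp s" "subfm q s" "r = Neg s"
        | s u where "setp s" "setp u" "subfm q s" "r = Imp s u"
        | s u where "setp s" "setp u" "subfm q u" "r = Imp s u"
        | x s where "setp x" "setp s" "subfm q s" "r = All x s"
        by metis
      then show "subfm p r"
      proof cases
        case (2 s)
        then show ?thesis using IH[of s] below_code(1)[of s s] subfm_NegI by simp
      next
        case (3 s u)
        then show ?thesis using IH[of s] below_code(2) subfm_ImpI1 by simp
      next
        case (4 s u)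
        then show ?thesis using IH[of u] below_code(3) subfm_ImpI2 by simp
      next
        case (5 x s)
        then show ?thesis using IH[of s] below_code(4) subfm_AllI by simp
      qed (simp add: assms(1))
    qed
  qed
  with assms(2) show ?thesis by simp
qed

lemma is_fm_subfm:
  assumes "is_fm \<rho> p" "subfm q p" shows "is_fm \<rho> q"
proof -
  have "predicative (\<lambda>e. subfm q (e 0) \<and> is_fm \<rho> (e 0) \<longrightarrow> is_fm \<rho> q)" by (intro pred_intros)
  then have "subfm q p \<and> is_fm \<rho> p \<longrightarrow> is_fm \<rho> q" using is_fm_setp[OF assms(1)]
  proof (rule below_induct)
    fix r assume IH: "\<And>s. below s r \<Longrightarrow> subfm q s \<and> is_fm \<rho> s \<longrightarrow> is_fm \<rho> q"
    show "subfm q r \<and> is_fm \<rho> r \<longrightarrow> is_fm \<rho> q"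
    proof
      assume r: "subfm q r \<and> is_fm \<rho> r"
      from subfm_cases[OF conjunct1[OF r]] consider "r = q" | s where "setp s" "subfm q s" "r = Neg s"
        | s u where "setp s" "setp u" "subfm q s" "r = Imp s u"
        | s u where "setp s" "setp u" "subfm q u" "r = Imp s u"
        | x s where "setp x" "setp s" "subfm q s" "r = All x s"
        by metis
      then show "is_fm \<rho> q"
      proof cases
        case (2 s)
        then show ?thesis using IH[of s] below_code(1)[of s s] is_fm_NegD r by simp
      next
        case (3 s u)
        then show ?thesis using IH[of s] below_code(2)[of s u] is_fm_ImpD[of \<rho> s u] r by simp
      next
        case (4 s u)
        then show ?thesis using IH[of u] below_code(3)[of s u] is_fm_ImpD[of \<rho> s u] r by simp
      next
        case (5 x s)
        then show ?thesis using IH[of s] below_code(4)[of x s] is_fm_AllD[of \<rho> x s] r by simp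
      qed (use r in simp)
    qed
  qed
  with assms show ?thesis by simp
qed

lemma subfm_Neg: "setp p \<Longrightarrow> subfm (Neg p) c \<Longrightarrow> subfm p c"
  by (rule subfm_trans[OF subfm_NegI[OF subfm_refl]])

lemma subfm_Imp: "setp p \<Longrightarrow> setp q \<Longrightarrow> subfm (Imp p q) c \<Longrightarrow> subfm p c \<and> subfm q c"
  by (intro conjI; rule subfm_trans[of _ "Imp p q"]) (simp_all add: subfm_ImpI1 subfm_ImpI2 subfm_refl)

lemma subfm_All: "setp x \<Longrightarrow> setp p \<Longrightarrow> subfm (All x p) c \<Longrightarrow> subfm p c"
  by (rule subfm_trans[of _ "All x p"]) (simp_all add: subfm_AllI subfm_refl)

section \<open>Occurrences and free variables\<close>

lemma occurs_setp: "occurs x t \<Longrightarrow> setp t"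
  unfolding occurs_def by (rule generated_setp)

lemma occurs_cases:
  assumes "occurs x t"
  shows "t = x \<or> (\<exists>\<^sub>s f. \<exists>\<^sub>s a. (\<exists>\<^sub>s i. \<exists>t. occurs x t \<and> \<langle>i, t\<rangle> \<epsilon> a) \<and> t = Fn f a)"
  by (rule generated_cases[OF assms[unfolded occurs_def], folded occurs_def]) (elim disjE exE conjE; metis)

definition occurs_step :: "'a \<Rightarrow> 'a \<Rightarrow> 'a \<Rightarrow> bool" where
  "occurs_step x X q \<longleftrightarrow> q = x
     \<or> (\<exists>\<^sub>s f. \<exists>\<^sub>s a. (\<exists>\<^sub>s i. \<exists>t. t \<epsilon> X \<and> \<langle>i, t\<rangle> \<epsilon> a) \<and> q = Fn f a)"

lemma occurs_generated: "occurs x = generated (occurs_step x)"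
  unfolding occurs_def occurs_step_def ..

lemma mono_occurs_step: "mono_step (occurs_step x)"
  unfolding mono_step_def occurs_step_def by (intro allI impI; elim disjE exE conjE; metis)

lemma occurs_refl: "setp x \<Longrightarrow> occurs x x"
  unfolding occurs_generated
  by (rule generated_step0[OF mono_occurs_step]) (simp_all add: occurs_step_def)

lemma occurs_FnI:
  assumes "setp f" "setp a" "setp i" "\<langle>i, t\<rangle> \<epsilon> a" "occurs x t" shows "occurs x (Fn f a)"
  using assms(5) unfolding occurs_generated
  by (rule generated_step1[OF mono_occurs_step]) (unfold occurs_step_def, use assms(1-4) in blast, simp)

definition free_step :: "'a \<Rightarrow> 'a \<Rightarrow> 'a \<Rightarrow> bool" where
  "free_step x X q \<longleftrightarrow> (\<exists>\<^sub>s t. \<exists>\<^sub>s u. (occurs x t \<or> occurs x u) \<and> q = Eqn t u)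
     \<or> (\<exists>\<^sub>s r. \<exists>\<^sub>s a. (\<exists>\<^sub>s i. \<exists>\<^sub>s t. \<langle>i, t\<rangle> \<epsilon> a \<and> occurs x t) \<and> q = Rl r a)
     \<or> (\<exists>p. p \<epsilon> X \<and> q = Neg p)
     \<or> (\<exists>\<^sub>s p. \<exists>\<^sub>s r. (p \<epsilon> X \<or> r \<epsilon> X) \<and> q = Imp p r)
     \<or> (\<exists>\<^sub>s y. \<exists>p. y \<noteq> x \<and> p \<epsilon> X \<and> q = All y p)"

lemma free_generated: "free x = generated (free_step x)"
  unfolding free_def free_step_def ..

lemma mono_free_step: "mono_step (free_step x)"
  unfolding mono_step_def free_step_def by (intro allI impI; elim disjE exE conjE; metis)

lemma free_setp: "free x t \<Longrightarrow> setp t"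
  unfolding free_def by (rule generated_setp)

lemma free_cases:
  assumes "free x q"
  shows "(\<exists>\<^sub>s t. \<exists>\<^sub>s u. (occurs x t \<or> occurs x u) \<and> q = Eqn t u)
     \<or> (\<exists>\<^sub>s r. \<exists>\<^sub>s a. (\<exists>\<^sub>s i. \<exists>\<^sub>s t. \<langle>i, t\<rangle> \<epsilon> a \<and> occurs x t) \<and> q = Rl r a)
     \<or> (\<exists>\<^sub>s p. free x p \<and> q = Neg p)
     \<or> (\<exists>\<^sub>s p. \<exists>\<^sub>s r. (free x p \<or> free x r) \<and> q = Imp p r)
     \<or> (\<exists>\<^sub>s y. \<exists>\<^sub>s p. y \<noteq> x \<and> free x p \<and> q = All y p)"
  by (rule generated_cases[OF assms[unfolded free_def], folded free_def]) (elim disjE exE conjE; metis)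

lemma free_Eqn: "setp t \<Longrightarrow> setp u \<Longrightarrow> free x (Eqn t u) \<longleftrightarrow> occurs x t \<or> occurs x u"
proof
  assume "setp t" "setp u" "free x (Eqn t u)"
  then show "occurs x t \<or> occurs x u"
    using free_cases[of x "Eqn t u"] by (auto simp: code_simps dest: free_setp)
next
  assume "setp t" "setp u" "occurs x t \<or> occurs x u"
  then show "free x (Eqn t u)"
    unfolding free_generated
    by (rule_tac generated_step0[OF mono_free_step]) (unfold free_step_def, blast, simp)
qed

lemma free_Rl:
  "setp r \<Longrightarrow> setp a \<Longrightarrow> free x (Rl r a) \<longleftrightarrow> (\<exists>\<^sub>s i. \<exists>\<^sub>s t. \<langle>i, t\<rangle> \<epsilon> a \<and> occurs x t)"
proof
  assume "setp r" "setp a" "free x (Rl r a)"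
  then show "\<exists>\<^sub>s i. \<exists>\<^sub>s t. \<langle>i, t\<rangle> \<epsilon> a \<and> occurs x t"
    using free_cases[of x "Rl r a"] by (auto simp: code_simps dest: free_setp) blast
next
  assume "setp r" "setp a" "\<exists>\<^sub>s i. \<exists>\<^sub>s t. \<langle>i, t\<rangle> \<epsilon> a \<and> occurs x t"
  then show "free x (Rl r a)"
    unfolding free_generated
    by (rule_tac generated_step0[OF mono_free_step]) (unfold free_step_def, blast, simp)
qed

lemma free_Neg: "setp p \<Longrightarrow> free x (Neg p) \<longleftrightarrow> free x p"
proof
  assume "setp p" "free x (Neg p)"
  then show "free x p"
    using free_cases[of x "Neg p"] by (auto simp: code_simps dest: free_setp)
next
  assume "free x p"
  then show "free x (Neg p)"
    unfolding free_generated
    by (rule generated_step1[OF mono_free_step]) (unfold free_step_def, blast, simp)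
qed

lemma free_Imp: "setp p \<Longrightarrow> setp q \<Longrightarrow> free x (Imp p q) \<longleftrightarrow> free x p \<or> free x q"
proof
  assume "setp p" "setp q" "free x (Imp p q)"
  then show "free x p \<or> free x q"
    using free_cases[of x "Imp p q"] by (auto simp: code_simps dest: free_setp)
next
  assume *: "setp p" "setp q" "free x p \<or> free x q"
  have step: "free_step x X (Imp p q)" if "p \<epsilon> X \<or> q \<epsilon> X" for X
    using that *(1,2) unfolding free_step_def by blast
  from *(3) show "free x (Imp p q)"
    unfolding free_generated
    by (elim disjE; erule_tac generated_step1[OF mono_free_step]; simp add: step)
qed

lemma free_All: "setp y \<Longrightarrow> setp p \<Longrightarrow> free x (All y p) \<longleftrightarrow> y \<noteq> x \<and> free x p"
proof
  assume "setp y" "setp p" "free x (All y p)"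
  then show "y \<noteq> x \<and> free x p"
    using free_cases[of x "All y p"] by (auto simp: code_simps dest: free_setp)
next
  assume *: "setp y" "setp p" "y \<noteq> x \<and> free x p"
  from conjunct2[OF *(3)] show "free x (All y p)"
    unfolding free_generated
    by (rule generated_step1[OF mono_free_step]) (unfold free_step_def, use * in blast, simp)
qed

section \<open>Inversion for substitution and for term values\<close>

definition subst_tm_step :: "'a \<Rightarrow> 'a \<Rightarrow> 'a \<Rightarrow> 'a \<Rightarrow> bool" where
  "subst_tm_step x t X q \<longleftrightarrow> q = \<langle>x, t\<rangle>
     \<or> (\<exists>\<^sub>s y. is_var y \<and> y \<noteq> x \<and> q = \<langle>y, y\<rangle>)
     \<or> (\<exists>\<^sub>s f. \<exists>\<^sub>s a. \<exists>\<^sub>s b. pointwise (\<lambda>w z. \<langle>w, z\<rangle> \<epsilon> X) a b \<and> q = \<langle>Fn f a, Fn f b\<rangle>)"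

lemma subst_tm_generated: "subst_tm x t u v \<longleftrightarrow> generated (subst_tm_step x t) \<langle>u, v\<rangle>"
  unfolding subst_tm_def subst_tm_step_def ..

lemma subst_tm_cases:
  assumes "subst_tm x t u v" "setp x" "setp t" "setp u" "setp v"
  shows "(u = x \<and> v = t) \<or> (is_var u \<and> u \<noteq> x \<and> v = u)
    \<or> (\<exists>\<^sub>s f. \<exists>\<^sub>s a. \<exists>\<^sub>s b. pointwise (subst_tm x t) a b \<and> u = Fn f a \<and> v = Fn f b)"
proof (rule generated_cases[OF assms(1)[unfolded subst_tm_generated]])
  fix X assume X: "\<forall>q. q \<epsilon> X \<longrightarrow> setp q \<and> generated (subst_tm_step x t) q"
    and step: "subst_tm_step x t X \<langle>u, v\<rangle>"
  have pw: "pointwise (subst_tm x t) a b" if "pointwise (\<lambda>w z. \<langle>w, z\<rangle> \<epsilon> X) a b" for a b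
    using that by (rule pointwise_mono) (simp add: X subst_tm_generated)
  from step show ?thesis
    unfolding subst_tm_step_def using assms(2-)
    by (elim disjE exE conjE; simp only: opair_eq_iff setp_code simp_thms) (use pw in \<open>metis+\<close>)
qed

definition subst_fm_step :: "'a \<Rightarrow> 'a \<Rightarrow> 'a \<Rightarrow> 'a \<Rightarrow> bool" where
  "subst_fm_step x t X w \<longleftrightarrow>
       (\<exists>\<^sub>s u. \<exists>\<^sub>s v. \<exists>\<^sub>s u'. \<exists>\<^sub>s v'. subst_tm x t u u' \<and> subst_tm x t v v'
            \<and> w = \<langle>Eqn u v, Eqn u' v'\<rangle>)
     \<or> (\<exists>\<^sub>s r. \<exists>\<^sub>s a. \<exists>\<^sub>s b. pointwise (subst_tm x t) a b \<and> w = \<langle>Rl r a, Rl r b\<rangle>)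
     \<or> (\<exists>\<^sub>s r. \<exists>\<^sub>s r'. \<langle>r, r'\<rangle> \<epsilon> X \<and> w = \<langle>Neg r, Neg r'\<rangle>)
     \<or> (\<exists>\<^sub>s r. \<exists>\<^sub>s s. \<exists>\<^sub>s r'. \<exists>\<^sub>s s'. \<langle>r, r'\<rangle> \<epsilon> X \<and> \<langle>s, s'\<rangle> \<epsilon> X
            \<and> w = \<langle>Imp r s, Imp r' s'\<rangle>)
     \<or> (\<exists>\<^sub>s y. \<exists>\<^sub>s r. \<not> free x (All y r) \<and> w = \<langle>All y r, All y r\<rangle>)
     \<or> (\<exists>\<^sub>s y. \<exists>\<^sub>s r. \<exists>\<^sub>s r'. y \<noteq> x \<and> \<not> occurs y t \<and> \<langle>r, r'\<rangle> \<epsilon> X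
            \<and> w = \<langle>All y r, All y r'\<rangle>)"

lemma subst_fm_generated: "subst_fm x t p q \<longleftrightarrow> generated (subst_fm_step x t) \<langle>p, q\<rangle>"
  unfolding subst_fm_def subst_fm_step_def ..

lemma subst_fm_cases [consumes 3, case_names Eqn Rl Neg Imp All_bound All]:
  assumes "subst_fm x t p q" "setp p" "setp q"
  obtains u v u' v' where "setp u" "setp v" "setp u'" "setp v'" "subst_tm x t u u'" "subst_tm x t v v'"
      "p = Eqn u v" "q = Eqn u' v'"
  | r a b where "setp r" "setp a" "setp b" "pointwise (subst_tm x t) a b" "p = Rl r a" "q = Rl r b"
  | r r' where "setp r" "setp r'" "subst_fm x t r r'" "p = Neg r" "q = Neg r'"
  | r s r' s' where "setp r" "setp s" "setp r'" "setp s'" "subst_fm x t r r'" "subst_fm x t s s'"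
      "p = Imp r s" "q = Imp r' s'"
  | y r where "setp y" "setp r" "\<not> free x (All y r)" "p = All y r" "q = All y r"
  | y r r' where "setp y" "setp r" "setp r'" "y \<noteq> x" "\<not> occurs y t" "subst_fm x t r r'"
      "p = All y r" "q = All y r'"
proof (rule generated_cases[OF assms(1)[unfolded subst_fm_generated]])
  fix X assume X: "\<forall>q. q \<epsilon> X \<longrightarrow> setp q \<and> generated (subst_fm_step x t) q"
    and step: "subst_fm_step x t X \<langle>p, q\<rangle>"
  have X': "subst_fm x t r r'" if "\<langle>r, r'\<rangle> \<epsilon> X" for r r'
    using that X by (simp add: subst_fm_generated)
  have "(\<exists>\<^sub>s u. \<exists>\<^sub>s v. \<exists>\<^sub>s u'. \<exists>\<^sub>s v'. subst_tm x t u u' \<and> subst_tm x t v v'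
            \<and> p = Eqn u v \<and> q = Eqn u' v')
     \<or> (\<exists>\<^sub>s r. \<exists>\<^sub>s a. \<exists>\<^sub>s b. pointwise (subst_tm x t) a b \<and> p = Rl r a \<and> q = Rl r b)
     \<or> (\<exists>\<^sub>s r. \<exists>\<^sub>s r'. \<langle>r, r'\<rangle> \<epsilon> X \<and> p = Neg r \<and> q = Neg r')
     \<or> (\<exists>\<^sub>s r. \<exists>\<^sub>s s. \<exists>\<^sub>s r'. \<exists>\<^sub>s s'. \<langle>r, r'\<rangle> \<epsilon> X \<and> \<langle>s, s'\<rangle> \<epsilon> X
            \<and> p = Imp r s \<and> q = Imp r' s')
     \<or> (\<exists>\<^sub>s y. \<exists>\<^sub>s r. \<not> free x (All y r) \<and> p = All y r \<and> q = All y r)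
     \<or> (\<exists>\<^sub>s y. \<exists>\<^sub>s r. \<exists>\<^sub>s r'. y \<noteq> x \<and> \<not> occurs y t \<and> \<langle>r, r'\<rangle> \<epsilon> X
            \<and> p = All y r \<and> q = All y r')"
    using step unfolding subst_fm_step_def by (simp only: opair_eq_iff setp_code assms(2,3))
  then show thesis
    by (elim disjE exE conjE)
      ((rule that(1); assumption), (rule that(2); assumption),
        (rule that(3); (assumption | erule X')), (rule that(4); (assumption | erule X')),
        (rule that(5); assumption), (rule that(6); (assumption | erule X')))
qed

definition tm_val_step :: "'a struct \<Rightarrow> 'a \<Rightarrow> 'a \<Rightarrow> 'a \<Rightarrow> bool" where
  "tm_val_step M A X q \<longleftrightarrow>
       (\<exists>\<^sub>s x. \<exists>\<^sub>s c. is_var x \<and> \<langle>x, c\<rangle> \<epsilon> A \<and> q = \<langle>x, c\<rangle>)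
     \<or> (\<exists>\<^sub>s f. \<exists>\<^sub>s a. \<exists>\<^sub>s d. \<exists>\<^sub>s c. pointwise (\<lambda>u e. \<langle>u, e\<rangle> \<epsilon> X) a d
          \<and> \<langle>\<langle>f, d\<rangle>, c\<rangle> \<epsilon> fun_int M \<and> q = \<langle>Fn f a, c\<rangle>)"

lemma tm_val_generated: "tm_val M A t b \<longleftrightarrow> generated (tm_val_step M A) \<langle>t, b\<rangle>"
  unfolding tm_val_def tm_val_step_def ..

lemma tm_val_cases:
  assumes "tm_val M A t b" "setp t" "setp b"
  shows "(is_var t \<and> \<langle>t, b\<rangle> \<epsilon> A) \<or> (\<exists>\<^sub>s f. \<exists>\<^sub>s a. \<exists>\<^sub>s d. pointwise (tm_val M A) a d
          \<and> \<langle>\<langle>f, d\<rangle>, b\<rangle> \<epsilon> fun_int M \<and> t = Fn f a)"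
proof (rule generated_cases[OF assms(1)[unfolded tm_val_generated]])
  fix X assume X: "\<forall>q. q \<epsilon> X \<longrightarrow> setp q \<and> generated (tm_val_step M A) q"
    and step: "tm_val_step M A X \<langle>t, b\<rangle>"
  have pw: "pointwise (tm_val M A) a d" if "pointwise (\<lambda>w z. \<langle>w, z\<rangle> \<epsilon> X) a d" for a d
    using that by (rule pointwise_mono) (simp add: X tm_val_generated)
  from step show ?thesis
    unfolding tm_val_step_def using assms(2-)
    by (elim disjE exE conjE; simp only: opair_eq_iff setp_code simp_thms) (use pw in \<open>metis+\<close>)
qed

end

section \<open>Assignments and values of terms\<close>

locale class_structure = class_theory_C mem for mem :: "'a \<Rightarrow> 'a \<Rightarrow> bool" (infix "\<epsilon>" 50) +
  fixes \<rho> :: "'a signature" and M :: "'a struct"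
  assumes signature: "is_signature \<rho>" and struct: "is_struct \<rho> M"
begin

lemma arity_nat:
  assumes "\<langle>f, n\<rangle> \<epsilon> fun_arity \<rho> \<or> \<langle>f, n\<rangle> \<epsilon> rel_arity \<rho>" "setp f" "setp n" shows "is_nat n"
  using signature assms fun_onD(2) unfolding is_signature_def by metis

lemma fun_int_in_universe:
  assumes "\<langle>w, b\<rangle> \<epsilon> fun_int M" "setp w" "setp b" shows "b \<epsilon> universe M"
proof -
  obtain D where "fun_on (fun_int M) D (\<lambda>b. b \<epsilon> universe M)"
    using struct unfolding is_struct_def by blast
  then show ?thesis using fun_onD(2) assms by blast
qed

lemma fun_int_unique:
  assumes "\<langle>w, b\<rangle> \<epsilon> fun_int M" "\<langle>w, c\<rangle> \<epsilon> fun_int M" "setp w" "setp b" "setp c" shows "b = c"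
proof -
  obtain D where "fun_on (fun_int M) D (\<lambda>b. b \<epsilon> universe M)"
    using struct unfolding is_struct_def by blast
  then show ?thesis using fun_on_unique assms by blast
qed

lemma fun_int_exists:
  assumes "\<langle>f, n\<rangle> \<epsilon> fun_arity \<rho>" "fun_on d n (\<lambda>b. b \<epsilon> universe M)" "setp f" "setp n" "setp d"
  obtains b where "b \<epsilon> universe M" "\<langle>\<langle>f, d\<rangle>, b\<rangle> \<epsilon> fun_int M"
proof -
  obtain D where D: "\<forall>q. q \<epsilon> D \<longleftrightarrow>
      (\<exists>\<^sub>s f. \<exists>\<^sub>s n. \<exists>\<^sub>s d. \<langle>f, n\<rangle> \<epsilon> fun_arity \<rho> \<and> fun_on d n (\<lambda>b. b \<epsilon> universe M) \<and> q = \<langle>f, d\<rangle>)"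
    and I: "fun_on (fun_int M) D (\<lambda>b. b \<epsilon> universe M)"
    using struct unfolding is_struct_def by blast
  have "\<langle>f, d\<rangle> \<epsilon> D" unfolding D[rule_format] using assms by blast
  from fun_on_value[OF I this] that show thesis by blast
qed

lemma universe_nonempty: obtains b where "b \<epsilon> universe M"
  using struct unfolding is_struct_def by blast

section \<open>Finite assignments and their updates\<close>

definition partial_assignment :: "'a \<Rightarrow> bool" where
  "partial_assignment A \<longleftrightarrow> finite_set A \<and> (\<exists>\<^sub>s D. fun_on A D (\<lambda>b. b \<epsilon> universe M))"

lemma predicative_partial_assignment [pred_intros]:
  assumes "definable a" shows "predicative (\<lambda>e. partial_assignment (a e))"
  unfolding partial_assignment_def
  by (intro pred_intros assms definable_reindex[OF assms]; auto simp: inj_def intro: setpI)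

text \<open>Removes the domain from the description: being a set of pairs with single values is
  easier to check for updates than exhibiting a new domain.\<close>

lemma partial_assignment_iff:
  "partial_assignment A \<longleftrightarrow> finite_set A
    \<and> (\<forall>p. p \<epsilon> A \<longrightarrow> (\<exists>\<^sub>s x. \<exists>b. b \<epsilon> universe M \<and> p = \<langle>x, b\<rangle>))
    \<and> (\<forall>\<^sub>s x. \<forall>\<^sub>s b. \<forall>\<^sub>s c. \<langle>x, b\<rangle> \<epsilon> A \<longrightarrow> \<langle>x, c\<rangle> \<epsilon> A \<longrightarrow> b = c)"
  (is "_ \<longleftrightarrow> _ \<and> ?pairs \<and> ?functional")
proof (intro iffI conjI)
  assume A: "partial_assignment A"
  then show "finite_set A" by (simp add: partial_assignment_def)
  from A obtain D where D: "fun_on A D (\<lambda>b. b \<epsilon> universe M)"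
    by (auto simp: partial_assignment_def)
  show ?pairs using fun_on_pair[OF D] by metis
  show ?functional using fun_on_unique[OF D] by blast
next
  assume "finite_set A \<and> ?pairs \<and> ?functional"
  then have fin: "finite_set A" and pairs: ?pairs and fnl: ?functional by blast+
  \<comment> \<open>The domain is recovered as the image of \<open>A\<close> under the first
    projection.\<close>
  obtain D where D: "setp D" "\<And>x. x \<epsilon> D \<longleftrightarrow> setp x \<and> (\<exists>p. p \<epsilon> A \<and> (\<exists>\<^sub>s b. p = \<langle>x, b\<rangle>))"
  proof (rule set_image)
    show "setp A" using fin by (rule finite_setp)
    show "predicative (\<lambda>e. \<exists>\<^sub>s b. e (Suc 0) = \<langle>e 0, b\<rangle>)" by (intro pred_intros; auto)
    show "y = z" if "setp y" "setp z" "\<exists>\<^sub>s b. x = \<langle>y, b\<rangle>" "\<exists>\<^sub>s b. x = \<langle>z, b\<rangle>" for x y z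
      using that opair_eq_iff by metis
  qed (rule that)
  have "fun_on A D (\<lambda>b. b \<epsilon> universe M)"
  proof (rule fun_onI)
    fix p assume p: "p \<epsilon> A"
    then obtain x b where "setp x" "b \<epsilon> universe M" "p = \<langle>x, b\<rangle>" using pairs by blast
    moreover from this p have "x \<epsilon> D" unfolding D(2) using setpI[of b] by blast
    ultimately show "\<exists>x y. x \<epsilon> D \<and> setp y \<and> y \<epsilon> universe M \<and> p = \<langle>x, y\<rangle>"
      using setpI[of b] by blast
  next
    fix x assume "x \<epsilon> D"
    then show "\<exists>y. setp y \<and> \<langle>x, y\<rangle> \<epsilon> A" unfolding D(2) by blast
  next
    fix x y z assume "x \<epsilon> D" "setp y" "setp z" "\<langle>x, y\<rangle> \<epsilon> A" "\<langle>x, z\<rangle> \<epsilon> A"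
    then show "y = z" using fnl setpI[of x] by blast
  qed
  with fin D(1) show "partial_assignment A" by (auto simp: partial_assignment_def)
qed

lemma partial_assignment_setp: "partial_assignment A \<Longrightarrow> setp A"
  by (simp add: partial_assignment_def finite_setp)

lemma partial_assignment_unique:
  assumes "partial_assignment A" "\<langle>x, b\<rangle> \<epsilon> A" "\<langle>x, c\<rangle> \<epsilon> A" "setp x" "setp b" "setp c"
  shows "b = c"
  using assms unfolding partial_assignment_iff by blast

lemma partial_assignment_universe:
  assumes "partial_assignment A" "\<langle>x, b\<rangle> \<epsilon> A" "setp x" "setp b"
  shows "b \<epsilon> universe M"
  using assms fun_onD(2) unfolding partial_assignment_def by metis

lemma assignment_for_iff:
  "assignment_for M q A \<longleftrightarrow> partial_assignment A \<and> (\<forall>x. is_var x \<and> free x q \<longrightarrow> in_dom A x)"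
  unfolding assignment_for_def partial_assignment_def using is_var_setp by blast

lemma mem_update: "p \<epsilon> update A x b \<longleftrightarrow> p = \<langle>x, b\<rangle> \<or> (p \<epsilon> A \<and> \<not> (\<exists>\<^sub>s c. p = \<langle>x, c\<rangle>))"
proof -
  have "p \<epsilon> update A x b \<longleftrightarrow> setp p \<and> (p = \<langle>x, b\<rangle> \<or> (p \<epsilon> A \<and> \<not> (\<exists>\<^sub>s c. p = \<langle>x, c\<rangle>)))"
    unfolding update_def by (rule mem_coll) (intro pred_intros; auto)
  then show ?thesis using setpI[of p A] setp_opair[of x b] by metis
qed

lemma pair_mem_update:
  assumes "setp x" "setp b" "setp y" "setp c"
  shows "\<langle>y, c\<rangle> \<epsilon> update A x b \<longleftrightarrow> (y = x \<and> c = b) \<or> (y \<noteq> x \<and> \<langle>y, c\<rangle> \<epsilon> A)"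
proof -
  have "\<langle>y, c\<rangle> = \<langle>x, d\<rangle> \<longleftrightarrow> y = x \<and> c = d" if "setp d" for d
    using assms that by simp
  then show ?thesis unfolding mem_update using assms by metis
qed

lemma partial_assignment_update:
  assumes A: "partial_assignment A" and x: "setp x" and b: "b \<epsilon> universe M"
  shows "partial_assignment (update A x b)"
proof -
  have sb: "setp b" using b by (rule setpI)
  have "finite_set (cins \<langle>x, b\<rangle> A)"
    using A finite_set_cins by (simp add: partial_assignment_def)
  then have "finite_set (update A x b)"
    by (rule finite_set_subset) (auto simp: mem_update mem_cins)
  moreover have "\<exists>\<^sub>s y. \<exists>c. c \<epsilon> universe M \<and> p = \<langle>y, c\<rangle>" if "p \<epsilon> update A x b" for p
    using that A x b unfolding mem_update partial_assignment_iff by blast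
  moreover have "c = d" if "setp y" "setp c" "setp d" "\<langle>y, c\<rangle> \<epsilon> update A x b" "\<langle>y, d\<rangle> \<epsilon> update A x b" for y c d
    using that(4,5) partial_assignment_unique[OF A _ _ that(1-3)]
    unfolding pair_mem_update[OF x sb that(1,2)] pair_mem_update[OF x sb that(1,3)] by blast
  ultimately show ?thesis unfolding partial_assignment_iff by blast
qed

lemma update_commute:
  assumes "setp x" "setp y" "x \<noteq> y" "setp b" "setp c"
  shows "update (update A x b) y c = update (update A y c) x b"
proof (rule extensionality)
  fix p
  have "\<langle>x, b\<rangle> \<noteq> \<langle>y, d\<rangle>" "\<langle>y, c\<rangle> \<noteq> \<langle>x, d\<rangle>" if "setp d" for d
    using that assms by auto
  then show "p \<epsilon> update (update A x b) y c \<longleftrightarrow> p \<epsilon> update (update A y c) x b"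
    unfolding mem_update by metis
qed

lemma assignment_for_update:
  assumes "assignment_for M (All x p) A" "setp x" "setp p" "b \<epsilon> universe M"
  shows "assignment_for M p (update A x b)"
proof -
  have A: "partial_assignment A" and dom: "\<forall>y. is_var y \<and> free y (All x p) \<longrightarrow> in_dom A y"
    using assms(1) by (auto simp: assignment_for_iff)
  have sb: "setp b" using assms(4) by (rule setpI)
  have "in_dom (update A x b) y" if y: "is_var y" "free y p" for y
  proof (cases "y = x")
    case True
    then show ?thesis
      using pair_mem_update[OF assms(2) sb assms(2) sb] sb unfolding in_dom_def by blast
  next
    case False
    then obtain c where "setp c" "\<langle>y, c\<rangle> \<epsilon> A"
      using dom y assms(2,3) by (auto simp: free_All in_dom_def)
    then show ?thesis
      using pair_mem_update[OF assms(2) sb is_var_setp[OF y(1)]] False unfolding in_dom_def by blast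
  qed
  then show ?thesis
    unfolding assignment_for_iff using partial_assignment_update[OF A assms(2,4)] by blast
qed

text \<open>Variables without a value receive an arbitrary element of the nonempty universe, one
  after another along the finite set \<open>W\<close>; values already present are kept.\<close>

lemma partial_assignment_extend:
  assumes A: "partial_assignment A" and "finite_set W"
  shows "\<exists>A'. partial_assignment A' \<and> (\<forall>p. p \<epsilon> A \<longrightarrow> p \<epsilon> A') \<and> (\<forall>x. x \<epsilon> W \<longrightarrow> in_dom A' x)"
proof -
  define Q where "Q W \<longleftrightarrow> (\<exists>\<^sub>s A'. partial_assignment A' \<and> (\<forall>p. p \<epsilon> A \<longrightarrow> p \<epsilon> A')
      \<and> (\<forall>x. x \<epsilon> W \<longrightarrow> in_dom A' x))" for W
  have "predicative (\<lambda>e. Q (e 0))"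
    unfolding Q_def by (intro pred_intros; auto intro: setpI)
  then have "Q W" using assms(2)
  proof (rule finite_set_induct)
    show "Q cempty"
      unfolding Q_def using A partial_assignment_setp[OF A] by auto
  next
    fix W x
    assume x: "setp x"
      and W: "Q W"
    from W obtain B where B: "partial_assignment B" "\<forall>p. p \<epsilon> A \<longrightarrow> p \<epsilon> B" "\<forall>x. x \<epsilon> W \<longrightarrow> in_dom B x"
      unfolding Q_def by (elim exE conjE)
    show "Q (cins x W)"
    proof (cases "in_dom B x")
      case True
      then have "\<forall>y. y \<epsilon> cins x W \<longrightarrow> in_dom B y" using B(3) by (simp add: mem_cins)
      then show ?thesis unfolding Q_def using B(1,2) partial_assignment_setp[OF B(1)] by blast
    next
      case False
      obtain b where b: "b \<epsilon> universe M" by (rule universe_nonempty)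
      have sb: "setp b" using b by (rule setpI)
      \<comment> \<open>As \<open>x\<close> has no value in \<open>B\<close>, this update discards
        nothing.\<close>
      have eq: "p \<epsilon> update B x b \<longleftrightarrow> p = \<langle>x, b\<rangle> \<or> p \<epsilon> B" for p
        using False unfolding mem_update in_dom_def by blast
      have new: "in_dom (update B x b) x" using sb unfolding in_dom_def eq by blast
      have old: "in_dom (update B x b) y" if "in_dom B y" for y
        using that unfolding in_dom_def eq by blast
      have "\<forall>y. y \<epsilon> cins x W \<longrightarrow> in_dom (update B x b) y"
        using B(3) new old by (simp add: mem_cins)
      moreover have "\<forall>p. p \<epsilon> A \<longrightarrow> p \<epsilon> update B x b" using B(2) by (simp add: eq)
      moreover have B': "partial_assignment (update B x b)"
        using B(1) x b by (rule partial_assignment_update)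
      moreover have "setp (update B x b)" using B' by (rule partial_assignment_setp)
      ultimately show ?thesis unfolding Q_def by blast
    qed
  qed
  then show ?thesis unfolding Q_def by (elim exE conjE) (intro exI conjI)
qed

section \<open>Values of terms\<close>

lemma mono_tm_val_step: "mono_step (tm_val_step M A)"
proof -
  have "tm_val_step M A Y q" if "\<forall>z. z \<epsilon> X \<longrightarrow> z \<epsilon> Y" "tm_val_step M A X q" for X Y q
  proof -
    have pw: "pointwise (\<lambda>u e. \<langle>u, e\<rangle> \<epsilon> Y) a d" if "pointwise (\<lambda>u e. \<langle>u, e\<rangle> \<epsilon> X) a d" for a d
      using that by (rule pointwise_mono) (use \<open>\<forall>z. z \<epsilon> X \<longrightarrow> z \<epsilon> Y\<close> in blast)
    show ?thesis
      using that(2) unfolding tm_val_step_def by (blast intro: pw)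
  qed
  then show ?thesis unfolding mono_step_def by blast
qed

lemma is_var_neq_Fn: "is_var x \<Longrightarrow> x \<noteq> Fn f a"
  by (auto simp: is_var_def code_simps)

lemma tm_val_var:
  assumes "is_var x" "setp b"
  shows "tm_val M A x b \<longleftrightarrow> \<langle>x, b\<rangle> \<epsilon> A"
proof
  assume "tm_val M A x b"
  from tm_val_cases[OF this is_var_setp[OF assms(1)] assms(2)] show "\<langle>x, b\<rangle> \<epsilon> A"
    using is_var_neq_Fn[OF assms(1)] by blast
next
  assume *: "\<langle>x, b\<rangle> \<epsilon> A"
  show "tm_val M A x b"
    unfolding tm_val_generated
  proof (rule generated_step0[OF mono_tm_val_step])
    show "tm_val_step M A cempty \<langle>x, b\<rangle>"
      unfolding tm_val_step_def using * assms is_var_setp[OF assms(1)] by blast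
  qed simp
qed

text \<open>Every argument comes with a finite derivation of its own. The number of arguments is
  internal, so the derivations are united by \<open>closed_under_directed\<close> over the index
  set; \<open>R i\<close> asks that the value of argument number \<open>i\<close> be
  derived.\<close>

lemma tm_val_FnI:
  assumes pw: "pointwise (tm_val M A) a d" and val: "\<langle>\<langle>f, d\<rangle>, b\<rangle> \<epsilon> fun_int M"
    and sets: "setp f" "setp a" "setp d" "setp b"
  shows "tm_val M A (Fn f a) b"
proof -
  obtain n where n: "is_nat n" "fun_on a n (\<lambda>_. True)" "fun_on d n (\<lambda>_. True)"
    "\<forall>\<^sub>s i. \<forall>\<^sub>s x. \<forall>\<^sub>s y. \<langle>i, x\<rangle> \<epsilon> a \<and> \<langle>i, y\<rangle> \<epsilon> d \<longrightarrow> tm_val M A x y"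
    by (rule pointwiseE[OF pw])
  define R where "R i X \<longleftrightarrow> (\<forall>\<^sub>s t. \<forall>\<^sub>s e. \<langle>i, t\<rangle> \<epsilon> a \<and> \<langle>i, e\<rangle> \<epsilon> d \<longrightarrow> \<langle>t, e\<rangle> \<epsilon> X)" for i X
  have "\<exists>X. closed_under (tm_val_step M A) X \<and> (\<forall>i. i \<epsilon> n \<longrightarrow> R i X)"
    using mono_tm_val_step
  proof (rule closed_under_directed)
    show "predicative (\<lambda>e. tm_val_step M A (e (Suc 0)) (e 0))"
      unfolding tm_val_step_def by (intro pred_intros; auto intro: setpI)
    show "predicative (\<lambda>e. R (e 0) (e (Suc 0)))"
      unfolding R_def by (intro pred_intros; auto intro: setpI)
    show "finite_set n" using n(1) by (rule finite_set_nat)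
    show "\<exists>X. closed_under (tm_val_step M A) X \<and> R i X" if i: "i \<epsilon> n" for i
    proof -
      have si: "setp i" using i by (rule setpI)
      obtain t where t: "setp t" "\<langle>i, t\<rangle> \<epsilon> a" using fun_on_value[OF n(2) i] by blast
      obtain e where e: "setp e" "\<langle>i, e\<rangle> \<epsilon> d" using fun_on_value[OF n(3) i] by blast
      have "tm_val M A t e" using n(4) t e si by blast
      then obtain X where X: "closed_under (tm_val_step M A) X" "\<langle>t, e\<rangle> \<epsilon> X"
        unfolding tm_val_generated generated_iff_closed by blast
      have "R i X"
        unfolding R_def
        using X(2) fun_on_unique[OF n(2) t(2) _ si t(1)] fun_on_unique[OF n(3) e(2) _ si e(1)]
        by metis
      with X(1) show ?thesis by blast
    qed
    show "R i W" if "R i V" "\<And>z. z \<epsilon> V \<Longrightarrow> z \<epsilon> W" for i V W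
      using that unfolding R_def by simp
  qed
  then obtain X where X: "closed_under (tm_val_step M A) X" "\<forall>i. i \<epsilon> n \<longrightarrow> R i X" by blast
  have "pointwise (\<lambda>u e. \<langle>u, e\<rangle> \<epsilon> X) a d"
    by (rule pointwiseI[OF n(1-3)]) (use X(2) in \<open>unfold R_def, blast\<close>)
  then have "tm_val_step M A X \<langle>Fn f a, b\<rangle>"
    unfolding tm_val_step_def using val sets by blast
  then show ?thesis
    unfolding tm_val_generated by (rule generated_closedI[OF mono_tm_val_step X(1)]) simp
qed

lemma tm_val_Fn:
  assumes "setp f" "setp a" "setp b"
  shows "tm_val M A (Fn f a) b \<longleftrightarrow>
    (\<exists>\<^sub>s d. pointwise (tm_val M A) a d \<and> \<langle>\<langle>f, d\<rangle>, b\<rangle> \<epsilon> fun_int M)"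
proof
  assume "tm_val M A (Fn f a) b"
  from tm_val_cases[OF this setp_code(2) assms(3)] consider "is_var (Fn f a)"
    | g c d where "setp g" "setp c" "setp d" "pointwise (tm_val M A) c d"
      "\<langle>\<langle>g, d\<rangle>, b\<rangle> \<epsilon> fun_int M" "Fn f a = Fn g c"
    by blast
  then show "\<exists>\<^sub>s d. pointwise (tm_val M A) a d \<and> \<langle>\<langle>f, d\<rangle>, b\<rangle> \<epsilon> fun_int M"
  proof cases
    case 1
    then show ?thesis using is_var_neq_Fn by blast
  next
    case (2 g c d)
    then have "g = f" "c = a" using assms by (auto simp: code_simps)
    with 2 show ?thesis by blast
  qed
next
  assume "\<exists>\<^sub>s d. pointwise (tm_val M A) a d \<and> \<langle>\<langle>f, d\<rangle>, b\<rangle> \<epsilon> fun_int M"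
  then show "tm_val M A (Fn f a) b" using tm_val_FnI assms by blast
qed

lemma tm_val_in_universe:
  assumes "partial_assignment A" "tm_val M A t b" "setp t" "setp b"
  shows "b \<epsilon> universe M"
  using tm_val_cases[OF assms(2-4)] partial_assignment_universe[OF assms(1)] fun_int_in_universe assms
  by (metis setp_opair)

text \<open>By induction the arguments determine the tuple of values \<open>d\<close>, and
  \<open>fun_int M\<close> is single-valued on the pair of \<open>f\<close> and
  \<open>d\<close>.\<close>

lemma tm_val_unique:
  assumes A: "partial_assignment A" and "tm_val M A t b" "tm_val M A t c" "setp t" "setp b" "setp c"
  shows "b = c"
proof -
  have "predicative (\<lambda>e. \<forall>\<^sub>s b. \<forall>\<^sub>s c. tm_val M A (e 0) b \<longrightarrow> tm_val M A (e 0) c \<longrightarrow> b = c)"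
    by (intro pred_intros; auto)
  then have "\<forall>\<^sub>s b. \<forall>\<^sub>s c. tm_val M A t b \<longrightarrow> tm_val M A t c \<longrightarrow> b = c"
    using \<open>setp t\<close>
  proof (rule below_induct)
    fix t assume t: "setp t"
      and IH: "\<And>u. below u t \<Longrightarrow> \<forall>\<^sub>s b. \<forall>\<^sub>s c. tm_val M A u b \<longrightarrow> tm_val M A u c \<longrightarrow> b = c"
    show "\<forall>\<^sub>s b. \<forall>\<^sub>s c. tm_val M A t b \<longrightarrow> tm_val M A t c \<longrightarrow> b = c"
    proof (intro allI impI)
      fix b c assume bc: "setp b" "setp c" "tm_val M A t b" "tm_val M A t c"
      from tm_val_cases[OF bc(3) t bc(1)] show "b = c"
      proof (elim disjE exE conjE)
        assume "is_var t" "\<langle>t, b\<rangle> \<epsilon> A"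
        then show ?thesis
          using bc(4) partial_assignment_unique[OF A _ _ t bc(1,2)] tm_val_var bc(2) by blast
      next
        fix f a d assume d: "setp f" "setp a" "setp d" "pointwise (tm_val M A) a d"
          "\<langle>\<langle>f, d\<rangle>, b\<rangle> \<epsilon> fun_int M" "t = Fn f a"
        obtain d' where d': "setp d'" "pointwise (tm_val M A) a d'" "\<langle>\<langle>f, d'\<rangle>, c\<rangle> \<epsilon> fun_int M"
          using bc(4) tm_val_Fn[OF d(1,2) bc(2)] unfolding d(6) by blast
        have "d = d'"
          using d(4) d'(2)
        proof (rule pointwise_unique)
          fix i u v w
          assume "setp i" "setp u" "setp v" "setp w" "\<langle>i, u\<rangle> \<epsilon> a" "tm_val M A u v" "tm_val M A u w"
          then show "v = w" using IH[of u] below_Fn[OF d(1,2), of i u] unfolding d(6) by blast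
        qed
        then show ?thesis using fun_int_unique d(5) d'(3) bc(1,2) setp_opair by metis
      qed
    qed
  qed
  with assms show ?thesis by blast
qed

end

context class_structure
begin

text \<open>Because values are unique, the tuple of argument values is an image under a functional
  relation and exists by replacement; no choice is involved.\<close>

lemma tm_val_exists:
  assumes A: "partial_assignment A" and "is_term \<rho> t"
    and "\<forall>x. is_var x \<and> occurs x t \<longrightarrow> in_dom A x"
  shows "\<exists>b. b \<epsilon> universe M \<and> tm_val M A t b"
proof -
  define Q where "Q t \<longleftrightarrow> is_term \<rho> t \<and> (\<forall>x. is_var x \<and> occurs x t \<longrightarrow> in_dom A x)
    \<longrightarrow> (\<exists>b. b \<epsilon> universe M \<and> tm_val M A t b)" for t
  have "predicative (\<lambda>e. Q (e 0))"
    unfolding Q_def by (intro pred_intros; auto intro: setpI is_var_setp)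
  then have "Q t" using is_term_setp[OF assms(2)]
  proof (rule below_induct)
    fix t assume t: "setp t" and IH: "\<And>u. below u t \<Longrightarrow> Q u"
    show "Q t"
      unfolding Q_def
    proof (intro impI)
      assume asm: "is_term \<rho> t \<and> (\<forall>x. is_var x \<and> occurs x t \<longrightarrow> in_dom A x)"
      from is_term_cases[OF conjunct1[OF asm]]
      show "\<exists>b. b \<epsilon> universe M \<and> tm_val M A t b"
      proof (elim disjE exE conjE)
        assume "is_var t"
        moreover from this have "in_dom A t" using asm occurs_refl[OF t] by simp
        then obtain b where b: "setp b" "\<langle>t, b\<rangle> \<epsilon> A" unfolding in_dom_def by blast
        ultimately have "tm_val M A t b" by (simp add: tm_val_var)
        with partial_assignment_universe[OF A b(2) t b(1)] show ?thesis by blast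
      next
        fix f n a
        assume fa: "setp f" "setp n" "setp a" "\<langle>f, n\<rangle> \<epsilon> fun_arity \<rho>" "fun_on a n (is_term \<rho>)" "t = Fn f a"
        have n: "is_nat n" using arity_nat fa(1,2,4) by blast
        \<comment> \<open>An index is sent to the pair of itself and the value of its argument, so
          the image of \<open>n\<close> under \<open>R\<close> is the value sequence itself.\<close>
        define R where "R i p \<longleftrightarrow> (\<exists>\<^sub>s u. \<exists>\<^sub>s b. \<langle>i, u\<rangle> \<epsilon> a \<and> tm_val M A u b \<and> p = \<langle>i, b\<rangle>)" for i p
        have R_unique: "b = c" if i: "setp i" and b: "R i \<langle>i, b\<rangle>" "R i \<langle>i, c\<rangle>" "setp b" "setp c" for i b c
        proof -
          obtain u where u: "setp u" "\<langle>i, u\<rangle> \<epsilon> a" "tm_val M A u b"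
            using b(1,3) i unfolding R_def by auto
          obtain v where v: "setp v" "\<langle>i, v\<rangle> \<epsilon> a" "tm_val M A v c"
            using b(2,4) i unfolding R_def by auto
          have "u = v" using fun_on_unique[OF fa(5) u(2) v(2) i u(1) v(1)] .
          with tm_val_unique[OF A u(3) _ u(1) b(3,4)] v(3) show ?thesis by simp
        qed
        obtain d where d: "setp d" "\<And>p. p \<epsilon> d \<longleftrightarrow> setp p \<and> (\<exists>i. i \<epsilon> n \<and> R i p)"
        proof (rule set_image)
          show "predicative (\<lambda>e. R (e (Suc 0)) (e 0))"
            unfolding R_def by (intro pred_intros; auto)
          fix i p q assume i: "i \<epsilon> n" and p: "R i p" and q: "R i q"
          obtain b where b: "setp b" "p = \<langle>i, b\<rangle>" using p unfolding R_def by metis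
          obtain c where c: "setp c" "q = \<langle>i, c\<rangle>" using q unfolding R_def by metis
          show "p = q" using R_unique[OF setpI[OF i]] p q b c by metis
        qed (rule fa(2), rule that)
        have val: "\<exists>b. b \<epsilon> universe M \<and> tm_val M A u b" if u: "setp i" "setp u" "\<langle>i, u\<rangle> \<epsilon> a" for i u
        proof -
          have "Q u" using IH below_Fn[OF fa(1,3) u(3,1,2)] fa(6) by simp
          moreover have "is_term \<rho> u" using fun_onD(2)[OF fa(5) u(3,1,2)] .
          moreover have "in_dom A x" if "is_var x \<and> occurs x u" for x
            using asm occurs_FnI[OF fa(1,3) u(1,3)] that fa(6) by simp
          ultimately show ?thesis unfolding Q_def by simp
        qed
        have pair: "\<langle>i, b\<rangle> \<epsilon> d \<longleftrightarrow> i \<epsilon> n \<and> R i \<langle>i, b\<rangle>" if ib: "setp i" "setp b" for i b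
        proof -
          have "j = i" if R: "R j \<langle>i, b\<rangle>" and j: "j \<epsilon> n" for j
          proof -
            obtain c where "setp c" "\<langle>i, b\<rangle> = \<langle>j, c\<rangle>" using R unfolding R_def by metis
            then show ?thesis using ib setpI[OF j] by simp
          qed
          then show ?thesis unfolding d(2) using setp_opair by metis
        qed
        have fd: "fun_on d n (\<lambda>b. b \<epsilon> universe M)"
        proof (rule fun_onI)
          fix p assume "p \<epsilon> d"
          then obtain i where i: "i \<epsilon> n" "R i p" unfolding d(2) by blast
          then obtain u b where u: "setp u" "setp b" "\<langle>i, u\<rangle> \<epsilon> a" "tm_val M A u b" "p = \<langle>i, b\<rangle>"
            unfolding R_def by metis
          have "b \<epsilon> universe M" using tm_val_in_universe[OF A u(4,1,2)] .
          with i(1) u(2,5) show "\<exists>i b. i \<epsilon> n \<and> setp b \<and> b \<epsilon> universe M \<and> p = \<langle>i, b\<rangle>" by blast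
        next
          fix i assume i: "i \<epsilon> n"
          obtain u where u: "setp u" "\<langle>i, u\<rangle> \<epsilon> a" using fun_on_value[OF fa(5) i] by blast
          obtain b where b: "b \<epsilon> universe M" "tm_val M A u b" using val[OF setpI[OF i] u] by blast
          have "R i \<langle>i, b\<rangle>" unfolding R_def using u b setpI[OF b(1)] by blast
          then show "\<exists>b. setp b \<and> \<langle>i, b\<rangle> \<epsilon> d"
            using pair[OF setpI[OF i] setpI[OF b(1)]] i setpI[OF b(1)] by blast
        next
          fix i b c assume "i \<epsilon> n" "setp b" "setp c" "\<langle>i, b\<rangle> \<epsilon> d" "\<langle>i, c\<rangle> \<epsilon> d"
          then show "b = c" using R_unique[of i b c] pair[of i b] pair[of i c] setpI[of i n] by simp
        qed
        have "pointwise (tm_val M A) a d"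
        proof (rule pointwiseI[OF n])
          show "fun_on a n (\<lambda>_. True)" using fa(5) by (rule fun_on_mono) simp
          show "fun_on d n (\<lambda>_. True)" using fd by (rule fun_on_mono) simp
          fix i u b assume i: "setp i" "setp u" "setp b" "\<langle>i, u\<rangle> \<epsilon> a" "\<langle>i, b\<rangle> \<epsilon> d"
          have "R i \<langle>i, b\<rangle>" using pair[OF i(1,3)] i(5) by simp
          then obtain v c where v: "setp v" "setp c" "\<langle>i, v\<rangle> \<epsilon> a" "tm_val M A v c" "\<langle>i, b\<rangle> = \<langle>i, c\<rangle>"
            unfolding R_def by metis
          have "c = b" using v(2,5) i(1,3) by simp
          moreover have "v = u" using fun_on_unique[OF fa(5) v(3) i(4,1) v(1) i(2)] .
          ultimately show "tm_val M A u b" using v(4) by simp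
        qed
        moreover obtain b where b: "b \<epsilon> universe M" "\<langle>\<langle>f, d\<rangle>, b\<rangle> \<epsilon> fun_int M"
          using fun_int_exists[OF fa(4) fd fa(1,2) d(1)] by blast
        ultimately have "tm_val M A t b"
          using tm_val_FnI[OF _ b(2) fa(1,3) d(1) setpI[OF b(1)]] fa(6) by simp
        with b(1) show ?thesis by blast
      qed
    qed
  qed
  with assms show ?thesis unfolding Q_def by blast
qed

text \<open>One inclusion is enough: the derivation of a value consults only pairs that are present
  in \<open>A\<close>.\<close>

lemma tm_val_coincidence:
  assumes "tm_val M A t b" "setp t" "setp b"
    and "\<forall>x. is_var x \<and> occurs x t \<longrightarrow> (\<forall>\<^sub>s c. \<langle>x, c\<rangle> \<epsilon> A \<longrightarrow> \<langle>x, c\<rangle> \<epsilon> B)"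
  shows "tm_val M B t b"
proof -
  define Q where "Q t \<longleftrightarrow> (\<forall>x. is_var x \<and> occurs x t \<longrightarrow> (\<forall>\<^sub>s c. \<langle>x, c\<rangle> \<epsilon> A \<longrightarrow> \<langle>x, c\<rangle> \<epsilon> B))
    \<longrightarrow> (\<forall>\<^sub>s b. tm_val M A t b \<longrightarrow> tm_val M B t b)" for t
  have "predicative (\<lambda>e. Q (e 0))"
    unfolding Q_def by (intro pred_intros; auto intro: setpI is_var_setp)
  then have "Q t" using assms(2)
  proof (rule below_induct)
    fix t assume t: "setp t" and IH: "\<And>u. below u t \<Longrightarrow> Q u"
    show "Q t"
      unfolding Q_def
    proof (intro impI allI)
      fix b assume agree: "\<forall>x. is_var x \<and> occurs x t \<longrightarrow> (\<forall>\<^sub>s c. \<langle>x, c\<rangle> \<epsilon> A \<longrightarrow> \<langle>x, c\<rangle> \<epsilon> B)"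
        and b: "setp b" and val: "tm_val M A t b"
      from tm_val_cases[OF val t b] show "tm_val M B t b"
      proof (elim disjE exE conjE)
        assume "is_var t" "\<langle>t, b\<rangle> \<epsilon> A"
        then show ?thesis using agree occurs_refl[OF t] b by (simp add: tm_val_var)
      next
        fix f a d
        assume fa: "setp f" "setp a" "setp d" "pointwise (tm_val M A) a d"
          "\<langle>\<langle>f, d\<rangle>, b\<rangle> \<epsilon> fun_int M" "t = Fn f a"
        have "pointwise (tm_val M B) a d"
          using fa(4)
        proof (rule pointwise_mono)
          fix i u c assume u: "setp i" "setp u" "setp c" "\<langle>i, u\<rangle> \<epsilon> a" "tm_val M A u c"
          have "Q u" using IH below_Fn[OF fa(1,2) u(4,1,2)] fa(6) by simp
          moreover have "\<forall>x. is_var x \<and> occurs x u \<longrightarrow> (\<forall>\<^sub>s c. \<langle>x, c\<rangle> \<epsilon> A \<longrightarrow> \<langle>x, c\<rangle> \<epsilon> B)"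
            using agree occurs_FnI[OF fa(1,2) u(1,4)] fa(6) by simp
          ultimately show "tm_val M B u c" unfolding Q_def using u(3,5) by blast
        qed
        then show ?thesis using tm_val_FnI[OF _ fa(5,1,2,3) b] fa(6) by simp
      qed
    qed
  qed
  with assms show ?thesis unfolding Q_def by blast
qed

lemma pointwise_transfer:
  assumes "pointwise S a a'"
    and "\<And>i u v b. setp i \<Longrightarrow> setp u \<Longrightarrow> setp v \<Longrightarrow> setp b \<Longrightarrow> \<langle>i, u\<rangle> \<epsilon> a \<Longrightarrow> S u v \<Longrightarrow> P u b \<longleftrightarrow> Q v b"
  shows "pointwise P a d \<longleftrightarrow> pointwise Q a' d"
proof
  assume P: "pointwise P a d"
  show "pointwise Q a' d"
    \<comment> \<open>Here \<open>a\<close> is the middle sequence of the composition, and the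
      second assumption needs an index of its entry; \<open>pointwise_mem\<close> supplies
      it.\<close>
    using pointwise_swap[OF pointwise_mem[OF assms(1)]] P
    by (rule pointwise_compose) (use assms(2) in metis)
next
  assume Q: "pointwise Q a' d"
  show "pointwise P a d"
    using assms(1) Q by (rule pointwise_compose) (use assms(2) in metis)
qed

text \<open>At the variable \<open>x\<close> both sides say \<open>b = c\<close>: on the left by the
  update, on the right by uniqueness of the value of \<open>t\<close>. At \<open>Fn\<close> the two
  argument sequences have the same value tuples.\<close>

lemma tm_val_subst:
  assumes A: "partial_assignment A" and x: "is_var x" and t: "setp t"
    and c: "setp c" and tc: "tm_val M A t c"
    and "subst_tm x t u v" "setp u" "setp v" "setp b"
  shows "tm_val M (update A x c) u b \<longleftrightarrow> tm_val M A v b"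
proof -
  have sx: "setp x" using x by (rule is_var_setp)
  define Q where "Q u \<longleftrightarrow> (\<forall>\<^sub>s v. subst_tm x t u v \<longrightarrow>
    (\<forall>\<^sub>s b. tm_val M (update A x c) u b \<longleftrightarrow> tm_val M A v b))" for u
  have "predicative (\<lambda>e. Q (e 0))"
    unfolding Q_def by (intro pred_intros; auto)
  then have "Q u" using assms(7)
  proof (rule below_induct)
    fix u assume u: "setp u" and IH: "\<And>w. below w u \<Longrightarrow> Q w"
    show "Q u"
      unfolding Q_def
    proof (intro impI allI)
      fix v b assume v: "setp v" and subst: "subst_tm x t u v" and b: "setp b"
      from subst_tm_cases[OF subst sx t u v]
      show "tm_val M (update A x c) u b \<longleftrightarrow> tm_val M A v b"
      proof (elim disjE exE conjE)
        assume "u = x" "v = t"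
        moreover have "tm_val M (update A x c) x b \<longleftrightarrow> b = c"
          using tm_val_var[OF x b] pair_mem_update[OF sx c sx b] by simp
        moreover have "tm_val M A t b \<longleftrightarrow> b = c"
          using tm_val_unique[OF A _ tc t b c] tc by blast
        ultimately show ?thesis by simp
      next
        assume "is_var u" "u \<noteq> x" "v = u"
        then show ?thesis
          using tm_val_var[OF _ b] pair_mem_update[OF sx c u b] by simp
      next
        fix f a a'
        assume fa: "setp f" "setp a" "setp a'" "pointwise (subst_tm x t) a a'" "u = Fn f a" "v = Fn f a'"
        have "pointwise (tm_val M (update A x c)) a d \<longleftrightarrow> pointwise (tm_val M A) a' d" for d
          using fa(4)
        proof (rule pointwise_transfer)
          fix i w w' b assume w: "setp i" "setp w" "setp w'" "setp b" "\<langle>i, w\<rangle> \<epsilon> a" "subst_tm x t w w'"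
          have "Q w" using IH below_Fn[OF fa(1,2) w(5,1,2)] fa(5) by simp
          then show "tm_val M (update A x c) w b \<longleftrightarrow> tm_val M A w' b"
            unfolding Q_def using w(3,4,6) by blast
        qed
        then show ?thesis unfolding fa(5,6) tm_val_Fn[OF fa(1,2) b] tm_val_Fn[OF fa(1,3) b] by simp
      qed
    qed
  qed
  with assms(6,8,9) show ?thesis unfolding Q_def by blast
qed

text \<open>A finite superset of the variables is all that is claimed. Such bounds survive
  enlargement, so \<open>finite_directed\<close> can collect them over the arguments of a function
  symbol.\<close>

lemma finite_term_vars:
  assumes "is_term \<rho> t"
  shows "\<exists>W. finite_set W \<and> (\<forall>x. is_var x \<and> occurs x t \<longrightarrow> x \<epsilon> W)"
proof -
  define R where "R t W \<longleftrightarrow> (\<forall>x. is_var x \<and> occurs x t \<longrightarrow> x \<epsilon> W)" for t W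
  define Q where "Q t \<longleftrightarrow> is_term \<rho> t \<longrightarrow> (\<exists>\<^sub>s W. finite_set W \<and> R t W)" for t
  have "predicative (\<lambda>e. Q (e 0))"
    unfolding Q_def R_def by (intro pred_intros; auto intro: is_var_setp)
  then have "Q t" using is_term_setp[OF assms]
  proof (rule below_induct)
    fix t assume t: "setp t" and IH: "\<And>u. below u t \<Longrightarrow> Q u"
    show "Q t"
      unfolding Q_def
    proof (intro impI)
      assume "is_term \<rho> t"
      from is_term_cases[OF this] show "\<exists>\<^sub>s W. finite_set W \<and> R t W"
      proof (elim disjE exE conjE)
        assume v: "is_var t"
        have "R t (cins t cempty)"
          unfolding R_def using occurs_cases is_var_neq_Fn[OF v] t by (metis mem_cins)
        then show ?thesis using finite_set_cins[OF finite_set_cempty t] finite_setp by blast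
      next
        fix f n a
        assume fa: "setp f" "setp n" "setp a" "\<langle>f, n\<rangle> \<epsilon> fun_arity \<rho>" "fun_on a n (is_term \<rho>)" "t = Fn f a"
        have n: "is_nat n" using arity_nat fa(1,2,4) by blast
        define S where "S i W \<longleftrightarrow> (\<forall>\<^sub>s u. \<langle>i, u\<rangle> \<epsilon> a \<longrightarrow> R u W)" for i W
        have "\<exists>\<^sub>s W. finite_set W \<and> (\<forall>i. i \<epsilon> n \<longrightarrow> S i W)"
        proof (rule finite_directed)
          show "predicative (\<lambda>e. S (e 0) (e (Suc 0)))"
            unfolding S_def R_def by (intro pred_intros; auto intro: is_var_setp)
          show "predicative (\<lambda>e. finite_set (e 0))" by (intro pred_intros)
          show "finite_set n" using n by (rule finite_set_nat)
          show "finite_set cempty" by (rule finite_set_cempty)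
          show "finite_set (cun V W)" if "finite_set V" "finite_set W" for V W
            using that by (rule finite_set_cun)
          show "S i W" if "S i V" "\<And>z. z \<epsilon> V \<Longrightarrow> z \<epsilon> W" for i V W
            using that unfolding S_def R_def by simp
          fix i assume i: "i \<epsilon> n"
          obtain u where u: "setp u" "\<langle>i, u\<rangle> \<epsilon> a" "is_term \<rho> u" using fun_on_value[OF fa(5) i] by blast
          have "Q u" using IH below_Fn[OF fa(1,3) u(2) setpI[OF i] u(1)] fa(6) by simp
          then obtain W where W: "setp W" "finite_set W" "R u W" unfolding Q_def using u(3) by blast
          have "S i W"
            unfolding S_def using W(3) fun_on_unique[OF fa(5) u(2) _ setpI[OF i] u(1)] by metis
          with W show "\<exists>\<^sub>s W. finite_set W \<and> S i W" by blast
        qed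
        then obtain W where W: "setp W" "finite_set W" "\<forall>i. i \<epsilon> n \<longrightarrow> S i W" by blast
        have "R t W"
          unfolding R_def
        proof (intro allI impI)
          fix x assume x: "is_var x \<and> occurs x t"
          from occurs_cases[OF conjunct2[OF x]] show "x \<epsilon> W"
          proof (elim disjE exE conjE)
            assume "t = x"
            then show ?thesis using is_var_neq_Fn x fa(6) by blast
          next
            fix g b i u
            assume g: "setp g" "setp b" "setp i" "occurs x u" "\<langle>i, u\<rangle> \<epsilon> b" "t = Fn g b"
            have "b = a" using g(1,2,6) fa(1,3,6) by (simp add: code_simps)
            then have iu: "\<langle>i, u\<rangle> \<epsilon> a" using g(5) by simp
            have su: "setp u" using g(4) by (rule occurs_setp)
            have "i \<epsilon> n" using fun_onD(1)[OF fa(5) iu g(3) su] .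
            then show ?thesis using W(3) iu su x g(4) unfolding S_def R_def by blast
          qed
        qed
        with W show ?thesis by blast
      qed
    qed
  qed
  with assms show ?thesis unfolding Q_def R_def by blast
qed

end

section \<open>Truth in a valuation\<close>

context class_structure
begin

lemma is_fm_elim [consumes 1, case_names Eqn Rl Neg Imp All]:
  assumes "is_fm \<rho> q"
  obtains t u where "setp t" "setp u" "is_term \<rho> t" "is_term \<rho> u" "q = Eqn t u"
  | r n a where "setp r" "setp n" "setp a" "\<langle>r, n\<rangle> \<epsilon> rel_arity \<rho>" "fun_on a n (is_term \<rho>)" "q = Rl r a"
  | p where "setp p" "is_fm \<rho> p" "q = Neg p"
  | p r where "setp p" "setp r" "is_fm \<rho> p" "is_fm \<rho> r" "q = Imp p r"
  | x p where "setp x" "setp p" "is_var x" "is_fm \<rho> p" "q = All x p"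
  using is_fm_cases[OF assms] unfolding is_atomic_def
  by (elim disjE exE conjE)
    ((rule that(1); assumption), (rule that(2); assumption), (rule that(3); assumption),
      (rule that(4); assumption), (rule that(5); assumption))

section \<open>Finite bounds for free variables\<close>

lemma finite_fm_vars:
  assumes "is_fm \<rho> q"
  shows "\<exists>W. finite_set W \<and> (\<forall>x. is_var x \<and> free x q \<longrightarrow> x \<epsilon> W)"
proof -
  define R where "R q W \<longleftrightarrow> (\<forall>x. is_var x \<and> free x q \<longrightarrow> x \<epsilon> W)" for q W
  define Q where "Q q \<longleftrightarrow> is_fm \<rho> q \<longrightarrow> (\<exists>\<^sub>s W. finite_set W \<and> R q W)" for q
  have "predicative (\<lambda>e. Q (e 0))"
    unfolding Q_def R_def by (intro pred_intros; auto intro: is_var_setp)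
  then have "Q q" using is_fm_setp[OF assms]
  proof (rule below_induct)
    fix q assume IH: "\<And>p. below p q \<Longrightarrow> Q p"
    show "Q q"
      unfolding Q_def
    proof (intro impI)
      assume "is_fm \<rho> q"
      then show "\<exists>\<^sub>s W. finite_set W \<and> R q W"
      proof (cases rule: is_fm_elim)
        case (Eqn t u)
        obtain V where V: "finite_set V" "\<forall>x. is_var x \<and> occurs x t \<longrightarrow> x \<epsilon> V"
          using finite_term_vars[OF Eqn(3)] by blast
        obtain W where W: "finite_set W" "\<forall>x. is_var x \<and> occurs x u \<longrightarrow> x \<epsilon> W"
          using finite_term_vars[OF Eqn(4)] by blast
        have "R q (cun V W)" unfolding R_def Eqn(5) free_Eqn[OF Eqn(1,2)] using V(2) W(2) by auto
        then show ?thesis using finite_set_cun[OF V(1) W(1)] finite_setp by blast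
      next
        case (Rl r n a)
        have n: "is_nat n" using arity_nat Rl(1,2,4) by blast
        define S where "S i W \<longleftrightarrow> (\<forall>\<^sub>s u. \<langle>i, u\<rangle> \<epsilon> a \<longrightarrow> (\<forall>x. is_var x \<and> occurs x u \<longrightarrow> x \<epsilon> W))" for i W
        have "\<exists>\<^sub>s W. finite_set W \<and> (\<forall>i. i \<epsilon> n \<longrightarrow> S i W)"
        proof (rule finite_directed)
          show "predicative (\<lambda>e. S (e 0) (e (Suc 0)))"
            unfolding S_def by (intro pred_intros; auto intro: is_var_setp)
          show "predicative (\<lambda>e. finite_set (e 0))" by (intro pred_intros)
          show "finite_set n" using n by (rule finite_set_nat)
          show "finite_set cempty" by (rule finite_set_cempty)
          show "finite_set (cun V W)" if "finite_set V" "finite_set W" for V W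
            using that by (rule finite_set_cun)
          show "S i W" if "S i V" "\<And>z. z \<epsilon> V \<Longrightarrow> z \<epsilon> W" for i V W
            using that unfolding S_def by simp
          fix i assume i: "i \<epsilon> n"
          obtain u where u: "setp u" "\<langle>i, u\<rangle> \<epsilon> a" "is_term \<rho> u" using fun_on_value[OF Rl(5) i] by blast
          obtain W where W: "finite_set W" "\<forall>x. is_var x \<and> occurs x u \<longrightarrow> x \<epsilon> W"
            using finite_term_vars[OF u(3)] by blast
          have "S i W"
            unfolding S_def using W(2) fun_on_unique[OF Rl(5) u(2) _ setpI[OF i] u(1)] by metis
          with W(1) show "\<exists>\<^sub>s W. finite_set W \<and> S i W" using finite_setp by blast
        qed
        then obtain W where W: "setp W" "finite_set W" "\<forall>i. i \<epsilon> n \<longrightarrow> S i W" by blast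
        have "x \<epsilon> W" if x: "is_var x" and f: "free x q" for x
        proof -
          obtain i u where i: "setp i" "setp u" "\<langle>i, u\<rangle> \<epsilon> a" "occurs x u"
            using f free_Rl[OF Rl(1,3)] unfolding Rl(6) by blast
          have "i \<epsilon> n" using fun_onD(1)[OF Rl(5) i(3,1,2)] .
          then show ?thesis using W(3) i x unfolding S_def by blast
        qed
        then show ?thesis using W(1,2) unfolding R_def by blast
      next
        case (Neg p)
        have "Q p" using IH below_code(1)[OF Neg(1,1)] Neg(3) by simp
        then show ?thesis unfolding Q_def R_def Neg(3) free_Neg[OF Neg(1)] using Neg(2) by blast
      next
        case (Imp p r)
        have "Q p" using IH below_code(2)[OF Imp(1,2)] Imp(5) by simp
        then obtain V where V: "finite_set V" "R p V" unfolding Q_def using Imp(3) by blast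
        have "Q r" using IH below_code(3)[OF Imp(1,2)] Imp(5) by simp
        then obtain W where W: "finite_set W" "R r W" unfolding Q_def using Imp(4) by blast
        have "R q (cun V W)" using V(2) W(2) unfolding R_def Imp(5) free_Imp[OF Imp(1,2)] by auto
        then show ?thesis using finite_set_cun[OF V(1) W(1)] finite_setp by blast
      next
        case (All x p)
        have "Q p" using IH below_code(4)[OF All(1,2)] All(5) by simp
        then show ?thesis unfolding Q_def R_def All(5) free_All[OF All(1,2)] using All(4) by blast
      qed
    qed
  qed
  with assms show ?thesis unfolding Q_def R_def by blast
qed

section \<open>Truth relative to one evaluated formula\<close>

definition truth :: "'a \<Rightarrow> 'a \<Rightarrow> 'a \<Rightarrow> bool" where
  "truth V q A \<longleftrightarrow> \<langle>\<langle>q, A\<rangle>, num 1\<rangle> \<epsilon> V"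

text \<open>The Tarskian clauses bind \<open>V\<close> only at subformulas of \<chi>, which is why
  the facts about \<open>truth V\<close> carry a hypothesis \<open>subfm q \<chi>\<close>.\<close>

definition evaluates :: "'a \<Rightarrow> 'a \<Rightarrow> bool" where
  "evaluates V \<chi> \<longleftrightarrow> is_fm \<rho> \<chi> \<and> is_valuation M (sing \<chi>) V"

lemma predicative_truth [pred_intros]:
  "definable v \<Longrightarrow> definable q \<Longrightarrow> definable a \<Longrightarrow> predicative (\<lambda>e. truth (v e) (q e) (a e))"
  unfolding truth_def by (intro pred_intros)

lemma sat_dom_sing: "is_fm \<rho> \<chi> \<Longrightarrow> sat_dom M (sing \<chi>) q A \<longleftrightarrow> subfm q \<chi> \<and> assignment_for M q A"
  unfolding sat_dom_def mem_sing using is_fm_setp by blast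

lemma assignment_for_partial: "assignment_for M q A \<Longrightarrow> partial_assignment A"
  by (simp add: assignment_for_iff)

lemma assignment_for_setp: "assignment_for M q A \<Longrightarrow> setp A"
  using assignment_for_partial partial_assignment_setp by blast

lemma assignment_for_mono:
  assumes "assignment_for M q A" "\<And>x. is_var x \<Longrightarrow> free x p \<Longrightarrow> free x q"
  shows "assignment_for M p A"
  using assms unfolding assignment_for_iff by simp

lemma assignment_for_Neg: "setp p \<Longrightarrow> assignment_for M (Neg p) A \<longleftrightarrow> assignment_for M p A"
  unfolding assignment_for_iff by (simp add: free_Neg)

lemma assignment_for_Imp:
  "setp p \<Longrightarrow> setp q \<Longrightarrow> assignment_for M (Imp p q) A \<longleftrightarrow> assignment_for M p A \<and> assignment_for M q A"
  unfolding assignment_for_iff by (auto simp: free_Imp)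

context
  fixes V \<chi>
  assumes ev: "evaluates V \<chi>"
begin

lemma evaluates_fm: "is_fm \<rho> \<chi>"
  using ev by (simp add: evaluates_def)

lemma is_fm_sub: "subfm q \<chi> \<Longrightarrow> is_fm \<rho> q"
  using is_fm_subfm[OF evaluates_fm] .

lemma truth_Eqn:
  assumes "subfm (Eqn t u) \<chi>" "assignment_for M (Eqn t u) A" "setp t" "setp u"
  shows "truth V (Eqn t u) A \<longleftrightarrow> (\<exists>\<^sub>s b. tm_val M A t b \<and> tm_val M A u b)"
  using ev assms assignment_for_setp[OF assms(2)] sat_dom_sing[OF evaluates_fm]
  unfolding evaluates_def is_valuation_def Let_def truth_def by simp

lemma truth_Rl:
  assumes "subfm (Rl r a) \<chi>" "assignment_for M (Rl r a) A" "setp r" "setp a"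
  shows "truth V (Rl r a) A \<longleftrightarrow> (\<exists>\<^sub>s d. pointwise (tm_val M A) a d \<and> \<langle>r, d\<rangle> \<epsilon> rel_int M)"
  using ev assms assignment_for_setp[OF assms(2)] sat_dom_sing[OF evaluates_fm]
  unfolding evaluates_def is_valuation_def Let_def truth_def by simp

lemma truth_Neg:
  assumes "subfm (Neg p) \<chi>" "assignment_for M (Neg p) A" "setp p"
  shows "truth V (Neg p) A \<longleftrightarrow> \<not> truth V p A"
  using ev assms assignment_for_setp[OF assms(2)] sat_dom_sing[OF evaluates_fm]
  unfolding evaluates_def is_valuation_def Let_def truth_def by simp

lemma truth_Imp:
  assumes "subfm (Imp p q) \<chi>" "assignment_for M (Imp p q) A" "setp p" "setp q"
  shows "truth V (Imp p q) A \<longleftrightarrow> (truth V p A \<longrightarrow> truth V q A)"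
  using ev assms assignment_for_setp[OF assms(2)] sat_dom_sing[OF evaluates_fm]
  unfolding evaluates_def is_valuation_def Let_def truth_def by simp

lemma truth_All:
  assumes "subfm (All x p) \<chi>" "assignment_for M (All x p) A" "setp x" "setp p"
  shows "truth V (All x p) A \<longleftrightarrow> (\<forall>b. b \<epsilon> universe M \<longrightarrow> truth V p (update A x b))"
  using ev assms assignment_for_setp[OF assms(2)] sat_dom_sing[OF evaluates_fm]
  unfolding evaluates_def is_valuation_def Let_def truth_def by simp

lemma truth_coincidence:
  assumes "subfm q \<chi>" "assignment_for M q A" "assignment_for M q B"
    and "\<forall>x. is_var x \<and> free x q \<longrightarrow> (\<forall>\<^sub>s b. \<langle>x, b\<rangle> \<epsilon> A \<longleftrightarrow> \<langle>x, b\<rangle> \<epsilon> B)"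
  shows "truth V q A \<longleftrightarrow> truth V q B"
proof -
  define agree where
    "agree q A B \<longleftrightarrow> (\<forall>x. is_var x \<and> free x q \<longrightarrow> (\<forall>\<^sub>s b. \<langle>x, b\<rangle> \<epsilon> A \<longleftrightarrow> \<langle>x, b\<rangle> \<epsilon> B))" for q A B
  \<comment> \<open>Both assignments are quantified in the induction hypothesis because the clause
    for \<open>All\<close> updates them.\<close>
  define Q where "Q q \<longleftrightarrow> (\<forall>\<^sub>s A. \<forall>\<^sub>s B. subfm q \<chi> \<and> assignment_for M q A \<and> assignment_for M q B
    \<and> agree q A B \<longrightarrow> (truth V q A \<longleftrightarrow> truth V q B))" for q
  have "predicative (\<lambda>e. Q (e 0))"
    unfolding Q_def agree_def by (intro pred_intros; auto intro: is_var_setp)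
  then have "Q q" using is_fm_setp[OF is_fm_sub[OF assms(1)]]
  proof (rule below_induct)
    fix q assume IH: "\<And>p. below p q \<Longrightarrow> Q p"
    have IH': "truth V p A \<longleftrightarrow> truth V p B"
      if "below p q" "subfm p \<chi>" "assignment_for M p A" "assignment_for M p B" "agree p A B" for p A B
      using IH[OF that(1)] that(2-) assignment_for_setp unfolding Q_def by blast
    show "Q q"
      unfolding Q_def
    proof (intro allI impI)
      fix A B
      assume "subfm q \<chi> \<and> assignment_for M q A \<and> assignment_for M q B \<and> agree q A B"
      then have q: "subfm q \<chi>" and A: "assignment_for M q A" and B: "assignment_for M q B"
        and agree: "agree q A B"
        by blast+
      have val: "tm_val M A t b \<longleftrightarrow> tm_val M B t b"
        if "\<forall>x. occurs x t \<longrightarrow> free x q" "setp t" "setp b" for t b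
        using tm_val_coincidence[OF _ that(2,3), of A B] tm_val_coincidence[OF _ that(2,3), of B A]
          agree that(1) unfolding agree_def by blast
      from is_fm_sub[OF q] show "truth V q A \<longleftrightarrow> truth V q B"
      proof (cases rule: is_fm_elim)
        case (Eqn t u)
        have "tm_val M A t b \<longleftrightarrow> tm_val M B t b" "tm_val M A u b \<longleftrightarrow> tm_val M B u b" if "setp b" for b
          using val[OF _ Eqn(1) that] val[OF _ Eqn(2) that] free_Eqn[OF Eqn(1,2)] Eqn(5) by simp_all
        then show ?thesis
          using truth_Eqn[OF _ _ Eqn(1,2)] q A B unfolding Eqn(5) by auto
      next
        case (Rl r n a)
        have "tm_val M A t b \<longleftrightarrow> tm_val M B t b"
          if "setp i" "setp t" "setp b" "\<langle>i, t\<rangle> \<epsilon> a" for i t b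
          using val[OF _ that(2,3)] free_Rl[OF Rl(1,3)] that Rl(6) by blast
        then have "pointwise (tm_val M A) a d \<longleftrightarrow> pointwise (tm_val M B) a d" for d
          using pointwise_mono[of "tm_val M A" a d "tm_val M B"]
            pointwise_mono[of "tm_val M B" a d "tm_val M A"] by metis
        then show ?thesis
          using truth_Rl[OF _ _ Rl(1,3)] q A B unfolding Rl(6) by simp
      next
        case (Neg p)
        have "truth V p A \<longleftrightarrow> truth V p B"
        proof (rule IH')
          show "below p q" "subfm p \<chi>"
            using below_code(1) subfm_Neg Neg q by simp_all
          show "assignment_for M p A" "assignment_for M p B"
            using A B Neg by (simp_all add: assignment_for_Neg)
          show "agree p A B" using agree Neg free_Neg unfolding agree_def by simp
        qed
        then show ?thesis using truth_Neg[OF _ _ Neg(1)] q A B unfolding Neg(3) by simp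
      next
        case (Imp p r)
        note asg = assignment_for_Imp[OF Imp(1,2)]
        have "truth V p A \<longleftrightarrow> truth V p B"
        proof (rule IH')
          show "below p q" "subfm p \<chi>"
            using below_code(2) subfm_Imp[OF Imp(1,2)] Imp q by simp_all
          show "assignment_for M p A" "assignment_for M p B" using A B asg Imp(5) by simp_all
          show "agree p A B" using agree Imp(5) free_Imp[OF Imp(1,2)] unfolding agree_def by simp
        qed
        moreover have "truth V r A \<longleftrightarrow> truth V r B"
        proof (rule IH')
          show "below r q" "subfm r \<chi>"
            using below_code(3) subfm_Imp[OF Imp(1,2)] Imp q by simp_all
          show "assignment_for M r A" "assignment_for M r B" using A B asg Imp(5) by simp_all
          show "agree r A B" using agree Imp(5) free_Imp[OF Imp(1,2)] unfolding agree_def by simp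
        qed
        ultimately show ?thesis using truth_Imp[OF _ _ Imp(1,2)] q A B unfolding Imp(5) by simp
      next
        case (All x p)
        have "truth V p (update A x b) \<longleftrightarrow> truth V p (update B x b)" if b: "b \<epsilon> universe M" for b
        proof (rule IH')
          have sb: "setp b" using b by (rule setpI)
          show "below p q" "subfm p \<chi>"
            using below_code(4)[OF All(1,2)] subfm_All[OF All(1,2)] All(5) q by simp_all
          show "assignment_for M p (update A x b)" "assignment_for M p (update B x b)"
            using A B assignment_for_update[OF _ All(1,2) b] All(5) by simp_all
          show "agree p (update A x b) (update B x b)"
            unfolding agree_def
          proof (intro allI impI)
            fix y c assume y: "is_var y \<and> free y p" and c: "setp c"
            have sy: "setp y" using y is_var_setp by blast
            have "\<langle>y, c\<rangle> \<epsilon> A \<longleftrightarrow> \<langle>y, c\<rangle> \<epsilon> B" if "y \<noteq> x"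
              using agree y c that free_All[OF All(1,2), of y] unfolding agree_def All(5) by metis
            then show "\<langle>y, c\<rangle> \<epsilon> update A x b \<longleftrightarrow> \<langle>y, c\<rangle> \<epsilon> update B x b"
              unfolding pair_mem_update[OF All(1) sb sy c] by blast
          qed
        qed
        then show ?thesis using truth_All[OF _ _ All(1,2)] q A B unfolding All(5) by simp
      qed
    qed
  qed
  with assms show ?thesis unfolding Q_def agree_def using assignment_for_setp by blast
qed

text \<open>Used whenever a further formula or term calls for more variables. The free variables of
  \<open>q\<close> already have values in \<open>A\<close>, and since \<open>B\<close> is
  single-valued it cannot give them others.\<close>

lemma truth_extend:
  assumes "subfm q \<chi>" "assignment_for M q A" "partial_assignment B" "\<forall>p. p \<epsilon> A \<longrightarrow> p \<epsilon> B"
  shows "assignment_for M q B" "truth V q A \<longleftrightarrow> truth V q B"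
proof -
  show B: "assignment_for M q B"
    using assms(2-4) unfolding assignment_for_iff in_dom_def by blast
  show "truth V q A \<longleftrightarrow> truth V q B"
  proof (rule truth_coincidence[OF assms(1,2) B], intro allI impI)
    fix x b assume x: "is_var x \<and> free x q" and b: "setp b"
    have sx: "setp x" using x is_var_setp by blast
    obtain c where c: "setp c" "\<langle>x, c\<rangle> \<epsilon> A"
      using assms(2) x unfolding assignment_for_iff in_dom_def by blast
    show "\<langle>x, b\<rangle> \<epsilon> A \<longleftrightarrow> \<langle>x, b\<rangle> \<epsilon> B"
      using partial_assignment_unique[OF assms(3) _ _ sx b c(1)] c(2) assms(4) by blast
  qed
qed

text \<open>Induction on \<open>p\<close> with the assignment varying, as quantifiers change it.
  Both \<open>p\<close> and \<open>q\<close> must lie in \<chi>: a substitution instance is in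
  general not a subformula of the original, and a single valuation has to know both.\<close>

lemma truth_subst:
  assumes x: "is_var x" and t: "setp t"
    and "subst_fm x t p q" "subfm p \<chi>" "subfm q \<chi>"
    and "assignment_for M p (update A x c)" "assignment_for M q A"
    and "c \<epsilon> universe M" "tm_val M A t c"
  shows "truth V p (update A x c) \<longleftrightarrow> truth V q A"
proof -
  have sx: "setp x" using x by (rule is_var_setp)
  define asm where "asm p q A c \<longleftrightarrow> subst_fm x t p q \<and> subfm p \<chi> \<and> subfm q \<chi>
    \<and> assignment_for M p (update A x c) \<and> assignment_for M q A \<and> c \<epsilon> universe M \<and> tm_val M A t c"
    for p q A c
  define Q where "Q p \<longleftrightarrow> (\<forall>\<^sub>s q. \<forall>\<^sub>s A. \<forall>\<^sub>s c. asm p q A c \<longrightarrow>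
    (truth V p (update A x c) \<longleftrightarrow> truth V q A))" for p
  have "predicative (\<lambda>e. Q (e 0))"
    unfolding Q_def asm_def by (intro pred_intros; auto)
  then have "Q p" using is_fm_setp[OF is_fm_sub[OF assms(4)]]
  proof (rule below_induct)
    fix p assume sp: "setp p" and IH: "\<And>r. below r p \<Longrightarrow> Q r"
    have IH': "truth V r (update A x c) \<longleftrightarrow> truth V r' A" if "below r p" "asm r r' A c" for r r' A c
    proof -
      have "setp r'" "setp A" "setp c"
        using that(2) subfm_setp assignment_for_setp setpI is_fm_setp[OF is_fm_sub] unfolding asm_def
        by blast+
      with IH[OF that(1)] that(2) show ?thesis unfolding Q_def by blast
    qed
    show "Q p"
      unfolding Q_def
    proof (intro allI impI)
      fix q A c assume sq: "setp q" and "setp A" and sc: "setp c" and asm: "asm p q A c"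
      define A' where "A' = update A x c"
      have subst: "subst_fm x t p q" and sub: "subfm p \<chi>" "subfm q \<chi>"
        and asg: "assignment_for M p A'" "assignment_for M q A"
        and c: "c \<epsilon> universe M" and tc: "tm_val M A t c"
        using asm unfolding asm_def A'_def by blast+
      have A: "partial_assignment A" using asg(2) by (rule assignment_for_partial)
      note tm = tm_val_subst[OF A x t sc tc, folded A'_def]
      have "truth V p A' \<longleftrightarrow> truth V q A"
        using subst sp sq
      proof (cases rule: subst_fm_cases)
        case (Eqn u v u' v')
        have "tm_val M A' u b \<longleftrightarrow> tm_val M A u' b" "tm_val M A' v b \<longleftrightarrow> tm_val M A v' b" if "setp b" for b
          using tm Eqn that by simp_all
        then show ?thesis
          using truth_Eqn[OF _ _ Eqn(1,2)] truth_Eqn[OF _ _ Eqn(3,4)] sub asg unfolding Eqn(7,8) by auto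
      next
        case (Rl r a b)
        have "pointwise (tm_val M A') a d \<longleftrightarrow> pointwise (tm_val M A) b d" for d
          using Rl(4) by (rule pointwise_transfer) (use tm in blast)
        then show ?thesis
          using truth_Rl[OF _ _ Rl(1,2)] truth_Rl[OF _ _ Rl(1,3)] sub asg unfolding Rl(5,6) by simp
      next
        case (Neg r r')
        have "truth V r A' \<longleftrightarrow> truth V r' A"
          unfolding A'_def
        proof (rule IH')
          show "below r p" using below_code(1)[OF Neg(1,1)] Neg(4) by simp
          show "asm r r' A c"
            using asm subfm_Neg[OF Neg(1)] subfm_Neg[OF Neg(2)] assignment_for_Neg[OF Neg(1)]
              assignment_for_Neg[OF Neg(2)] Neg(3) unfolding asm_def Neg(4,5) by simp
        qed
        then show ?thesis
          using truth_Neg[OF _ _ Neg(1)] truth_Neg[OF _ _ Neg(2)] sub asg unfolding Neg(4,5) by simp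
      next
        case (Imp r s r' s')
        note rules = subfm_Imp[OF Imp(1,2)] subfm_Imp[OF Imp(3,4)]
          assignment_for_Imp[OF Imp(1,2)] assignment_for_Imp[OF Imp(3,4)]
        have "truth V r A' \<longleftrightarrow> truth V r' A"
          unfolding A'_def
        proof (rule IH')
          show "below r p" using below_code(2)[OF Imp(1,2)] Imp(7) by simp
          show "asm r r' A c" using asm rules Imp(5) unfolding asm_def Imp(7,8) by simp
        qed
        moreover have "truth V s A' \<longleftrightarrow> truth V s' A"
          unfolding A'_def
        proof (rule IH')
          show "below s p" using below_code(3)[OF Imp(1,2)] Imp(7) by simp
          show "asm s s' A c" using asm rules Imp(6) unfolding asm_def Imp(7,8) by simp
        qed
        ultimately show ?thesis
          using truth_Imp[OF _ _ Imp(1,2)] truth_Imp[OF _ _ Imp(3,4)] sub asg unfolding Imp(7,8) by simp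
      next
        case (All_bound y r)
        \<comment> \<open>With \<open>x\<close> not free in \<open>p\<close>, the assignments
          \<open>A'\<close> and \<open>A\<close> agree on everything that \<open>p\<close> depends
          on.\<close>
        have "\<forall>z. is_var z \<and> free z p \<longrightarrow> (\<forall>\<^sub>s b. \<langle>z, b\<rangle> \<epsilon> A' \<longleftrightarrow> \<langle>z, b\<rangle> \<epsilon> A)"
        proof (intro allI impI)
          fix z b assume z: "is_var z \<and> free z p" and b: "setp b"
          have "z \<noteq> x" using z All_bound(3,4) by metis
          then show "\<langle>z, b\<rangle> \<epsilon> A' \<longleftrightarrow> \<langle>z, b\<rangle> \<epsilon> A"
            unfolding A'_def using pair_mem_update[OF sx sc _ b, of z] is_var_setp z by simp
        qed
        moreover have "q = p" using All_bound by simp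
        ultimately show ?thesis using truth_coincidence[OF sub(1) asg(1)] asg(2) by simp
      next
        case (All y r r')
        have y: "is_var y" using is_fm_sub[OF sub(1)] is_fm_AllD All(1,2) unfolding All(7) by blast
        have "truth V r (update A' y d) \<longleftrightarrow> truth V r' (update A y d)" if d: "d \<epsilon> universe M" for d
        proof -
          have sd: "setp d" using d by (rule setpI)
          \<comment> \<open>Since \<open>y\<close> differs from \<open>x\<close> the updates
            commute, so the induction hypothesis can be applied at \<open>update A y d\<close>.
            There \<open>t\<close> still has the value \<open>c\<close>, because \<open>y\<close>
            does not occur in \<open>t\<close>.\<close>
          have comm: "update A' y d = update (update A y d) x c"
            unfolding A'_def using update_commute[OF sx All(1) _ sc sd] All(4) by simp
          have "tm_val M (update A y d) t c"
            using tc t sc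
          proof (rule tm_val_coincidence, intro allI impI)
            fix z b assume z: "is_var z \<and> occurs z t" and b: "setp b" "\<langle>z, b\<rangle> \<epsilon> A"
            have "z \<noteq> y" using z All(5) by metis
            then show "\<langle>z, b\<rangle> \<epsilon> update A y d"
              using pair_mem_update[OF All(1) sd _ b(1), of z] is_var_setp z b(2) by simp
          qed
          moreover have "subfm r \<chi>" "subfm r' \<chi>"
            using subfm_All[OF All(1,2)] subfm_All[OF All(1,3)] sub unfolding All(7,8) by simp_all
          moreover have "assignment_for M r (update A' y d)" "assignment_for M r' (update A y d)"
            using assignment_for_update[OF _ All(1,2) d] assignment_for_update[OF _ All(1,3) d] asg
            unfolding All(7,8) by simp_all
          ultimately have "asm r r' (update A y d) c"
            unfolding asm_def comm[symmetric] using All(6) c by blast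
          moreover have "below r p" using below_code(4)[OF All(1,2)] All(7) by simp
          ultimately show ?thesis unfolding comm by (rule_tac IH')
        qed
        then show ?thesis
          using truth_All[OF _ _ All(1,2)] truth_All[OF _ _ All(1,3)] sub asg unfolding All(7,8) by simp
      qed
      then show "truth V p (update A x c) \<longleftrightarrow> truth V q A" unfolding A'_def .
    qed
  qed
  moreover have "asm p q A c" unfolding asm_def using assms(3-) by blast
  moreover have "setp q" "setp A" "setp c"
    using is_fm_setp[OF is_fm_sub[OF assms(5)]] assignment_for_setp[OF assms(7)] setpI[OF assms(8)] by blast+
  ultimately show ?thesis unfolding Q_def by blast
qed

end

lemma truth_unique:
  assumes ev: "evaluates V \<chi>" "evaluates W \<psi>"
    and "subfm q \<chi>" "subfm q \<psi>" "assignment_for M q A"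
  shows "truth V q A \<longleftrightarrow> truth W q A"
proof -
  define Q where "Q q \<longleftrightarrow> (\<forall>\<^sub>s A. subfm q \<chi> \<and> subfm q \<psi> \<and> assignment_for M q A \<longrightarrow>
    (truth V q A \<longleftrightarrow> truth W q A))" for q
  have "predicative (\<lambda>e. Q (e 0))"
    unfolding Q_def by (intro pred_intros; auto)
  then have "Q q" using is_fm_setp[OF is_fm_sub[OF ev(1) assms(3)]]
  proof (rule below_induct)
    fix q assume IH: "\<And>p. below p q \<Longrightarrow> Q p"
    have IH': "truth V p A \<longleftrightarrow> truth W p A"
      if "below p q" "subfm p \<chi>" "subfm p \<psi>" "assignment_for M p A" for p A
      using IH[OF that(1)] that(2-) assignment_for_setp unfolding Q_def by blast
    show "Q q"
      unfolding Q_def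
    proof (intro allI impI)
      fix A assume "subfm q \<chi> \<and> subfm q \<psi> \<and> assignment_for M q A"
      then have q: "subfm q \<chi>" "subfm q \<psi>" and A: "assignment_for M q A" by blast+
      from is_fm_sub[OF ev(1) q(1)] show "truth V q A \<longleftrightarrow> truth W q A"
      proof (cases rule: is_fm_elim)
        case (Eqn t u)
        show ?thesis
          using truth_Eqn[OF ev(1) _ _ Eqn(1,2)] truth_Eqn[OF ev(2) _ _ Eqn(1,2)] q A unfolding Eqn(5) by simp
      next
        case (Rl r n a)
        show ?thesis
          using truth_Rl[OF ev(1) _ _ Rl(1,3)] truth_Rl[OF ev(2) _ _ Rl(1,3)] q A unfolding Rl(6) by simp
      next
        case (Neg p)
        have "truth V p A \<longleftrightarrow> truth W p A"
          by (rule IH') (use below_code(1) subfm_Neg assignment_for_Neg Neg q A in simp_all)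
        then show ?thesis
          using truth_Neg[OF ev(1) _ _ Neg(1)] truth_Neg[OF ev(2) _ _ Neg(1)] q A unfolding Neg(3) by simp
      next
        case (Imp p r)
        note rules = below_code(2,3)[OF Imp(1,2)] subfm_Imp[OF Imp(1,2)] assignment_for_Imp[OF Imp(1,2)]
        have "truth V p A \<longleftrightarrow> truth W p A" "truth V r A \<longleftrightarrow> truth W r A"
          by (rule IH'; use rules q A in \<open>simp add: Imp(5)\<close>)+
        then show ?thesis
          using truth_Imp[OF ev(1) _ _ Imp(1,2)] truth_Imp[OF ev(2) _ _ Imp(1,2)] q A unfolding Imp(5) by simp
      next
        case (All x p)
        have "truth V p (update A x b) \<longleftrightarrow> truth W p (update A x b)" if b: "b \<epsilon> universe M" for b
          by (rule IH') (use below_code(4)[OF All(1,2)] subfm_All[OF All(1,2)]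
            assignment_for_update[OF _ All(1,2) b] q A All(5) in simp_all)
        then show ?thesis
          using truth_All[OF ev(1) _ _ All(1,2)] truth_All[OF ev(2) _ _ All(1,2)] q A unfolding All(5) by simp
      qed
    qed
  qed
  with assms show ?thesis unfolding Q_def using assignment_for_setp by blast
qed

end

section \<open>Soundness\<close>

context class_structure
begin

lemma evaluates_exists:
  assumes "is_sat_relation M (sing q) S" "is_fm \<rho> q"
  obtains V where "evaluates V q" "\<forall>\<^sub>s A. \<langle>q, A\<rangle> \<epsilon> S \<longleftrightarrow> truth V q A"
proof -
  obtain V where V: "is_valuation M (sing q) V"
    "\<forall>w. w \<epsilon> S \<longleftrightarrow> (\<exists>\<^sub>s q. \<exists>\<^sub>s A. w = \<langle>q, A\<rangle> \<and> \<langle>\<langle>q, A\<rangle>, num 1\<rangle> \<epsilon> V)"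
    using assms(1) unfolding is_sat_relation_def by blast
  have "evaluates V q" using V(1) assms(2) by (simp add: evaluates_def)
  moreover have "\<forall>\<^sub>s A. \<langle>q, A\<rangle> \<epsilon> S \<longleftrightarrow> truth V q A"
    unfolding V(2)[rule_format] truth_def using is_fm_setp[OF assms(2)] opair_eq_iff by metis
  ultimately show thesis by (rule that)
qed

section \<open>Joining the lines of a proof\<close>

definition equality_axiom :: "'a \<Rightarrow> 'a \<Rightarrow> bool" where
  "equality_axiom a q \<longleftrightarrow> (\<exists>\<^sub>s x. \<exists>\<^sub>s t. \<exists>\<^sub>s u. \<exists>\<^sub>s b. \<exists>\<^sub>s c.
    is_var x \<and> is_term \<rho> t \<and> is_term \<rho> u \<and> is_fm \<rho> a
    \<and> subst_fm x t a b \<and> subst_fm x u a c \<and> q = Imp (Eqn t u) (Imp b c))"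

text \<open>
  The formula substituted into by an instance of the equality axiom need not be a subformula of
  the instance, so that it has to be made part of the formula to be evaluated.
\<close>

definition covers :: "'a \<Rightarrow> 'a \<Rightarrow> bool" where
  "covers \<chi> q \<longleftrightarrow> subfm q \<chi> \<and>
    ((\<exists>\<^sub>s a. equality_axiom a q) \<longrightarrow> (\<exists>\<^sub>s a. equality_axiom a q \<and> subfm a \<chi>))"

lemma predicative_covers [pred_intros]:
  assumes "definable a" "definable b" shows "predicative (\<lambda>e. covers (a e) (b e))"
  unfolding covers_def equality_axiom_def
  by (intro pred_intros assms definable_reindex[OF assms(1)] definable_reindex[OF assms(2)];
      auto simp: inj_def)

lemma covers_mono: "covers \<chi> q \<Longrightarrow> subfm \<chi> \<psi> \<Longrightarrow> covers \<psi> q"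
  unfolding covers_def using subfm_trans by metis

text \<open>The implication \<open>Imp q a\<close> only serves as a container for its two
  subformulas; whether it is true does not matter.\<close>

lemma covers_exists:
  assumes "is_fm \<rho> q"
  obtains \<chi> where "is_fm \<rho> \<chi>" "covers \<chi> q"
proof (cases "\<exists>\<^sub>s a. equality_axiom a q")
  case True
  then obtain a where a: "setp a" "equality_axiom a q" by blast
  then have "is_fm \<rho> a" unfolding equality_axiom_def by blast
  then have "is_fm \<rho> (Imp q a)" using assms by (rule_tac is_fm_Imp)
  moreover have "covers (Imp q a) q"
    unfolding covers_def
    using subfm_ImpI1 subfm_ImpI2 subfm_refl is_fm_setp[OF assms] a by metis
  ultimately show thesis by (rule that)
next
  case False
  then have "covers q q" unfolding covers_def using subfm_refl is_fm_setp[OF assms] by blast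
  with assms show thesis by (rule that)
qed

lemma covers_sequence:
  assumes n: "is_nat n" and s: "fun_on s n (is_fm \<rho>)" and "n \<noteq> cempty"
  shows "\<exists>\<chi>. is_fm \<rho> \<chi> \<and> (\<forall>i. i \<epsilon> n \<longrightarrow> (\<forall>\<^sub>s q. \<langle>i, q\<rangle> \<epsilon> s \<longrightarrow> covers \<chi> q))"
proof -
  \<comment> \<open>Initial segments of the proof are joined one line at a time. The guard on
    \<open>m\<close> ensures in the successor step that line \<open>m\<close> exists.\<close>
  define Q where "Q m \<longleftrightarrow> (m \<epsilon> n \<or> m = n \<longrightarrow>
    (\<exists>\<^sub>s \<chi>. is_fm \<rho> \<chi> \<and> (\<forall>i. i \<epsilon> m \<longrightarrow> (\<forall>\<^sub>s q. \<langle>i, q\<rangle> \<epsilon> s \<longrightarrow> covers \<chi> q))))" for m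
  have "predicative (\<lambda>e. Q (e 0))"
    unfolding Q_def by (intro pred_intros; auto intro: setpI)
  then have "Q n" using n
  proof (rule nat_induct)
    \<comment> \<open>For the empty segment any formula will do as a start; some line of the proof
      provides one.\<close>
    obtain i where "i \<epsilon> n" using assms(3) extensionality[of n cempty] mem_cempty by blast
    then obtain q where "is_fm \<rho> q" using fun_on_value[OF s] by blast
    then show "Q cempty" unfolding Q_def using is_fm_setp by auto
  next
    fix m assume m: "is_nat m" and IH: "Q m"
    show "Q (csucc m)"
      unfolding Q_def
    proof
      assume asm: "csucc m \<epsilon> n \<or> csucc m = n"
      have "m \<epsilon> csucc m" using setp_nat[OF m] by (simp add: mem_csucc)
      then have mn: "m \<epsilon> n" using asm nat_trans[OF n] by blast
      then obtain \<chi> where \<chi>: "is_fm \<rho> \<chi>" "\<forall>i. i \<epsilon> m \<longrightarrow> (\<forall>\<^sub>s q. \<langle>i, q\<rangle> \<epsilon> s \<longrightarrow> covers \<chi> q)"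
        using IH unfolding Q_def by blast
      obtain p where p: "setp p" "is_fm \<rho> p" "\<langle>m, p\<rangle> \<epsilon> s" using fun_on_value[OF s mn] by blast
      obtain \<psi> where \<psi>: "is_fm \<rho> \<psi>" "covers \<psi> p" using covers_exists[OF p(2)] .
      have sets: "setp \<chi>" "setp \<psi>" using \<chi>(1) \<psi>(1) is_fm_setp by blast+
      have sub: "subfm \<chi> (Imp \<psi> \<chi>)" "subfm \<psi> (Imp \<psi> \<chi>)"
        using subfm_ImpI1 subfm_ImpI2 subfm_refl sets by simp_all
      have "covers (Imp \<psi> \<chi>) q" if i: "i \<epsilon> csucc m" and q: "setp q" "\<langle>i, q\<rangle> \<epsilon> s" for i q
      proof (cases "i = m")
        case True
        then have "q = p" using fun_on_unique[OF s _ p(3) setp_nat[OF m] q(1) p(1)] q(2) by simp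
        then show ?thesis using covers_mono[OF \<psi>(2) sub(2)] by simp
      next
        case False
        then have "i \<epsilon> m" using i by (simp add: mem_csucc)
        then show ?thesis using covers_mono[OF _ sub(1)] \<chi>(2) q by blast
      qed
      moreover have "is_fm \<rho> (Imp \<psi> \<chi>)" using \<psi>(1) \<chi>(1) by (rule is_fm_Imp)
      ultimately show "\<exists>\<^sub>s \<chi>. is_fm \<rho> \<chi> \<and> (\<forall>i. i \<epsilon> csucc m \<longrightarrow> (\<forall>\<^sub>s q. \<langle>i, q\<rangle> \<epsilon> s \<longrightarrow> covers \<chi> q))"
        using setp_code(6)[of \<psi> \<chi>] by blast
    qed
  qed
  then show ?thesis unfolding Q_def by blast
qed

section \<open>Enlarging assignments\<close>

lemma extend_to_term:
  assumes "partial_assignment A" "is_term \<rho> t"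
  obtains B where "partial_assignment B" "\<forall>p. p \<epsilon> A \<longrightarrow> p \<epsilon> B"
    "\<forall>x. is_var x \<and> occurs x t \<longrightarrow> in_dom B x"
proof -
  obtain W where W: "finite_set W" "\<forall>x. is_var x \<and> occurs x t \<longrightarrow> x \<epsilon> W"
    using finite_term_vars[OF assms(2)] by blast
  obtain B where B: "partial_assignment B" "\<forall>p. p \<epsilon> A \<longrightarrow> p \<epsilon> B" "\<forall>x. x \<epsilon> W \<longrightarrow> in_dom B x"
    using partial_assignment_extend[OF assms(1) W(1)] by (elim exE conjE)
  have "\<forall>x. is_var x \<and> occurs x t \<longrightarrow> in_dom B x" using B(3) W(2) by simp
  with B(1,2) show thesis by (rule that)
qed

lemma extend_to_fm:
  assumes "partial_assignment A" "is_fm \<rho> q"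
  obtains B where "assignment_for M q B" "\<forall>p. p \<epsilon> A \<longrightarrow> p \<epsilon> B"
proof -
  obtain W where W: "finite_set W" "\<forall>x. is_var x \<and> free x q \<longrightarrow> x \<epsilon> W"
    using finite_fm_vars[OF assms(2)] by blast
  obtain B where B: "partial_assignment B" "\<forall>p. p \<epsilon> A \<longrightarrow> p \<epsilon> B" "\<forall>x. x \<epsilon> W \<longrightarrow> in_dom B x"
    using partial_assignment_extend[OF assms(1) W(1)] by (elim exE conjE)
  have "assignment_for M q B" using B(1,3) W(2) unfolding assignment_for_iff by simp
  then show thesis using B(2) by (rule that)
qed

lemma equality_axiomI:
  assumes "setp x" "setp t" "setp u" "setp b" "setp c" "is_var x" "is_term \<rho> t" "is_term \<rho> u"
    "is_fm \<rho> a" "subst_fm x t a b" "subst_fm x u a c" "q = Imp (Eqn t u) (Imp b c)"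
  shows "equality_axiom a q"
  unfolding equality_axiom_def
  by (rule exI[of _ x], rule conjI, rule assms, rule exI[of _ t], rule conjI, rule assms,
      rule exI[of _ u], rule conjI, rule assms, rule exI[of _ b], rule conjI, rule assms,
      rule exI[of _ c]) (simp add: assms)

lemma logical_axiom_elim [consumes 1, case_names K S N inst dist refl eq]:
  assumes "logical_axiom \<rho> q"
  obtains a b where "setp a" "setp b" "q = Imp a (Imp b a)"
  | a b c where "setp a" "setp b" "setp c" "q = Imp (Imp a (Imp b c)) (Imp (Imp a b) (Imp a c))"
  | a b where "setp a" "setp b" "q = Imp (Imp (Neg a) (Neg b)) (Imp b a)"
  | x t a b where "setp x" "setp t" "setp a" "setp b" "is_var x" "is_term \<rho> t"
      "subst_fm x t a b" "q = Imp (All x a) b"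
  | x a b where "setp x" "setp a" "setp b" "is_var x" "\<not> free x a"
      "q = Imp (All x (Imp a b)) (Imp a (All x b))"
  | t where "setp t" "is_term \<rho> t" "q = Eqn t t"
  | a where "setp a" "equality_axiom a q"
  using conjunct2[OF assms[unfolded logical_axiom_def]]
  by (elim disjE exE conjE)
    ((rule that(1); assumption), (rule that(2); assumption), (rule that(3); assumption),
      (rule that(4); assumption), (rule that(5); assumption), (rule that(6); assumption),
      (rule that(7), assumption, rule equality_axiomI; assumption))

section \<open>Truth of the logical axioms\<close>

context
  fixes V \<chi>
  assumes ev: "evaluates V \<chi>"
begin

lemma truth_logical_axiom:
  assumes ax: "logical_axiom \<rho> q" and cov: "covers \<chi> q" and A: "assignment_for M q A"
  shows "truth V q A"
proof -
  note truth_Imp = truth_Imp[OF ev] and truth_Neg = truth_Neg[OF ev]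
    and extend = truth_extend[OF ev] and subst = truth_subst[OF ev]
  have q: "subfm q \<chi>" using cov by (simp add: covers_def)
  have pA: "partial_assignment A" using A by (rule assignment_for_partial)
  from ax show ?thesis
  proof (cases rule: logical_axiom_elim)
    case (K a b)
    have set: "setp (Imp b a)" by simp
    have sub: "subfm (Imp b a) \<chi>"
      using subfm_Imp[OF K(1) set q[unfolded K(3)]] by blast
    have asg: "assignment_for M (Imp b a) A"
      using A[unfolded K(3) assignment_for_Imp[OF K(1) set]] by blast
    show ?thesis
      unfolding K(3) truth_Imp[OF q[unfolded K(3)] A[unfolded K(3)] K(1) set]
        truth_Imp[OF sub asg K(2,1)]
      by blast
  next
    case (S a b c)
    have set: "setp (Imp a (Imp b c))" "setp (Imp (Imp a b) (Imp a c))" "setp (Imp b c)"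
      "setp (Imp a b)" "setp (Imp a c)"
      by simp_all
    have sub1: "subfm (Imp a (Imp b c)) \<chi>" "subfm (Imp (Imp a b) (Imp a c)) \<chi>"
      using subfm_Imp[OF set(1,2) q[unfolded S(4)]] by blast+
    have sub2: "subfm (Imp b c) \<chi>" "subfm (Imp a b) \<chi>" "subfm (Imp a c) \<chi>"
      using subfm_Imp[OF S(1) set(3) sub1(1)] subfm_Imp[OF set(4,5) sub1(2)] by blast+
    have asg1: "assignment_for M (Imp a (Imp b c)) A" "assignment_for M (Imp (Imp a b) (Imp a c)) A"
      using A[unfolded S(4) assignment_for_Imp[OF set(1,2)]] by blast+
    have asg2: "assignment_for M (Imp b c) A" "assignment_for M (Imp a b) A" "assignment_for M (Imp a c) A"
      using asg1[unfolded assignment_for_Imp[OF S(1) set(3)] assignment_for_Imp[OF set(4,5)]] by blast+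
    show ?thesis
      unfolding S(4) truth_Imp[OF q[unfolded S(4)] A[unfolded S(4)] set(1,2)]
        truth_Imp[OF sub1(1) asg1(1) S(1) set(3)] truth_Imp[OF sub1(2) asg1(2) set(4,5)]
        truth_Imp[OF sub2(1) asg2(1) S(2,3)] truth_Imp[OF sub2(2) asg2(2) S(1,2)]
        truth_Imp[OF sub2(3) asg2(3) S(1,3)]
      by blast
  next
    case (N a b)
    have set: "setp (Imp (Neg a) (Neg b))" "setp (Imp b a)" "setp (Neg a)" "setp (Neg b)" by simp_all
    have sub1: "subfm (Imp (Neg a) (Neg b)) \<chi>" "subfm (Imp b a) \<chi>"
      using subfm_Imp[OF set(1,2) q[unfolded N(3)]] by blast+
    have sub2: "subfm (Neg a) \<chi>" "subfm (Neg b) \<chi>"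
      using subfm_Imp[OF set(3,4) sub1(1)] by blast+
    have asg1: "assignment_for M (Imp (Neg a) (Neg b)) A" "assignment_for M (Imp b a) A"
      using A[unfolded N(3) assignment_for_Imp[OF set(1,2)]] by blast+
    have asg2: "assignment_for M (Neg a) A" "assignment_for M (Neg b) A"
      using asg1(1)[unfolded assignment_for_Imp[OF set(3,4)]] by blast+
    show ?thesis
      unfolding N(3) truth_Imp[OF q[unfolded N(3)] A[unfolded N(3)] set(1,2)]
        truth_Imp[OF sub1(1) asg1(1) set(3,4)] truth_Imp[OF sub1(2) asg1(2) N(2,1)]
        truth_Neg[OF sub2(1) asg2(1) N(1)] truth_Neg[OF sub2(2) asg2(2) N(2)]
      by blast
  next
    case (inst x t a b)
    have sub: "subfm (All x a) \<chi>" "subfm b \<chi>" using subfm_Imp[OF setp_code(7) inst(4) q[unfolded inst(8)]] by blast+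
    have asg: "assignment_for M (All x a) A" "assignment_for M b A" using A[unfolded inst(8) assignment_for_Imp[OF setp_code(7) inst(4)]] by blast+
    have suba: "subfm a \<chi>" using subfm_All[OF inst(1,3) sub(1)] .
    \<comment> \<open>When \<open>x\<close> is not free in \<open>a\<close>, variables of
      \<open>t\<close> need not be free in the axiom, and \<open>A\<close> may leave
      \<open>t\<close> without a value. The two sides keep their truth values under the extension
      \<open>B\<close>.\<close>
    obtain B where B: "partial_assignment B" "\<forall>p. p \<epsilon> A \<longrightarrow> p \<epsilon> B"
      "\<forall>x. is_var x \<and> occurs x t \<longrightarrow> in_dom B x"
      by (rule extend_to_term[OF pA inst(6)])
    obtain d where d: "d \<epsilon> universe M" "tm_val M B t d" using tm_val_exists[OF B(1) inst(6) B(3)] by (elim exE conjE)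
    note eB = extend[OF sub(1) asg(1) B(1,2)] extend[OF sub(2) asg(2) B(1,2)]
    have "truth V b B" if "truth V (All x a) B"
    proof -
      have "truth V a (update B x d)" using that[unfolded truth_All[OF ev sub(1) eB(1) inst(1,3)]] d(1) by blast
      then show ?thesis
        by (rule iffD1[OF subst[OF inst(5,2,7) suba sub(2)
            assignment_for_update[OF eB(1) inst(1,3) d(1)] eB(3) d]])
    qed
    then show ?thesis
      unfolding inst(8) truth_Imp[OF q[unfolded inst(8)] A[unfolded inst(8)] setp_code(7) inst(4)] eB(2,4)
      by blast
  next
    case (dist x a b)
    have set: "setp (All x (Imp a b))" "setp (Imp a (All x b))" "setp (Imp a b)" "setp (All x b)" by simp_all
    have sub1: "subfm (All x (Imp a b)) \<chi>" "subfm (Imp a (All x b)) \<chi>"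
      using subfm_Imp[OF set(1,2)] q dist(6) by simp_all
    have asg1: "assignment_for M (All x (Imp a b)) A" "assignment_for M (Imp a (All x b)) A"
      using assignment_for_Imp[OF set(1,2)] A dist(6) by simp_all
    have sub2: "subfm (Imp a b) \<chi>" "subfm a \<chi>" "subfm (All x b) \<chi>"
      using subfm_All[OF dist(1) set(3) sub1(1)] subfm_Imp[OF dist(2) set(4) sub1(2)] by simp_all
    have asg2: "assignment_for M a A" "assignment_for M (All x b) A"
      using assignment_for_Imp[OF dist(2) set(4)] asg1(2) by simp_all
    have "truth V b (update A x d)"
      if all: "truth V (All x (Imp a b)) A" and a: "truth V a A" and d: "d \<epsilon> universe M" for d
    proof -
      have sd: "setp d" using d by (rule setpI)
      have asg3: "assignment_for M (Imp a b) (update A x d)"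
        using assignment_for_update[OF asg1(1) dist(1) set(3) d] .
      then have asg4: "assignment_for M a (update A x d)"
        using assignment_for_Imp[OF dist(2,3)] by simp
      have "truth V (Imp a b) (update A x d)"
        using truth_All[OF ev sub1(1) asg1(1) dist(1) set(3)] all d by blast
      moreover have "truth V a (update A x d)"
      proof -
        \<comment> \<open>Updating at \<open>x\<close> leaves the truth of \<open>a\<close>
          unchanged because \<open>x\<close> is not free in it.\<close>
        have "\<forall>y. is_var y \<and> free y a \<longrightarrow> (\<forall>\<^sub>s c. \<langle>y, c\<rangle> \<epsilon> A \<longleftrightarrow> \<langle>y, c\<rangle> \<epsilon> update A x d)"
        proof (intro allI impI)
          fix y c assume y: "is_var y \<and> free y a" and c: "setp c"
          have "y \<noteq> x" using y dist(5) by metis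
          then show "\<langle>y, c\<rangle> \<epsilon> A \<longleftrightarrow> \<langle>y, c\<rangle> \<epsilon> update A x d"
            using pair_mem_update[OF dist(1) sd _ c] is_var_setp y by simp
        qed
        then show ?thesis using truth_coincidence[OF ev sub2(2) asg2(1) asg4] a by simp
      qed
      ultimately show ?thesis using truth_Imp[OF sub2(1) asg3 dist(2,3)] by simp
    qed
    then show ?thesis
      unfolding dist(6) truth_Imp[OF q[unfolded dist(6)] A[unfolded dist(6)] set(1,2)]
        truth_Imp[OF sub1(2) asg1(2) dist(2) set(4)] truth_All[OF ev sub2(3) asg2(2) dist(1,3)]
      by blast
  next
    case (refl t)
    have "\<forall>x. is_var x \<and> occurs x t \<longrightarrow> in_dom A x"
      using A refl unfolding assignment_for_iff by (simp add: free_Eqn)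
    from tm_val_exists[OF pA refl(2) this] obtain b where b: "b \<epsilon> universe M" "tm_val M A t b"
      by (elim exE conjE)
    then show ?thesis
      unfolding refl(3) truth_Eqn[OF ev q[unfolded refl(3)] A[unfolded refl(3)] refl(1,1)]
      using setpI[OF b(1)] by blast
  next
    case (eq a')
    \<comment> \<open>The formula \<open>a'\<close> found in the axiom need not lie in \<chi>. The
      hypothesis \<open>covers \<chi> q\<close> provides one that does, with its own
      \<open>x\<close>, \<open>t\<close>, \<open>u\<close>, \<open>b\<close> and
      \<open>c\<close>.\<close>
    then obtain a where a: "setp a" "equality_axiom a q" "subfm a \<chi>"
      using cov unfolding covers_def by blast
    then obtain x t u b c where ax: "setp x" "setp t" "setp u" "setp b" "setp c" "is_var x"
        "is_term \<rho> t" "is_term \<rho> u" "is_fm \<rho> a" "subst_fm x t a b" "subst_fm x u a c"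
        "q = Imp (Eqn t u) (Imp b c)"
      unfolding equality_axiom_def by blast
    have set: "setp (Eqn t u)" "setp (Imp b c)" by simp_all
    have sub: "subfm (Eqn t u) \<chi>" "subfm (Imp b c) \<chi>" "subfm b \<chi>" "subfm c \<chi>"
      using subfm_Imp[OF set] subfm_Imp[OF ax(4,5)] q ax(12) by simp_all
    have asg: "assignment_for M (Eqn t u) A" "assignment_for M (Imp b c) A"
      "assignment_for M b A" "assignment_for M c A"
      using assignment_for_Imp[OF set] assignment_for_Imp[OF ax(4,5)] A ax(12) by simp_all
    \<comment> \<open>The assignment must also serve \<open>a\<close>, through which
      \<open>b\<close> and \<open>c\<close> are compared: both are equivalent to \<open>a\<close> at
      \<open>update B x d\<close>, where \<open>d\<close> is the common value of \<open>t\<close>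
      and \<open>u\<close>.\<close>
    obtain B where B: "assignment_for M a B" "\<forall>p. p \<epsilon> A \<longrightarrow> p \<epsilon> B"
      by (rule extend_to_fm[OF pA ax(9)])
    note pB = assignment_for_partial[OF B(1)]
    note eB = extend[OF sub(3) asg(3) pB B(2)] extend[OF sub(4) asg(4) pB B(2)]
      extend[OF sub(1) asg(1) pB B(2)]
    have "truth V b A \<longleftrightarrow> truth V c A" if te: "truth V (Eqn t u) A"
    proof -
      obtain d where d: "setp d" "tm_val M B t d" "tm_val M B u d"
        using te[unfolded eB(6) truth_Eqn[OF ev sub(1) eB(5) ax(2,3)]] by (elim exE conjE)
      have dU: "d \<epsilon> universe M" using tm_val_in_universe[OF pB d(2) ax(2) d(1)] .
      \<comment> \<open>A detour that turns \<open>assignment_for_update\<close> into a statement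
        about \<open>a\<close> itself.\<close>
      have "assignment_for M (All x a) B"
        using B(1) by (rule assignment_for_mono) (simp add: free_All[OF ax(1) a(1)])
      then have aB: "assignment_for M a (update B x d)"
        using assignment_for_update ax(1) a(1) dU by blast
      show ?thesis
        using subst[OF ax(6,2,10) a(3) sub(3) aB eB(1) dU d(2)]
          subst[OF ax(6,3,11) a(3) sub(4) aB eB(3) dU d(3)] eB(2,4) by simp
    qed
    then show ?thesis
      unfolding ax(12) truth_Imp[OF q[unfolded ax(12)] A[unfolded ax(12)] set]
        truth_Imp[OF sub(2) asg(2) ax(4,5)]
      by blast
  qed
qed

end

section \<open>From theory members to the last line\<close>

text \<open>Universal satisfaction says something only once a satisfaction relation for
  \<open>q\<close> exists. Weak satisfactoriness yields one, and its valuation \<open>W\<close>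
  agrees with \<open>V\<close> on \<open>q\<close>.\<close>

lemma truth_theory_member:
  assumes ev: "evaluates V \<chi>" and ws: "weakly_satisfactory \<rho> M"
    and "usat M q" "subfm q \<chi>" "assignment_for M q A"
  shows "truth V q A"
proof -
  have q: "is_fm \<rho> q" using is_fm_sub[OF ev assms(4)] .
  then obtain S where S: "is_sat_relation M (sing q) S"
    using ws unfolding weakly_satisfactory_def by blast
  obtain W where W: "evaluates W q" "\<forall>\<^sub>s A. \<langle>q, A\<rangle> \<epsilon> S \<longleftrightarrow> truth W q A"
    by (rule evaluates_exists[OF S q])
  have "\<langle>q, A\<rangle> \<epsilon> S" using assms(3,5) S unfolding usat_def usat_at_def by blast
  then have "truth W q A" using W(2)[rule_format, OF assignment_for_setp[OF assms(5)]] by simp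
  then show ?thesis
    using truth_unique[OF ev W(1) assms(4) subfm_refl[OF is_fm_setp[OF q]] assms(5)] by simp
qed

lemma truth_proof_line:
  assumes ev: "evaluates V \<chi>" and ws: "weakly_satisfactory \<rho> M" and us: "usat_theory M \<Theta>"
    and pf: "is_proof \<rho> \<Theta> n s"
    and cov: "\<forall>i. i \<epsilon> n \<longrightarrow> (\<forall>\<^sub>s q. \<langle>i, q\<rangle> \<epsilon> s \<longrightarrow> covers \<chi> q)"
    and "i \<epsilon> n" "setp q" "\<langle>i, q\<rangle> \<epsilon> s" "assignment_for M q A"
  shows "truth V q A"
proof -
  have n: "is_nat n" and lines: "fun_on s n (is_fm \<rho>)"
    and rules: "\<forall>i. i \<epsilon> n \<longrightarrow> (\<forall>\<^sub>s q. \<langle>i, q\<rangle> \<epsilon> s \<longrightarrow>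
            q \<epsilon> \<Theta>
          \<or> logical_axiom \<rho> q
          \<or> (\<exists>j k. \<exists>\<^sub>s p. j \<epsilon> i \<and> k \<epsilon> i \<and> \<langle>j, p\<rangle> \<epsilon> s \<and> \<langle>k, Imp p q\<rangle> \<epsilon> s)
          \<or> (\<exists>j. \<exists>\<^sub>s x. \<exists>\<^sub>s p. j \<epsilon> i \<and> is_var x \<and> \<langle>j, p\<rangle> \<epsilon> s \<and> q = All x p))"
    using pf unfolding is_proof_def by blast+
  \<comment> \<open>Truth is claimed under every assignment, since generalization updates the
    assignment and modus ponens enlarges it. Plain \<epsilon>-induction fits because the rules cite
    lines whose numbers are elements of \<open>i\<close>.\<close>
  define Q where "Q i \<longleftrightarrow> (i \<epsilon> n \<longrightarrow> (\<forall>\<^sub>s q. \<langle>i, q\<rangle> \<epsilon> s \<longrightarrow>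
    (\<forall>\<^sub>s A. assignment_for M q A \<longrightarrow> truth V q A)))" for i
  have "predicative (\<lambda>e. Q (e 0))"
    unfolding Q_def by (intro pred_intros; auto)
  then have "Q i" using setpI[OF assms(6)]
  proof (rule eps_induct)
    fix i assume IH: "\<And>j. j \<epsilon> i \<Longrightarrow> Q j"
    show "Q i"
      unfolding Q_def
    proof (intro impI allI)
      fix q A
      assume i: "i \<epsilon> n" and sq: "setp q" and q: "\<langle>i, q\<rangle> \<epsilon> s" and A: "assignment_for M q A"
      have IH': "truth V p B" if "j \<epsilon> i" "\<langle>j, p\<rangle> \<epsilon> s" "setp p" "assignment_for M p B" for j p B
        using IH[OF that(1)] nat_trans[OF n i that(1)] that(2-4) assignment_for_setp[OF that(4)]
        unfolding Q_def by simp
      have sub: "subfm p \<chi>" if "j \<epsilon> i \<or> j = i" "\<langle>j, p\<rangle> \<epsilon> s" "setp p" for j p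
      proof -
        have "j \<epsilon> n" using that(1) i nat_trans[OF n i] by metis
        then show ?thesis using cov that(2,3) unfolding covers_def by metis
      qed
      have subq: "subfm q \<chi>" using sub q sq by blast
      have "q \<epsilon> \<Theta> \<or> logical_axiom \<rho> q
          \<or> (\<exists>j k. \<exists>\<^sub>s p. j \<epsilon> i \<and> k \<epsilon> i \<and> \<langle>j, p\<rangle> \<epsilon> s \<and> \<langle>k, Imp p q\<rangle> \<epsilon> s)
          \<or> (\<exists>j. \<exists>\<^sub>s x. \<exists>\<^sub>s p. j \<epsilon> i \<and> is_var x \<and> \<langle>j, p\<rangle> \<epsilon> s \<and> q = All x p)"
        using rules i sq q by simp
      then show "truth V q A"
      proof (elim disjE exE conjE)
        assume "q \<epsilon> \<Theta>"
        then have "usat M q" using us by (simp add: usat_theory_def)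
        then show ?thesis using truth_theory_member[OF ev ws _ subq A] by simp
      next
        assume "logical_axiom \<rho> q"
        moreover have "covers \<chi> q" using cov i sq q by simp
        ultimately show ?thesis using truth_logical_axiom[OF ev _ _ A] by simp
      next
        fix j k p
        assume p: "setp p" "j \<epsilon> i" "k \<epsilon> i" "\<langle>j, p\<rangle> \<epsilon> s" "\<langle>k, Imp p q\<rangle> \<epsilon> s"
        have sub_imp: "subfm (Imp p q) \<chi>" using sub[OF _ p(5)] p(3) by simp
        have fp: "is_fm \<rho> p" using is_fm_sub[OF ev sub[OF _ p(4,1)]] p(2) by simp
        \<comment> \<open>The formula \<open>p\<close> disappears in the conclusion and may have
          free variables without a value in \<open>A\<close>. The truth of \<open>q\<close> is moved
          to \<open>B\<close> and back.\<close>
        obtain B where B: "assignment_for M p B" "\<forall>z. z \<epsilon> A \<longrightarrow> z \<epsilon> B"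
          by (rule extend_to_fm[OF assignment_for_partial[OF A] fp])
        note eB = truth_extend[OF ev subq A assignment_for_partial[OF B(1)] B(2)]
        have asg: "assignment_for M (Imp p q) B"
          using assignment_for_Imp[OF p(1) sq] B(1) eB(1) by simp
        have "truth V p B" using IH'[OF p(2,4,1) B(1)] .
        moreover have "truth V (Imp p q) B" using IH'[OF p(3,5) setp_code(6) asg] .
        ultimately have "truth V q B" using truth_Imp[OF ev sub_imp asg p(1) sq] by simp
        then show ?thesis using eB(2) by simp
      next
        fix j x p
        assume p: "setp x" "setp p" "j \<epsilon> i" "is_var x" "\<langle>j, p\<rangle> \<epsilon> s" "q = All x p"
        have "truth V p (update A x b)" if "b \<epsilon> universe M" for b
          using IH'[OF p(3,5,2)] assignment_for_update[OF A[unfolded p(6)] p(1,2) that] by simp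
        then show ?thesis
          unfolding p(6) truth_All[OF ev subq[unfolded p(6)] A[unfolded p(6)] p(1,2)] by simp
      qed
    qed
  qed
  then show ?thesis using assms(6-9) assignment_for_setp[OF assms(9)] unfolding Q_def by simp
qed

lemma soundness:
  assumes ws: "weakly_satisfactory \<rho> M" and us: "usat_theory M \<Theta>" and pr: "proves \<rho> \<Theta> q"
    and q: "is_fm \<rho> q"
  shows "usat M q"
proof -
  obtain i s where i: "setp i" and s: "setp s" and pf: "is_proof \<rho> \<Theta> (csucc i) s"
    and iq: "\<langle>i, q\<rangle> \<epsilon> s"
    using pr unfolding proves_def by blast
  have n: "is_nat (csucc i)" "fun_on s (csucc i) (is_fm \<rho>)"
    using pf unfolding is_proof_def by blast+
  have sq: "setp q" using q by (rule is_fm_setp)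
  have ii: "i \<epsilon> csucc i" using i by (simp add: mem_csucc)
  obtain \<chi> where \<chi>: "is_fm \<rho> \<chi>"
    and cov: "\<forall>j. j \<epsilon> csucc i \<longrightarrow> (\<forall>\<^sub>s p. \<langle>j, p\<rangle> \<epsilon> s \<longrightarrow> covers \<chi> p)"
    \<comment> \<open>A proof has length \<open>csucc i\<close> with \<open>i\<close> the number of
      its last line, so it is nonempty and has a formula to start from.\<close>
    using covers_sequence[OF n csucc_neq_cempty[OF i]] by (elim exE conjE)
  obtain S where S: "is_sat_relation M (sing \<chi>) S"
    using ws \<chi> unfolding weakly_satisfactory_def by blast
  obtain V where V: "evaluates V \<chi>"
    by (rule evaluates_exists[OF S \<chi>])
  have subq: "subfm q \<chi>" using cov ii sq iq unfolding covers_def by blast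
  show ?thesis
    unfolding usat_def usat_at_def
  proof (intro allI impI)
    fix A S
    assume A: "assignment_for M q A" and S: "is_sat_relation M (sing q) S"
    obtain W where W: "evaluates W q" "\<forall>\<^sub>s A. \<langle>q, A\<rangle> \<epsilon> S \<longleftrightarrow> truth W q A"
      by (rule evaluates_exists[OF S q])
    have "truth V q A" using truth_proof_line[OF V ws us pf cov ii sq iq A] .
    then have "truth W q A"
      using truth_unique[OF V W(1) subq subfm_refl[OF sq] A] by simp
    then show "\<langle>q, A\<rangle> \<epsilon> S" using W(2)[rule_format, OF assignment_for_setp[OF A]] by simp
  qed
qed

end

theorem theorem2p12:
  fixes mem :: "'c \<Rightarrow> 'c \<Rightarrow> bool"
    and \<rho> :: "'c signature" and \<SS> :: "'c struct" and \<Theta> \<sigma> :: 'c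
  assumes "class_theory_C mem"
    and "class_language.is_signature mem \<rho>"
    and "class_language.is_struct mem \<rho> \<SS>"
    and "class_language.weakly_satisfactory mem \<rho> \<SS>"
    and "class_language.is_theory mem \<rho> \<Theta>"
    and "class_language.is_sentence mem \<rho> \<sigma>"
    and "class_language.usat_theory mem \<SS> \<Theta>"
    and "class_language.proves mem \<rho> \<Theta> \<sigma>"
  shows "class_language.usat mem \<SS> \<sigma>"
proof -
  interpret class_theory_C mem by fact
  interpret class_structure mem \<rho> \<SS>
    by unfold_locales (fact assms(2), fact assms(3))
  from assms(6) have "is_fm \<rho> \<sigma>" by (simp add: is_sentence_def)
  with assms(4,7,8) show ?thesis by (rule_tac soundness)
qed

end
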